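(* Let $\pi=(\pi^n)_{n\ge1}$, $\pi^n=(0=t^n_0<t^n_1<\cdots<t^n_{m(n)}=T)$, be a sequence of partitions of $[0,T]$ and let $\omega\in Q_\pi([0,T],\mathbb{R}^d)\cap C^\nu([0,T],\mathbb{R}^d)$ with $\nu>\frac{\sqrt{13}-1}{6}$ satisfy $$\max_{0\le j\le m(n)-1}\ \sup_{t\in(t^n_j,t^n_{j+1}]}|\omega(t)-\omega(t^n_j)|\xrightarrow[n\to\infty]{}0 .$$ Assume that $F\in\mathbb{C}^{1,2}_b(\Lambda^d_T)$ is such that $\nabla_\omega F,\nabla^2_\omega F\in\mathbb{C}^{1,1}_b(\Lambda^d_T)$, that $F,\mathcal{D}F,\nabla^3_\omega F\in Lip(\Lambda^d_T,\|\cdot\|_\infty)$, and that $\nabla^3_\omega F$ is horizontally locally Lipschitz. Then the pathwise integral is a limit of non-anticipative Riemann sums: $$\int_0^T\nabla_\omega F(u,\omega)\,d^\pi\omega(u)=\lim_{n\to\infty}\sum_{i=0}^{m(n)-1}\nabla_\omega F(t^n_i,\omega)\cdot(\omega(t^n_{i+1})-\omega(t^n_i)).$$ In particular, its value only depends on $\nabla_\omega F(\cdot,\omega)$, and $$\nabla_\omega F(\cdot,\omega)=0\ \Longrightarrow\ \int_0^T\nabla_\omega F(u,\omega)\,d^\pi\omega(u)=0 .$$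
   Context: Fix $T>0$ and $d\ge 1$. $D([0,T],\mathbb{R}^d)$ is the set of càdlàg paths. For a path $\omega$, $\omega_t:=\omega(t\wedge\cdot)$ is the path stopped at $t$, and $\omega_{t-}$ is the path equal to $\omega$ on $[0,t)$ and to $\omega(t-)$ on $[t,T]$. The space of stopped paths $\Lambda^d_T=\{(t,\omega_t):(t,\omega)\in[0,T]\times D([0,T],\mathbb{R}^d)\}$ carries the metric $d_\infty((t,\omega),(t',\omega'))=\|\omega_t-\omega'_{t'}\|_\infty+|t-t'|$, where $\|\cdot\|_\infty$ is the sup norm on $[0,T]$. A non-anticipative functional is a measurable map $F:(\Lambda^d_T,d_\infty)\to\mathbb{R}$ (so $F(t,\omega)=F(t,\omega_t)$); vector-, matrix- or tensor-valued functionals are treated componentwise. Regularity: $F$ is continuous at fixed times if for all $t,\omega,\epsilon>0$ there is $\eta>0$ such that $\|\omega_t-\omega'_t\|_\infty<\eta$ implies $|F(t,\omega)-F(t,\omega')|<\epsilon$. $F$ is left-continuous ($F\in\mathbb{C}^{0,0}_l(\Lambda^d_T)$) if for all $(t,\omega)\in\Lambda_T^d$, $\epsilon>0$ there is $\eta>0$ such that for $(t',\omega')\in\Lambda_T^d$, $t'<t$ and $d_\infty((t,\omega),(t',\omega'))<\eta$ imply $|F(t,\omega)-F(t',\omega')|<\epsilon$. $F$ is boundedness-preserving ($F\in\mathbb{B}(\Lambda^d_T)$) if for every compact $K\subset\mathbb{R}^d$ and $t_0\in[0,T]$ there is $C(K,t_0)>0$ with $|F(t,\omega)|<C(K,t_0)$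 whenever $t\le t_0$ and $\omega([0,t])\subset K$. Derivatives: the horizontal derivative is $\mathcal{D}F(t,\omega)=\lim_{h\to0^+}\frac{F(t+h,\omega_t)-F(t,\omega_t)}{h}$ (for $t<T$, so that $t+h\le T$). The vertical derivative $\nabla_\omega F(t,\omega)\in\mathbb{R}^d$ is the gradient at $e=0$ of $e\mapsto F(t,\omega_t+e\mathbf{1}_{[t,T]})$ (this map being required to be differentiable at $0$); $\nabla^j_\omega F$ is the iterated vertical derivative, $\nabla_\omega^0F=F$. $\mathbb{C}^{1,k}_b(\Lambda^d_T)$ is the set of non-anticipative functionals $F$ that are horizontally differentiable with $\mathcal{D}F$ continuous at fixed times, $k$ times vertically differentiable with $\nabla^j_\omega F\in\mathbb{C}^{0,0}_l(\Lambda^d_T)$ for $j=0,\dots,k$, and with $\mathcal{D}F,\nabla_\omega F,\dots,\nabla^k_\omega F\in\mathbb{B}(\Lambda^d_T)$. $Lip(\Lambda^d_T,\|\cdot\|_\infty)$ is the set of non-anticipative functionals for which there is $K>0$ with $|F(t,\omega)-F(t,\omega')|\le K\|\omega_t-\omega'_t\|_\infty$ for all $t\in[0,T]$ and all $\omega,\omega'\in D([0,T],\mathbb{R}^d)$. A non-anticipative functional $G$ with values in a finite-dimensional real vector space is horizontally locally Lipschitz if for every $\omega\in D([0,T],\mathbb{R}^d)$ there are $C>0$, $\eta>0$ such that for all $h\ge0$, all $t\le T-h$ and all $\omega'\in D([0,T],\mathbb{R}^d)$, $\|\omega_t-\omega'_t\|_\infty<\eta$ implies $|G(t+h,\omega'_t)-G(t,\omega'_t)|\le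 Ch$. Quadratic variation: a càdlàg $x:[0,T]\to\mathbb{R}$ is in $Q_\pi([0,T],\mathbb{R})$ if for every $t\in[0,T]$ the limit $[x]_\pi(t)=\lim_{n}\sum_{t^n_{i+1}\le t}(x(t^n_{i+1})-x(t^n_i))^2<\infty$ exists and $[x]_\pi(t)=[x]^c_\pi(t)+\sum_{0<s\le t}|\Delta x(s)|^2$ with $[x]_\pi^c$ continuous and increasing. $x\in Q_\pi([0,T],\mathbb{R}^d)$ if $x^i$ and $x^i+x^j$ are in $Q_\pi([0,T],\mathbb{R})$ for all $i,j$. $C^\nu([0,T],\mathbb{R}^d)$, $0<\nu<1$, is the space of $\nu$-Hölder continuous functions. Pathwise integral: for continuous $\omega$ let $\omega^n=\sum_{i}\omega(t^n_{i+1})\mathbf{1}_{[t^n_i,t^n_{i+1})}+\omega(T)\mathbf{1}_{\{T\}}$. Then $\int_0^T\nabla_\omega F(s,\omega)\,d^\pi\omega:=\lim_{n}\sum_{i=0}^{m(n)-1}\nabla_\omega F(t^n_i,\omega^n_{t^n_i-})\cdot(\omega(t^n_{i+1})-\omega(t^n_i))$, i.e. the integrand is evaluated along the piecewise constant approximation $\omega^n$ rather than along $\omega$. *)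

theory Defs
  imports "HOL-Analysis.Analysis"
begin

section \<open>Paths\<close>

text \<open>A path on \<open>[0,T]\<close> is a function on \<open>real\<close> that is extensional on \<open>{0..T}\<close>, so that
  equality of such functions is equality of paths.\<close>

definition cadlag :: "real \<Rightarrow> (real \<Rightarrow> 'a::real_normed_vector) set" where
  "cadlag T = {x \<in> extensional {0..T}.
     (\<forall>t\<in>{0..<T}. continuous (at_right t) x) \<and>
     (\<forall>t\<in>{0<..T}. \<exists>l. (x \<longlongrightarrow> l) (at_left t))}"

text \<open>The usual convention \<open>x(0-) = x(0)\<close> is adopted.\<close>

definition left_lim :: "(real \<Rightarrow> 'a::real_normed_vector) \<Rightarrow> real \<Rightarrow> 'a" where
  "left_lim x t = (if 0 < t then Lim (at_left t) x else x t)"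

definition jump :: "(real \<Rightarrow> 'a::real_normed_vector) \<Rightarrow> real \<Rightarrow> 'a" where
  "jump x t = x t - left_lim x t"

definition stop :: "real \<Rightarrow> real \<Rightarrow> (real \<Rightarrow> 'a) \<Rightarrow> real \<Rightarrow> 'a" where
  "stop T t x = (\<lambda>s\<in>{0..T}. x (min t s))"

definition stop_left :: "real \<Rightarrow> real \<Rightarrow> (real \<Rightarrow> 'a::real_normed_vector) \<Rightarrow> real \<Rightarrow> 'a" where
  "stop_left T t x = (\<lambda>s\<in>{0..T}. if s < t then x s else left_lim x t)"

definition bump :: "real \<Rightarrow> real \<Rightarrow> (real \<Rightarrow> 'a::real_normed_vector) \<Rightarrow> 'a \<Rightarrow> real \<Rightarrow> 'a" where
  "bump T t x e = (\<lambda>s\<in>{0..T}. stop T t x s + indicator {t..T} s *\<^sub>R e)"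

definition sup_norm :: "real \<Rightarrow> (real \<Rightarrow> 'a::real_normed_vector) \<Rightarrow> real" where
  "sup_norm T x = (SUP s\<in>{0..T}. norm (x s))"

definition holder_paths :: "real \<Rightarrow> real \<Rightarrow> (real \<Rightarrow> 'a::real_normed_vector) set" where
  "holder_paths T \<nu> = {x \<in> extensional {0..T}.
     \<exists>C. \<forall>s\<in>{0..T}. \<forall>t\<in>{0..T}. norm (x t - x s) \<le> C * \<bar>t - s\<bar> powr \<nu>}"

section \<open>Non-anticipative functionals\<close>

definition stopped_paths :: "real \<Rightarrow> (real \<times> (real \<Rightarrow> 'a::real_normed_vector)) set" where
  "stopped_paths T = {(t, stop T t x) | t x. t \<in> {0..T} \<and> x \<in> cadlag T}"

definition d_inf :: "real \<Rightarrow> real \<times> (real \<Rightarrow> 'a::real_normed_vector)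
    \<Rightarrow> real \<times> (real \<Rightarrow> 'a) \<Rightarrow> real" where
  "d_inf T = (\<lambda>(t, x) (t', x').
     sup_norm T (\<lambda>s. stop T t x s - stop T t' x' s) + \<bar>t - t'\<bar>)"

text \<open>The Borel sigma-algebra of the metric space of stopped paths. The open sets are spelled out,
  because \<^const>\<open>d_inf\<close> is a metric only on \<^const>\<open>stopped_paths\<close>, whereas the locale
  for metric spaces also constrains the distance outside of its carrier.\<close>

definition stopped_borel :: "real \<Rightarrow> (real \<times> (real \<Rightarrow> 'a::real_normed_vector)) measure" where
  "stopped_borel T = sigma (stopped_paths T)
     {U. U \<subseteq> stopped_paths T \<and>
         (\<forall>p\<in>U. \<exists>r>0. \<forall>q\<in>stopped_paths T. d_inf T p q < r \<longrightarrow> q \<in> U)}"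

text \<open>Only the values of a functional on \<open>{0..T} \<times> cadlag T\<close> are meaningful.\<close>

type_synonym ('d, 'b) functional = "real \<Rightarrow> (real \<Rightarrow> real ^ 'd) \<Rightarrow> 'b"

definition non_anticipative :: "real \<Rightarrow> ('d::finite, 'b::euclidean_space) functional set" where
  "non_anticipative T = {F.
     (\<lambda>(t, x). F t x) \<in> borel_measurable (stopped_borel T) \<and>
     (\<forall>t\<in>{0..T}. \<forall>x\<in>cadlag T. F t x = F t (stop T t x))}"

definition cont_fixed_times :: "real \<Rightarrow> ('d::finite, real) functional set" where
  "cont_fixed_times T = {F \<in> non_anticipative T.
     \<forall>t\<in>{0..T}. \<forall>x\<in>cadlag T. \<forall>\<epsilon>>0. \<exists>\<eta>>0. \<forall>x'\<in>cadlag T.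
       sup_norm T (\<lambda>s. stop T t x s - stop T t x' s) < \<eta> \<longrightarrow> \<bar>F t x - F t x'\<bar> < \<epsilon>}"

definition left_cont :: "real \<Rightarrow> ('d::finite, real) functional set" where
  "left_cont T = {F \<in> non_anticipative T.
     \<forall>(t, x)\<in>stopped_paths T. \<forall>\<epsilon>>0. \<exists>\<eta>>0. \<forall>(t', x')\<in>stopped_paths T.
       t' < t \<and> d_inf T (t, x) (t', x') < \<eta> \<longrightarrow> \<bar>F t x - F t' x'\<bar> < \<epsilon>}"

definition bdd_preserving :: "real \<Rightarrow> ('d::finite, real) functional set" where
  "bdd_preserving T = {F \<in> non_anticipative T.
     \<forall>K t0. compact K \<and> t0 \<in> {0..T} \<longrightarrow>
       (\<exists>C>0. \<forall>t\<in>{0..t0}. \<forall>x\<in>cadlag T. x ` {0..t} \<subseteq> K \<longrightarrow> \<bar>F t x\<bar> < C)}"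

definition lip_functionals :: "real \<Rightarrow> ('d::finite, real) functional set" where
  "lip_functionals T = {F \<in> non_anticipative T.
     \<exists>K>0. \<forall>t\<in>{0..T}. \<forall>x\<in>cadlag T. \<forall>x'\<in>cadlag T.
       \<bar>F t x - F t x'\<bar> \<le> K * sup_norm T (\<lambda>s. stop T t x s - stop T t x' s)}"

definition horiz_loc_lip :: "real \<Rightarrow> ('d::finite, 'b::euclidean_space) functional set" where
  "horiz_loc_lip T = {G \<in> non_anticipative T.
     \<forall>x\<in>cadlag T. \<exists>C>0. \<exists>\<eta>>0. \<forall>h\<ge>0. \<forall>t\<in>{0..T - h}. \<forall>x'\<in>cadlag T.
       sup_norm T (\<lambda>s. stop T t x s - stop T t x' s) < \<eta> \<longrightarrow>
       norm (G (t + h) (stop T t x') - G t (stop T t x')) \<le> C * h}"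

section \<open>Horizontal and vertical derivatives\<close>

definition horiz_differentiable :: "real \<Rightarrow> ('d::finite, real) functional \<Rightarrow> bool" where
  "horiz_differentiable T F \<longleftrightarrow> (\<forall>t\<in>{0..<T}. \<forall>x\<in>cadlag T. \<exists>l.
     ((\<lambda>h. (F (t + h) (stop T t x) - F t (stop T t x)) / h) \<longlongrightarrow> l) (at_right 0))"

text \<open>The horizontal derivative exists only for \<open>t < T\<close>. It is set to \<open>0\<close> at time \<open>T\<close>, where
  this makes the conditions imposed on it below (continuity at fixed times, boundedness,
  Lipschitz continuity; all of them compare values at the same time) hold trivially.\<close>

definition horiz_deriv :: "real \<Rightarrow> ('d::finite, real) functional \<Rightarrow> ('d, real) functional" where
  "horiz_deriv T F t x = (if t < T
     then Lim (at_right 0) (\<lambda>h. (F (t + h) (stop T t x) - F t (stop T t x)) / h) else 0)"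

definition vert_differentiable :: "real \<Rightarrow> ('d::finite, real) functional \<Rightarrow> bool" where
  "vert_differentiable T F \<longleftrightarrow>
     (\<forall>t\<in>{0..T}. \<forall>x\<in>cadlag T. (\<lambda>e. F t (bump T t x e)) differentiable (at 0))"

definition vert_grad :: "real \<Rightarrow> ('d::finite, real) functional \<Rightarrow> ('d, real ^ 'd) functional" where
  "vert_grad T F t x = (THE D. GDERIV (\<lambda>e. F t (bump T t x e)) 0 :> D)"

text \<open>The \<open>j\<close>-th iterated vertical derivative is given by its components, which are indexed by
  the lists of length \<open>j\<close>: the component of index \<open>i # js\<close> is the \<open>i\<close>-th component of the
  vertical gradient of the component of index \<open>js\<close>.\<close>

fun vert_comp :: "real \<Rightarrow> ('d::finite, real) functional \<Rightarrow> 'd list \<Rightarrow> ('d, real) functional" where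
  "vert_comp T F [] = F"
| "vert_comp T F (i # js) = (\<lambda>t x. vert_grad T (vert_comp T F js) t x $ i)"

definition vert_deriv3 ::
    "real \<Rightarrow> ('d::finite, real) functional \<Rightarrow> ('d, real ^ 'd ^ 'd ^ 'd) functional" where
  "vert_deriv3 T F t x = (\<chi> i j k. vert_comp T F [i, j, k] t x)"

definition C1b :: "real \<Rightarrow> nat \<Rightarrow> ('d::finite, real) functional set" where
  "C1b T k = {F \<in> non_anticipative T.
     horiz_differentiable T F \<and>
     horiz_deriv T F \<in> cont_fixed_times T \<inter> bdd_preserving T \<and>
     (\<forall>js. length js < k \<longrightarrow> vert_differentiable T (vert_comp T F js)) \<and>
     (\<forall>js. length js \<le> k \<longrightarrow> vert_comp T F js \<in> left_cont T) \<and>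
     (\<forall>js. 1 \<le> length js \<and> length js \<le> k \<longrightarrow> vert_comp T F js \<in> bdd_preserving T)}"

definition regular_functionals :: "real \<Rightarrow> ('d::finite, real) functional set" where
  "regular_functionals T = {F \<in> C1b T 2.
     (\<forall>i. vert_comp T F [i] \<in> C1b T 1) \<and>
     (\<forall>i j. vert_comp T F [i, j] \<in> C1b T 1) \<and>
     F \<in> lip_functionals T \<and>
     horiz_deriv T F \<in> lip_functionals T \<and>
     (\<forall>i j k. vert_comp T F [i, j, k] \<in> lip_functionals T) \<and>
     vert_deriv3 T F \<in> horiz_loc_lip T}"

section \<open>Partitions, quadratic variation and the pathwise integral\<close>

text \<open>The \<open>n\<close>-th partition consists of the points \<open>\<pi> n 0 < \<dots> < \<pi> n (m n)\<close>.\<close>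

definition partition_seq :: "real \<Rightarrow> (nat \<Rightarrow> nat) \<Rightarrow> (nat \<Rightarrow> nat \<Rightarrow> real) \<Rightarrow> bool" where
  "partition_seq T m \<pi> \<longleftrightarrow>
     (\<forall>n. \<pi> n 0 = 0 \<and> \<pi> n (m n) = T \<and> (\<forall>i<m n. \<pi> n i < \<pi> n (Suc i)))"

text \<open>Below, \<open>q\<close> is the quadratic variation of \<open>x\<close> along the partitions and \<open>c\<close> is its
  continuous part.\<close>

definition finite_qv_real ::
    "real \<Rightarrow> (nat \<Rightarrow> nat) \<Rightarrow> (nat \<Rightarrow> nat \<Rightarrow> real) \<Rightarrow> (real \<Rightarrow> real) set" where
  "finite_qv_real T m \<pi> = {x \<in> cadlag T. \<exists>q c.
     (\<forall>t\<in>{0..T}. (\<lambda>n. \<Sum>i | i < m n \<and> \<pi> n (Suc i) \<le> t. (x (\<pi> n (Suc i)) - x (\<pi> n i))\<^sup>2)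
        \<longlonglongrightarrow> q t) \<and>
     continuous_on {0..T} c \<and> mono_on {0..T} c \<and>
     (\<forall>t\<in>{0..T}. ((\<lambda>s. (jump x s)\<^sup>2) has_sum (q t - c t)) {0<..t})}"

definition finite_qv ::
    "real \<Rightarrow> (nat \<Rightarrow> nat) \<Rightarrow> (nat \<Rightarrow> nat \<Rightarrow> real) \<Rightarrow> (real \<Rightarrow> real ^ 'd::finite) set" where
  "finite_qv T m \<pi> = {x \<in> cadlag T. \<forall>i j.
     (\<lambda>s\<in>{0..T}. x s $ i) \<in> finite_qv_real T m \<pi> \<and>
     (\<lambda>s\<in>{0..T}. x s $ i + x s $ j) \<in> finite_qv_real T m \<pi>}"

definition pc_approx :: "real \<Rightarrow> nat \<Rightarrow> (nat \<Rightarrow> real) \<Rightarrow> (real \<Rightarrow> 'a::real_normed_vector)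
    \<Rightarrow> real \<Rightarrow> 'a" where
  "pc_approx T M p x = (\<lambda>s\<in>{0..T}.
     (\<Sum>i<M. indicator {p i..<p (Suc i)} s *\<^sub>R x (p (Suc i))) + indicator {T} s *\<^sub>R x T)"

definition pathwise_sum :: "real \<Rightarrow> (nat \<Rightarrow> nat) \<Rightarrow> (nat \<Rightarrow> nat \<Rightarrow> real)
    \<Rightarrow> ('d::finite, real) functional \<Rightarrow> (real \<Rightarrow> real ^ 'd) \<Rightarrow> nat \<Rightarrow> real" where
  "pathwise_sum T m \<pi> F x n = (\<Sum>i<m n.
     vert_grad T F (\<pi> n i) (stop_left T (\<pi> n i) (pc_approx T (m n) (\<pi> n) x))
       \<bullet> (x (\<pi> n (Suc i)) - x (\<pi> n i)))"

definition pathwise_integral :: "real \<Rightarrow> (nat \<Rightarrow> nat) \<Rightarrow> (nat \<Rightarrow> nat \<Rightarrow> real)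
    \<Rightarrow> ('d::finite, real) functional \<Rightarrow> (real \<Rightarrow> real ^ 'd) \<Rightarrow> real" where
  "pathwise_integral T m \<pi> F x = lim (pathwise_sum T m \<pi> F x)"

end

theory Submission
  imports Defs
begin

text \<open>Write \<open>\<omega>(s,t) = \<omega> t - \<omega> s\<close>, and let \<open>g\<close>, \<open>H\<close> and \<open>D\<close> be the vertical gradient, the vertical Hessian and
the horizontal derivative of \<open>F\<close>. The theorem follows from one local estimate:
  \<open>F(t,\<omega>) - F(s,\<omega>) = \<integral>\<^sub>s\<^sup>t D(u,\<omega>) du + g(s,\<omega>) \<bullet> \<omega>(s,t) + H(s,\<omega>)(\<omega>(s,t),\<omega>(s,t))/2 + O(|t-s| powr \<theta>)\<close>
with \<open>\<theta> = 2\<nu> + \<nu>\<^sup>2\<close>. The lower bound on \<open>\<nu>\<close> makes \<open>\<theta> > 1\<close>. Lowering \<open>\<nu>\<close> only weakens Hoelder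
continuity, so that \<open>\<nu> \<le> 1/2\<close> may be assumed.

\<^bold>\<open>The local estimate\<close> (\<open>value_remainder\<close>). A functional cannot be expanded along a Hoelder path directly,
but it can along a path with finitely many jumps: on each interval of constancy the change of \<open>F\<close>
is the integral of \<open>D\<close>, and at each jump it is given by Taylor's formula. The path \<open>\<omega>\<close> is therefore
replaced on \<open>[s,t]\<close> by the step path through its values at \<open>2\<^sup>p\<close> dyadic points, and \<open>F\<close>, \<open>D\<close>, \<open>g\<close> and \<open>H\<close> are
Lipschitz in the uniform distance. The remainder is bounded uniformly in \<open>p\<close> by bisection: the remainder
of \<open>[s,t]\<close> is the sum of those of the two halves \<open>[s,u]\<close> and \<open>[u,t]\<close> and of a defect, which the
symmetry of \<open>H\<close> reduces to
  \<open>(g(u) - g(s) - H(s) \<omega>(s,u)) \<bullet> \<omega>(u,t)\<close> and \<open>(H(u) - H(s))(\<omega>(u,t),\<omega>(u,t))/2\<close>.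
If the defect is \<open>O(|t-s| powr \<theta>)\<close> with \<open>\<theta> > 1\<close>, so is the total, by a geometric series. Since
\<open>H(u) - H(s) = O(|u-s| powr \<nu>)\<close>, what is missing is
  \<open>g(u) - g(s) - H(s) \<omega>(s,u) = O(|u-s| powr (\<nu> + \<nu>\<^sup>2))\<close> (\<open>gradient_remainder\<close>).
Here bisection gives a bound that grows with \<open>p\<close>, like \<open>2 powr (p(1-\<nu>)) |u-s| powr (2\<nu>)\<close>. It is
applied only up to about \<open>|u-s| powr (-\<nu>)\<close> dyadic intervals. From there on, finer step paths differ from that one by
\<open>O(|u-s| powr (\<nu> + \<nu>\<^sup>2))\<close> uniformly, and \<open>g\<close> is Lipschitz.

\<^bold>\<open>The Riemann sums.\<close> Summed over a partition, the estimate expresses the Riemann sum of \<open>g(\<cdot>,\<omega>)\<close> by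
\<open>F(T,\<omega>) - F(0,\<omega>)\<close>, \<open>\<integral> D\<close> and \<open>\<Sum> H(\<omega>(t\<^sub>i,t\<^sub>i\<^sub>+\<^sub>1),\<omega>(t\<^sub>i,t\<^sub>i\<^sub>+\<^sub>1))/2\<close>. On the partition intervals the oscillation of
\<open>\<omega>\<close> tends to \<open>0\<close>, but their lengths may not. As the local remainder is also bounded by the oscillation,
interpolation between the two bounds shows that the remainders sum to \<open>o(1)\<close> (\<open>riemann_sum_error\<close>).
The sums that define the pathwise integral run along a step path; there the exact jump-by-jump expansion gives the same expression up to \<open>o(1)\<close> (\<open>step_sum_error\<close>).
Finally the quadratic sums converge, because \<open>H(\<cdot>,\<omega>)\<close> is continuous and \<open>\<omega>\<close> has a quadratic variation
(\<open>weighted_sums_convergent\<close>). So both sums converge to the same limit. The limit of the Riemann sums sees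
only \<open>g(\<cdot>,\<omega>)\<close>.

\<^bold>\<open>The hypotheses on \<open>F\<close>\<close> enter through \<open>regular_path_expansion\<close>. The Lipschitz continuity of \<open>g\<close> and \<open>H\<close>
comes from that of \<open>F\<close> and of its third vertical derivative, by finite differences; the
Lipschitz continuity in time from the boundedness of the horizontal derivatives.\<close>

section \<open>Bumped paths, frozen paths and partitions\<close>

lemma bump_apply:
  assumes "s \<in> {0..T}" "t \<in> {0..T}"
  shows "bump T t x e s = (if s < t then x s else x t + e)"
  using assms by (auto simp: bump_def stop_def indicator_def)

lemma bump_zero: "bump T t x 0 = stop T t x"
  by (auto simp: bump_def stop_def fun_eq_iff restrict_def)

lemma bump_cadlag:
  assumes x: "x \<in> cadlag T" and t: "t \<in> {0..T}"
  shows "bump T t x e \<in> cadlag T"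
proof -
  have "continuous (at_right r) (bump T t x e)" if r: "r \<in> {0..<T}" for r
  proof (cases "r < t")
    case True
    have "(x \<longlongrightarrow> x r) (at_right r)"
      using x r by (auto simp: cadlag_def continuous_within)
    moreover have "eventually (\<lambda>s. x s = bump T t x e s) (at_right r)"
      using eventually_at_right_real[OF True] by eventually_elim (use r t in \<open>auto simp: bump_apply\<close>)
    ultimately have "(bump T t x e \<longlongrightarrow> x r) (at_right r)"
      by (rule Lim_transform_eventually)
    then show ?thesis
      using True r t by (simp add: continuous_within bump_apply)
  next
    case False
    have "eventually (\<lambda>s. x t + e = bump T t x e s) (at_right r)"
      using eventually_at_right_real[of r T] r
      by (auto elim!: eventually_mono) (use False r t in \<open>auto simp: bump_apply\<close>)
    then have "(bump T t x e \<longlongrightarrow> x t + e) (at_right r)"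
      by (rule Lim_transform_eventually[OF tendsto_const])
    then show ?thesis
      using False r t by (simp add: continuous_within bump_apply)
  qed
  moreover have "\<exists>l. (bump T t x e \<longlongrightarrow> l) (at_left r)" if r: "r \<in> {0<..T}" for r
  proof (cases "r \<le> t")
    case True
    obtain l where "(x \<longlongrightarrow> l) (at_left r)"
      using x r unfolding cadlag_def by blast
    moreover have "eventually (\<lambda>s. x s = bump T t x e s) (at_left r)"
      using eventually_at_left_real[of 0 r] r
      by (auto elim!: eventually_mono) (use True r t in \<open>auto simp: bump_apply\<close>)
    ultimately show ?thesis
      by (blast intro: Lim_transform_eventually)
  next
    case False
    have "eventually (\<lambda>s. x t + e = bump T t x e s) (at_left r)"
      using eventually_at_left_real[of t r] False
      by (auto elim!: eventually_mono) (use False r t in \<open>auto simp: bump_apply\<close>)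
    then show ?thesis
      by (blast intro: Lim_transform_eventually[OF tendsto_const])
  qed
  ultimately show ?thesis
    by (auto simp: cadlag_def bump_def extensional_def)
qed

lemma stop_cadlag: "x \<in> cadlag T \<Longrightarrow> t \<in> {0..T} \<Longrightarrow> stop T t x \<in> cadlag T"
  using bump_cadlag[of x T t 0] by (simp add: bump_zero)

text \<open>A path that is constant from time \<open>s\<close> on and takes no values other than
  those of \<open>\<omega>\<close>. The second condition keeps all approximating paths in one
  compact set, on which boundedness-preserving functionals are bounded.\<close>

definition frozen ::
    "real \<Rightarrow> (real \<Rightarrow> 'a::real_normed_vector) \<Rightarrow> real \<Rightarrow> (real \<Rightarrow> 'a) \<Rightarrow> bool" where
  "frozen T \<omega> s y \<longleftrightarrow> y \<in> cadlag T \<and> y ` {0..T} \<subseteq> \<omega> ` {0..T} \<and> (\<exists>c. \<forall>r\<in>{s..T}. y r = c)"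

lemma partition_mono:
  fixes p :: "nat \<Rightarrow> real"
  assumes "\<forall>i<M. p i < p (Suc i)" "i \<le> j" "j \<le> M"
  shows "p i \<le> p j"
  using assms(2,3)
proof (induction j rule: dec_induct)
  case (step j)
  then have "p i \<le> p j" "p j < p (Suc j)" using assms(1) by auto
  then show ?case by simp
qed simp

lemma partition_locate:
  fixes p :: "nat \<Rightarrow> real"
  assumes "p 0 = 0" "r \<in> {0..<p i}"
  obtains j where "j < i" "r \<in> {p j..<p (Suc j)}"
proof -
  have "\<exists>j<i. r \<in> {p j..<p (Suc j)}"
    using assms(2)
  proof (induction i)
    case 0
    then show ?case using assms(1) by simp
  next
    case (Suc i)
    then show ?case
      by (cases "r < p i") (auto intro: less_SucI)
  qed
  then show ?thesis using that by blast
qed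

section \<open>Expansions along dyadic approximations of a rough path\<close>

lemma norm_triangle_split2:
  fixes x a b :: "'a::real_normed_vector"
  assumes "x = a + b" shows "norm x \<le> norm a + norm b"
  using assms norm_triangle_ineq by blast

lemma norm_triangle_split3:
  fixes x a b c :: "'a::real_normed_vector"
  assumes "x = a + b + c" shows "norm x \<le> norm a + norm b + norm c"
  using assms norm_triangle_ineq[of "a + b" c] norm_triangle_ineq[of a b] by simp

lemma powr_le_scaled:
  fixes \<delta> T a b :: real
  assumes "0 < \<delta>" "\<delta> \<le> T" "a \<le> b"
  shows "\<delta> powr b \<le> T powr (b - a) * \<delta> powr a"
proof -
  have "\<delta> powr b = \<delta> powr (b - a) * \<delta> powr a"
    by (simp add: powr_add[symmetric])
  also have "\<dots> \<le> T powr (b - a) * \<delta> powr a"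
    using assms by (intro mult_right_mono powr_mono2) auto
  finally show ?thesis .
qed

text \<open>What the expansion uses of the functional \<open>F\<close> and the path
  \<open>\<omega>\<close>, with one constant \<open>L\<close> for all the bounds. The Hessian is a
  linear map \<open>H t x\<close>, written as a function. The Lipschitz conditions compare paths
  only up to time \<open>t\<close>, so they contain that the functionals are non-anticipative.\<close>

locale path_expansion =
  fixes T \<nu> L :: real
    and \<omega> :: "real \<Rightarrow> 'v::euclidean_space"
    and F D :: "real \<Rightarrow> (real \<Rightarrow> 'v) \<Rightarrow> real"
    and g :: "real \<Rightarrow> (real \<Rightarrow> 'v) \<Rightarrow> 'v"
    and H :: "real \<Rightarrow> (real \<Rightarrow> 'v) \<Rightarrow> 'v \<Rightarrow> 'v"
  assumes T_pos: "0 < T" and L_ge_1: "1 \<le> L"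
    and nu: "0 < \<nu>" "\<nu> \<le> 1/2" "1 < 2 * \<nu> + \<nu>\<^sup>2"
    and path: "\<omega> \<in> cadlag T"
    and holder: "\<lbrakk>s \<in> {0..T}; t \<in> {0..T}\<rbrakk> \<Longrightarrow> norm (\<omega> t - \<omega> s) \<le> L * \<bar>t - s\<bar> powr \<nu>"
    and lip_F: "\<lbrakk>x \<in> cadlag T; y \<in> cadlag T; t \<in> {0..T}; \<And>r. r \<in> {0..t} \<Longrightarrow> norm (x r - y r) \<le> e\<rbrakk>
      \<Longrightarrow> \<bar>F t x - F t y\<bar> \<le> L * e"
    and lip_D: "\<lbrakk>x \<in> cadlag T; y \<in> cadlag T; t \<in> {0..T}; \<And>r. r \<in> {0..t} \<Longrightarrow> norm (x r - y r) \<le> e\<rbrakk>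
      \<Longrightarrow> \<bar>D t x - D t y\<bar> \<le> L * e"
    and lip_g: "\<lbrakk>x \<in> cadlag T; y \<in> cadlag T; t \<in> {0..T}; \<And>r. r \<in> {0..t} \<Longrightarrow> norm (x r - y r) \<le> e\<rbrakk>
      \<Longrightarrow> norm (g t x - g t y) \<le> L * e"
    and lip_H: "\<lbrakk>x \<in> cadlag T; y \<in> cadlag T; t \<in> {0..T}; \<And>r. r \<in> {0..t} \<Longrightarrow> norm (x r - y r) \<le> e\<rbrakk>
      \<Longrightarrow> norm (H t x a - H t y a) \<le> L * e * norm a"
    and hor_F: "\<lbrakk>0 \<le> s; s \<le> t; t \<le> T; frozen T \<omega> s y\<rbrakk>
      \<Longrightarrow> ((\<lambda>u. D u y) has_integral (F t y - F s y)) {s..t}"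
    and hor_g: "\<lbrakk>0 \<le> s; s \<le> t; t \<le> T; frozen T \<omega> s y\<rbrakk> \<Longrightarrow> norm (g t y - g s y) \<le> L * (t - s)"
    and hor_H: "\<lbrakk>0 \<le> s; s \<le> t; t \<le> T; frozen T \<omega> s y\<rbrakk>
      \<Longrightarrow> norm (H t y a - H s y a) \<le> L * (t - s) * norm a"
    and taylor_F: "\<lbrakk>x \<in> cadlag T; t \<in> {0..T}\<rbrakk>
      \<Longrightarrow> \<bar>F t (bump T t x a) - F t x - g t x \<bullet> a - (H t x a \<bullet> a) / 2\<bar> \<le> L * norm a ^ 3"
    and taylor_g: "\<lbrakk>x \<in> cadlag T; t \<in> {0..T}\<rbrakk>
      \<Longrightarrow> norm (g t (bump T t x a) - g t x - H t x a) \<le> L * (norm a)\<^sup>2"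
    and linear_H: "\<lbrakk>x \<in> cadlag T; t \<in> {0..T}\<rbrakk> \<Longrightarrow> linear (H t x)"
    and sym_H: "\<lbrakk>x \<in> cadlag T; t \<in> {0..T}\<rbrakk> \<Longrightarrow> H t x a \<bullet> b = H t x b \<bullet> a"
    and bound_g: "\<lbrakk>0 \<le> s; s \<le> T; frozen T \<omega> s y\<rbrakk> \<Longrightarrow> norm (g s y) \<le> L"
    and bound_H: "\<lbrakk>0 \<le> s; s \<le> T; frozen T \<omega> s y\<rbrakk> \<Longrightarrow> norm (H s y a) \<le> L * norm a"
begin

text \<open>The starting points of an expansion on \<open>[s,t]\<close>: an arbitrary past,
  followed by the value of \<open>\<omega>\<close> at \<open>s\<close>. The past cannot be fixed
  to that of \<open>\<omega>\<close>, because after one bisection step the second half starts from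
  an approximating path.\<close>

definition tracks :: "real \<Rightarrow> (real \<Rightarrow> 'v) \<Rightarrow> bool" where
  "tracks s y \<longleftrightarrow> frozen T \<omega> s y \<and> y s = \<omega> s"

abbreviation follow :: "real \<Rightarrow> real \<Rightarrow> (real \<Rightarrow> 'v) \<Rightarrow> real \<Rightarrow> 'v" where
  "follow s t y \<equiv> bump T s y (\<omega> t - \<omega> s)"

lemma tracks_cadlag: "tracks s y \<Longrightarrow> y \<in> cadlag T"
  by (simp add: tracks_def frozen_def)

lemma tracks_const: "tracks s y \<Longrightarrow> s \<le> r \<Longrightarrow> r \<le> T \<Longrightarrow> y r = \<omega> s"
  unfolding tracks_def frozen_def by (metis atLeastAtMost_iff order.refl order.trans)

lemma follow_apply:
  assumes "tracks s y" "0 \<le> s" "s \<le> T" "r \<in> {0..T}"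
  shows "follow s t y r = (if r < s then y r else \<omega> t)"
  using assms by (auto simp: bump_apply tracks_def)

lemma follow_frozen:
  assumes "tracks s y" "0 \<le> s" "s \<le> t" "t \<le> T"
  shows "frozen T \<omega> s (follow s t y)"
proof -
  have "follow s t y r \<in> \<omega> ` {0..T}" if "r \<in> {0..T}" for r
    using assms that by (auto simp: follow_apply tracks_def frozen_def)
  moreover have "\<forall>r\<in>{s..T}. follow s t y r = \<omega> t"
    using assms by (auto simp: follow_apply)
  moreover have "follow s t y \<in> cadlag T"
    using assms bump_cadlag[OF tracks_cadlag[OF assms(1)]] by auto
  ultimately show ?thesis unfolding frozen_def by blast
qed

lemma follow_tracks:
  assumes "tracks s y" "0 \<le> s" "s \<le> t" "t \<le> T"
  shows "tracks t (follow s t y)"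
proof -
  have "frozen T \<omega> t (follow s t y)"
    using follow_frozen[OF assms] assms unfolding frozen_def by auto
  then show ?thesis
    using assms by (simp add: tracks_def[of t] follow_apply)
qed

lemma stop_frozen:
  assumes "s \<in> {0..T}" shows "frozen T \<omega> s (stop T s \<omega>)" "tracks s (stop T s \<omega>)"
proof -
  have "stop T s \<omega> ` {0..T} \<subseteq> \<omega> ` {0..T}"
    using assms by (auto simp: stop_def min_def)
  moreover have "\<forall>r\<in>{s..T}. stop T s \<omega> r = \<omega> s"
    using assms by (auto simp: stop_def min_def)
  ultimately show "frozen T \<omega> s (stop T s \<omega>)"
    using assms path unfolding frozen_def by (blast intro: stop_cadlag)
  then show "tracks s (stop T s \<omega>)"
    using assms by (simp add: tracks_def stop_def)
qed

text \<open>The step path that follows \<open>\<omega>\<close> on \<open>[s,t]\<close> in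
  \<open>2\<^sup>p\<close> steps of equal length and takes on each of them the value of
  \<open>\<omega>\<close> at its right end point. The recursion bisects the interval, which is the
  induction that all the estimates use.\<close>

fun dyadic :: "nat \<Rightarrow> real \<Rightarrow> real \<Rightarrow> (real \<Rightarrow> 'v) \<Rightarrow> real \<Rightarrow> 'v" where
  "dyadic 0 s t y = follow s t y"
| "dyadic (Suc p) s t y = dyadic p ((s + t) / 2) t (dyadic p s ((s + t) / 2) y)"

lemma dyadic_approx:
  assumes "tracks s y" "0 \<le> s" "s < t" "t \<le> T"
  shows "tracks t (dyadic p s t y) \<and> (\<forall>r\<in>{0..<s}. dyadic p s t y r = y r) \<and>
    (\<forall>r\<in>{s..t}. norm (dyadic p s t y r - \<omega> r) \<le> L * ((t - s) / 2 ^ p) powr \<nu>)"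
  using assms
proof (induction p arbitrary: s t y)
  case 0
  have "norm (\<omega> t - \<omega> r) \<le> L * (t - s) powr \<nu>" if "r \<in> {s..t}" for r
  proof -
    have "norm (\<omega> t - \<omega> r) \<le> L * \<bar>t - r\<bar> powr \<nu>"
      using that 0 by (intro holder) auto
    also have "\<dots> \<le> L * (t - s) powr \<nu>"
      using that L_ge_1 nu by (intro mult_left_mono powr_mono2) auto
    finally show ?thesis .
  qed
  then show ?case
    using 0 follow_tracks[of s y t] by (auto simp: follow_apply)
next
  case (Suc p)
  let ?u = "(s + t) / 2" and ?z = "dyadic p s ((s + t) / 2) y"
  have u: "0 \<le> ?u" "s < ?u" "?u < t" "?u \<le> T" using Suc.prems by auto
  have z: "tracks ?u ?z" "\<forall>r\<in>{0..<s}. ?z r = y r"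
    "\<forall>r\<in>{s..?u}. norm (?z r - \<omega> r) \<le> L * ((?u - s) / 2 ^ p) powr \<nu>"
    using Suc.IH[of s y ?u] Suc.prems u by auto
  have z': "tracks t (dyadic p ?u t ?z)" "\<forall>r\<in>{0..<?u}. dyadic p ?u t ?z r = ?z r"
    "\<forall>r\<in>{?u..t}. norm (dyadic p ?u t ?z r - \<omega> r) \<le> L * ((t - ?u) / 2 ^ p) powr \<nu>"
    using Suc.IH[of ?u ?z t] Suc.prems u z by auto
  \<comment> \<open>both halves are cut into pieces of the same length\<close>
  have eq: "(?u - s) / 2 ^ p = (t - s) / 2 ^ Suc p" "(t - ?u) / 2 ^ p = (t - s) / 2 ^ Suc p"
    by (auto simp: field_simps)
  have "norm (dyadic p ?u t ?z r - \<omega> r) \<le> L * ((t - s) / 2 ^ Suc p) powr \<nu>" if "r \<in> {s..t}" for r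
  proof (cases "r < ?u")
    case True
    then have "dyadic p ?u t ?z r = ?z r" using z'(2) that Suc.prems by auto
    then show ?thesis using z(3) True that unfolding eq by auto
  next
    case False
    then show ?thesis using z'(3) that unfolding eq by auto
  qed
  then show ?case using z z' u Suc.prems by auto
qed

lemmas dyadic_tracks = dyadic_approx[THEN conjunct1]
  and dyadic_before = dyadic_approx[THEN conjunct2, THEN conjunct1, rule_format]
  and dyadic_close = dyadic_approx[THEN conjunct2, THEN conjunct2, rule_format]

lemma dyadic_le:
  assumes "0 < d" shows "(d / 2 ^ p) powr \<nu> \<le> d powr \<nu>"
proof (rule powr_mono2)
  show "d / 2 ^ p \<le> d"
    using divide_left_mono[of 1 "2 ^ p" d] assms by simp
qed (use assms nu in auto)

lemma dyadic_dist:
  assumes "tracks s y" "0 \<le> s" "s < t" "t \<le> T" "r \<in> {0..t}"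
  shows "norm (dyadic p s t y r - dyadic q s t y r)
    \<le> L * ((t - s) / 2 ^ p) powr \<nu> + L * ((t - s) / 2 ^ q) powr \<nu>"
proof (cases "r < s")
  case True
  then show ?thesis
    using dyadic_before[OF assms(1-4)] assms(5) L_ge_1 by simp
next
  case False
  then have r: "r \<in> {s..t}" using assms by auto
  show ?thesis
    using dyadic_close[OF assms(1-4) r, of p] dyadic_close[OF assms(1-4) r, of q]
      norm_triangle_split2[of "dyadic p s t y r - dyadic q s t y r"
        "dyadic p s t y r - \<omega> r" "\<omega> r - dyadic q s t y r"]
    by (simp add: norm_minus_commute)
qed

lemma dyadic_start:
  assumes "tracks s y" "0 \<le> s" "s < t" "t \<le> T" "r \<in> {0..t}"
  shows "norm (dyadic p s t y r - y r) \<le> 2 * L * (t - s) powr \<nu>"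
proof (cases "r < s")
  case True
  then show ?thesis
    using dyadic_before[OF assms(1-4)] assms(5) L_ge_1 by simp
next
  case False
  then have r: "r \<in> {s..t}" using assms by auto
  have "norm (dyadic p s t y r - \<omega> r) \<le> L * (t - s) powr \<nu>"
  proof (rule order.trans)
    show "norm (dyadic p s t y r - \<omega> r) \<le> L * ((t - s) / 2 ^ p) powr \<nu>"
      using assms r by (intro dyadic_close) auto
    show "L * ((t - s) / 2 ^ p) powr \<nu> \<le> L * (t - s) powr \<nu>"
      using assms L_ge_1 by (intro mult_left_mono dyadic_le) auto
  qed
  moreover have "norm (\<omega> r - \<omega> s) \<le> L * \<bar>r - s\<bar> powr \<nu>"
    using r assms by (intro holder) auto
  moreover have "L * \<bar>r - s\<bar> powr \<nu> \<le> L * (t - s) powr \<nu>"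
    using r L_ge_1 nu by (intro mult_left_mono powr_mono2) auto
  moreover have "y r = \<omega> s"
    using tracks_const[OF assms(1)] r assms by auto
  moreover have "norm (dyadic p s t y r - \<omega> s)
      \<le> norm (dyadic p s t y r - \<omega> r) + norm (\<omega> r - \<omega> s)"
    by (rule norm_triangle_split2) simp
  ultimately show ?thesis
    by simp
qed

lemma le_scaled_powr:
  assumes "0 < d" "d \<le> T" "a \<le> 1"
  shows "d \<le> T powr (1 - a) * d powr a"
  using powr_le_scaled[of d T a 1] assms by simp

lemma hessian_increment:
  "\<exists>C\<ge>0. \<forall>p s t y a. 0 \<le> s \<longrightarrow> s < t \<longrightarrow> t \<le> T \<longrightarrow> tracks s y \<longrightarrow>
     norm (H t (dyadic p s t y) a - H s y a) \<le> C * (t - s) powr \<nu> * norm a"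
proof (intro exI conjI allI impI)
  let ?C = "2 * L\<^sup>2 + L * T powr (1 - \<nu>)"
  show "0 \<le> ?C" using L_ge_1 by simp
  fix p s t y a assume st: "0 \<le> s" "s < t" "t \<le> T" and y: "tracks s y"
  let ?z = "dyadic p s t y"
  have "norm (H t ?z a - H t y a) \<le> L * (2 * L * (t - s) powr \<nu>) * norm a"
    using st y dyadic_tracks[OF y st] dyadic_start[OF y st]
    by (intro lip_H tracks_cadlag[of t] tracks_cadlag[of s]) auto
  moreover have "norm (H t y a - H s y a) \<le> L * (t - s) * norm a"
    using st y by (intro hor_H) (auto simp: tracks_def)
  moreover have "L * (t - s) * norm a \<le> L * (T powr (1 - \<nu>) * (t - s) powr \<nu>) * norm a"
    using st nu L_ge_1 le_scaled_powr[of "t - s" \<nu>] by (intro mult_right_mono mult_left_mono) auto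
  moreover have "norm (H t ?z a - H s y a) \<le> norm (H t ?z a - H t y a) + norm (H t y a - H s y a)"
    by (rule norm_triangle_split2) simp
  ultimately show "norm (H t ?z a - H s y a) \<le> ?C * (t - s) powr \<nu> * norm a"
    by (simp add: algebra_simps power2_eq_square)
qed

lemma increment_bound:
  assumes "0 \<le> s" "s \<le> t" "t \<le> T" "t - s \<le> d"
  shows "norm (\<omega> t - \<omega> s) \<le> L * d powr \<nu>"
proof -
  have "norm (\<omega> t - \<omega> s) \<le> L * \<bar>t - s\<bar> powr \<nu>"
    using assms by (intro holder) auto
  also have "\<dots> \<le> L * d powr \<nu>"
    using assms L_ge_1 nu by (intro mult_left_mono powr_mono2) auto
  finally show ?thesis .
qed

text \<open>Bisection doubles the remainder of half the length and adds a defect of order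
  \<open>(t-s) powr (2\<nu>)\<close>. As \<open>2\<nu> \<le> 1\<close>, doubling is not
  compensated and the bound grows with \<open>p\<close>; any factor \<open>q > 2 powr (1 -
  2\<nu>)\<close> per step would do, and \<open>q = 2 powr (1 - \<nu>)\<close> is the choice that
  leads to the exponent \<open>\<nu> + \<nu>\<^sup>2\<close> below.\<close>

lemma gradient_remainder_growth:
  "\<exists>C\<ge>0. \<forall>p s t y. 0 \<le> s \<longrightarrow> s < t \<longrightarrow> t \<le> T \<longrightarrow> tracks s y \<longrightarrow>
     norm (g t (dyadic p s t y) - g s y - H s y (\<omega> t - \<omega> s))
       \<le> C * (2 powr (1 - \<nu>)) ^ p * (t - s) powr (2 * \<nu>)"
proof -
  obtain B where B: "0 \<le> B" "\<And>p s t y a. \<lbrakk>0 \<le> s; s < t; t \<le> T; tracks s y\<rbrakk> \<Longrightarrow>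
     norm (H t (dyadic p s t y) a - H s y a) \<le> B * (t - s) powr \<nu> * norm a"
    using hessian_increment by blast
  define q r :: real where "q = 2 powr (1 - \<nu>)" and "r = 2 powr (1 - 2 * \<nu>)"
  have qr: "r < q" "1 \<le> q" "0 < r" using nu by (auto simp: q_def r_def ge_one_powr_ge_zero)
  define C where "C = max (L * T powr (1 - 2 * \<nu>) + L ^ 3) (B * L / (q - r))"
  have C: "L * T powr (1 - 2 * \<nu>) + L ^ 3 \<le> C" "B * L / (q - r) \<le> C"
    by (auto simp: C_def)
  have C0: "0 \<le> C" using L_ge_1 by (intro order.trans[OF _ C(1)]) auto
  have "norm (g t (dyadic p s t y) - g s y - H s y (\<omega> t - \<omega> s)) \<le> C * q ^ p * (t - s) powr (2 * \<nu>)"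
    if "0 \<le> s" "s < t" "t \<le> T" "tracks s y" for p s t y
    using that
  proof (induction p arbitrary: s t y)
    case 0
    let ?z = "follow s t y"
    have "norm (g t ?z - g s ?z) \<le> L * (t - s)"
      using 0 by (intro hor_g follow_frozen) auto
    moreover have "norm (g s ?z - g s y - H s y (\<omega> t - \<omega> s)) \<le> L * (norm (\<omega> t - \<omega> s))\<^sup>2"
      using 0 by (intro taylor_g tracks_cadlag) auto
    moreover have "(norm (\<omega> t - \<omega> s))\<^sup>2 \<le> (L * (t - s) powr \<nu>)\<^sup>2"
      using 0 by (intro power_mono increment_bound) auto
    then have "L * (norm (\<omega> t - \<omega> s))\<^sup>2 \<le> L * (L * (t - s) powr \<nu>)\<^sup>2"
      using L_ge_1 by (intro mult_left_mono) auto
    moreover have "((t - s) powr \<nu>)\<^sup>2 = (t - s) powr (2 * \<nu>)"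
      using 0 by (simp add: powr_power mult.commute)
    moreover have "L * (t - s) \<le> L * (T powr (1 - 2 * \<nu>) * (t - s) powr (2 * \<nu>))"
      using 0 L_ge_1 nu by (intro mult_left_mono le_scaled_powr) auto
    moreover have "norm (g t ?z - g s y - H s y (\<omega> t - \<omega> s))
      \<le> norm (g t ?z - g s ?z) + norm (g s ?z - g s y - H s y (\<omega> t - \<omega> s))"
      by (rule norm_triangle_split2) simp
    ultimately have "norm (g t ?z - g s y - H s y (\<omega> t - \<omega> s))
        \<le> (L * T powr (1 - 2 * \<nu>) + L ^ 3) * (t - s) powr (2 * \<nu>)"
      by (simp add: algebra_simps power_mult_distrib power2_eq_square power3_eq_cube)
    also have "\<dots> \<le> C * (t - s) powr (2 * \<nu>)"
      by (intro mult_right_mono C(1)) auto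
    finally show ?case by simp
  next
    case (Suc p)
    define u where "u = (s + t) / 2"
    define z where "z = dyadic p s u y"
    define h where "h = (t - s) / 2"
    have u: "0 \<le> s" "s < u" "u < t" "t \<le> T" "u \<le> T" "0 \<le> u" and h: "u - s = h" "t - u = h" "0 < h"
      using Suc.prems by (auto simp: u_def h_def field_simps)
    have z: "tracks u z" "tracks s y"
      using dyadic_tracks[of s y u p] Suc.prems u by (auto simp: z_def)
    have "norm (g t (dyadic p u t z) - g u z - H u z (\<omega> t - \<omega> u)) \<le> C * q ^ p * h powr (2 * \<nu>)"
      using Suc.IH[of u t z] u z h by auto
    moreover have "norm (g u z - g s y - H s y (\<omega> u - \<omega> s)) \<le> C * q ^ p * h powr (2 * \<nu>)"
      using Suc.IH[of s u y] u z h unfolding z_def by auto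
    moreover have "norm (H u z (\<omega> t - \<omega> u) - H s y (\<omega> t - \<omega> u)) \<le> B * h powr \<nu> * norm (\<omega> t - \<omega> u)"
      using B(2)[of s u y p] u z h unfolding z_def by auto
    moreover have "B * h powr \<nu> * norm (\<omega> t - \<omega> u) \<le> B * h powr \<nu> * (L * h powr \<nu>)"
      using u h B(1) by (intro mult_left_mono increment_bound) auto
    moreover have "B * h powr \<nu> * (L * h powr \<nu>) = B * L * h powr (2 * \<nu>)"
      by (simp add: powr_add[symmetric] mult.assoc mult.left_commute)
    moreover have "H s y (\<omega> t - \<omega> s) = H s y (\<omega> u - \<omega> s) + H s y (\<omega> t - \<omega> u)"
      using u z by (subst linear_add[OF linear_H, symmetric]) (auto intro: tracks_cadlag)
    then have "norm (g t (dyadic p u t z) - g s y - H s y (\<omega> t - \<omega> s))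
      = norm (g t (dyadic p u t z) - g s y - (H s y (\<omega> u - \<omega> s) + H s y (\<omega> t - \<omega> u)))"
      by simp
    moreover have "norm (g t (dyadic p u t z) - g s y - (H s y (\<omega> u - \<omega> s) + H s y (\<omega> t - \<omega> u)))
      \<le> norm (g t (dyadic p u t z) - g u z - H u z (\<omega> t - \<omega> u))
        + norm (g u z - g s y - H s y (\<omega> u - \<omega> s))
        + norm (H u z (\<omega> t - \<omega> u) - H s y (\<omega> t - \<omega> u))"
      by (rule norm_triangle_split3) simp
    ultimately have "norm (g t (dyadic p u t z) - g s y - H s y (\<omega> t - \<omega> s))
        \<le> C * q ^ p * h powr (2 * \<nu>) + C * q ^ p * h powr (2 * \<nu>) + B * L * h powr (2 * \<nu>)"
      by linarith
    also have "\<dots> = (2 * (C * q ^ p) + B * L) * h powr (2 * \<nu>)"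
      by (simp add: algebra_simps)
    also have "\<dots> = (2 * (C * q ^ p) + B * L) / 2 powr (2 * \<nu>) * (t - s) powr (2 * \<nu>)"
      using Suc.prems by (simp add: h_def powr_divide)
    also have "(2 * (C * q ^ p) + B * L) / 2 powr (2 * \<nu>) \<le> C * q ^ Suc p"
    proof -
      have "2 * (C * q ^ p) / 2 powr (2 * \<nu>) = C * q ^ p * r"
        by (simp add: r_def powr_diff)
      moreover have "B * L / 2 powr (2 * \<nu>) \<le> B * L / 1"
        using B(1) L_ge_1 nu by (intro divide_left_mono) (auto simp: ge_one_powr_ge_zero)
      moreover have "B * L \<le> C * (q - r)"
        using C(2) qr by (simp add: pos_divide_le_eq)
      moreover have "C * (q - r) * 1 \<le> C * (q - r) * q ^ p"
        using qr C0 by (intro mult_left_mono) auto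
      ultimately show ?thesis by (simp add: algebra_simps add_divide_distrib)
    qed
    finally show ?case
      by (simp add: u_def z_def mult_right_mono)
  qed
  with C0 show ?thesis unfolding q_def by blast
qed

text \<open>Up to \<open>q\<close> bisections, with \<open>2\<^sup>q\<close> about
  \<open>(T/(t-s)) powr \<nu>\<close>, the growing bound is still of the right order. Beyond that,
  the step path with \<open>2\<^sup>q\<close> steps is already within \<open>((t-s)/2\<^sup>q)
  powr \<nu>\<close>, which is of order \<open>(t-s) powr (\<nu> + \<nu>\<^sup>2)\<close>, of
  every finer one.\<close>

lemma gradient_remainder:
  "\<exists>C\<ge>0. \<forall>p s t y. 0 \<le> s \<longrightarrow> s < t \<longrightarrow> t \<le> T \<longrightarrow> tracks s y \<longrightarrow>
     norm (g t (dyadic p s t y) - g s y - H s y (\<omega> t - \<omega> s)) \<le> C * (t - s) powr (\<nu> + \<nu>\<^sup>2)"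
proof -
  obtain B where B: "0 \<le> B" "\<And>p s t y. \<lbrakk>0 \<le> s; s < t; t \<le> T; tracks s y\<rbrakk> \<Longrightarrow>
     norm (g t (dyadic p s t y) - g s y - H s y (\<omega> t - \<omega> s))
       \<le> B * (2 powr (1 - \<nu>)) ^ p * (t - s) powr (2 * \<nu>)"
    using gradient_remainder_growth by blast
  define C1 C2 where "C1 = B * T powr (\<nu> * (1 - \<nu>))" and "C2 = 2 * L\<^sup>2 * (2 powr \<nu> * T powr (- \<nu>\<^sup>2))"
  have C: "0 \<le> C1" "0 \<le> C2" using B(1) by (auto simp: C1_def C2_def)
  have "norm (g t (dyadic p s t y) - g s y - H s y (\<omega> t - \<omega> s)) \<le> (C1 + C2) * (t - s) powr (\<nu> + \<nu>\<^sup>2)"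
    if st: "0 \<le> s" "s < t" "t \<le> T" and y: "tracks s y" for p s t y
  proof -
    define d where "d = t - s"
    \<comment> \<open>the number of steps at which the two bounds balance; dividing by \<open>T\<close> makes it at least \<open>1\<close>\<close>
    define X where "X = (T / d) powr \<nu>"
    have d: "0 < d" "d \<le> T" using st by (auto simp: d_def)
    have X: "1 \<le> X" using d nu by (auto simp: X_def intro!: ge_one_powr_ge_zero)
    obtain q where q: "2 ^ q \<le> X" "X < 2 ^ Suc q"
    proof -
      have "1 \<le> nat \<lfloor>X\<rfloor>" using X by linarith
      then obtain q where "2 ^ q \<le> nat \<lfloor>X\<rfloor>" "nat \<lfloor>X\<rfloor> < 2 ^ (q + 1)"
        using ex_power_ivl1[of 2 "nat \<lfloor>X\<rfloor>"] by auto
      then have "real (2 ^ q) \<le> real (nat \<lfloor>X\<rfloor>)" "real (nat \<lfloor>X\<rfloor>) + 1 \<le> real (2 ^ (q + 1))"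
        by linarith+
      moreover have "real (nat \<lfloor>X\<rfloor>) \<le> X" "X < real (nat \<lfloor>X\<rfloor>) + 1"
        using X by linarith+
      ultimately have "real (2 ^ q) \<le> X" "X < real (2 ^ (q + 1))" by linarith+
      then show ?thesis using that[of q] by simp
    qed
    have small: "norm (g t (dyadic k s t y) - g s y - H s y (\<omega> t - \<omega> s)) \<le> C1 * d powr (\<nu> + \<nu>\<^sup>2)"
      if "k \<le> q" for k
    proof -
      have "(2 powr (1 - \<nu>)) ^ k = (2 ^ k) powr (1 - \<nu>)"
        by (simp add: powr_powr powr_realpow[symmetric] mult.commute)
      also have "\<dots> \<le> X powr (1 - \<nu>)"
      proof (intro powr_mono2)
        have "(2::real) ^ k \<le> 2 ^ q" using that by (intro power_increasing) auto
        then show "2 ^ k \<le> X" using q(1) by (rule order.trans)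
      qed (use nu in auto)
      also have "\<dots> = T powr (\<nu> * (1 - \<nu>)) / d powr (\<nu> * (1 - \<nu>))"
        using d by (simp add: X_def powr_powr powr_divide)
      finally have "B * (2 powr (1 - \<nu>)) ^ k * d powr (2 * \<nu>)
          \<le> B * (T powr (\<nu> * (1 - \<nu>)) / d powr (\<nu> * (1 - \<nu>))) * d powr (2 * \<nu>)"
        using B(1) by (intro mult_right_mono mult_left_mono) auto
      also have "\<dots> = C1 * (d powr (2 * \<nu>) / d powr (\<nu> * (1 - \<nu>)))"
        by (simp add: C1_def)
      also have "d powr (2 * \<nu>) / d powr (\<nu> * (1 - \<nu>)) = d powr (\<nu> + \<nu>\<^sup>2)"
        by (simp add: powr_diff[symmetric] algebra_simps power2_eq_square)
      finally show ?thesis using B(2)[OF st y, of k] by (simp add: d_def)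
    qed
    show ?thesis
    proof (cases "p \<le> q")
      case True
      then show ?thesis using small[of p] C(2) by (simp add: d_def distrib_right add_increasing2)
    next
      case False
      have less: "d / 2 ^ q \<le> 2 * d * (d / T) powr \<nu>"
      proof -
        have "1 / 2 ^ q \<le> 2 / X" using q(2) X by (simp add: field_simps)
        also have "2 / X = 2 * (d / T) powr \<nu>"
          using d by (simp add: X_def powr_divide)
        finally have "d * (1 / 2 ^ q) \<le> d * (2 * (d / T) powr \<nu>)"
          using d by (intro mult_left_mono) auto
        then show ?thesis by (simp add: mult.assoc mult.left_commute)
      qed
      have "(d / 2 ^ p) powr \<nu> \<le> (d / 2 ^ q) powr \<nu>"
        using d nu False by (intro powr_mono2 divide_left_mono power_increasing) auto
      then have "L * (d / 2 ^ p) powr \<nu> \<le> L * (d / 2 ^ q) powr \<nu>"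
        using L_ge_1 by (intro mult_left_mono) auto
      then have "norm (dyadic p s t y r - dyadic q s t y r) \<le> 2 * L * (d / 2 ^ q) powr \<nu>"
        if "r \<in> {0..t}" for r
        using dyadic_dist[OF y st that, of p q] unfolding d_def[symmetric] by linarith
      then have "norm (g t (dyadic p s t y) - g t (dyadic q s t y)) \<le> L * (2 * L * (d / 2 ^ q) powr \<nu>)"
        using st y by (intro lip_g tracks_cadlag[of t] dyadic_tracks) auto
      also have "\<dots> \<le> L * (2 * L * (2 * d * (d / T) powr \<nu>) powr \<nu>)"
        using less d L_ge_1 nu by (intro mult_left_mono powr_mono2) auto
      also have "(2 * d * (d / T) powr \<nu>) powr \<nu> = 2 powr \<nu> * T powr (- \<nu>\<^sup>2) * d powr (\<nu> + \<nu>\<^sup>2)"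
      proof -
        have "(2 * d * (d / T) powr \<nu>) powr \<nu> = 2 powr \<nu> * d powr \<nu> * (d / T) powr (\<nu>\<^sup>2)"
          using d T_pos by (simp add: powr_mult powr_powr power2_eq_square)
        also have "(d / T) powr (\<nu>\<^sup>2) = d powr (\<nu>\<^sup>2) * T powr (- \<nu>\<^sup>2)"
          using d T_pos by (simp add: powr_divide powr_minus_divide)
        finally show ?thesis by (simp add: powr_add)
      qed
      finally have "norm (g t (dyadic p s t y) - g t (dyadic q s t y)) \<le> C2 * d powr (\<nu> + \<nu>\<^sup>2)"
        by (simp add: C2_def power2_eq_square algebra_simps)
      moreover have "norm (g t (dyadic p s t y) - g s y - H s y (\<omega> t - \<omega> s))
        \<le> norm (g t (dyadic p s t y) - g t (dyadic q s t y))
          + norm (g t (dyadic q s t y) - g s y - H s y (\<omega> t - \<omega> s))"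
        by (rule norm_triangle_split2) simp
      ultimately show ?thesis
        using small[of q] by (simp add: d_def distrib_right)
    qed
  qed
  with C show ?thesis by (intro exI[of _ "C1 + C2"]) auto
qed

text \<open>Here the defect has order \<open>\<theta> = 2\<nu> + \<nu>\<^sup>2 > 1\<close>, so two
  halves contribute the factor \<open>2 powr (1 - \<theta>) < 1\<close> and the constant does not
  depend on \<open>p\<close>. The integral is part of the conclusion in the form of an unknown
  \<open>I\<close>, so that its existence comes out of the same induction.\<close>

lemma value_remainder_dyadic:
  "\<exists>C\<ge>0. \<forall>p s t y. 0 \<le> s \<longrightarrow> s < t \<longrightarrow> t \<le> T \<longrightarrow> tracks s y \<longrightarrow>
     (\<exists>I. ((\<lambda>u. D u (dyadic p s t y)) has_integral I) {s..t} \<and>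
       \<bar>F t (dyadic p s t y) - F s y - I - g s y \<bullet> (\<omega> t - \<omega> s)
         - (H s y (\<omega> t - \<omega> s) \<bullet> (\<omega> t - \<omega> s)) / 2\<bar> \<le> C * (t - s) powr (2 * \<nu> + \<nu>\<^sup>2))"
proof -
  obtain B where B: "0 \<le> B" "\<And>p s t y a. \<lbrakk>0 \<le> s; s < t; t \<le> T; tracks s y\<rbrakk> \<Longrightarrow>
     norm (H t (dyadic p s t y) a - H s y a) \<le> B * (t - s) powr \<nu> * norm a"
    using hessian_increment by blast
  obtain G where G: "0 \<le> G" "\<And>p s t y. \<lbrakk>0 \<le> s; s < t; t \<le> T; tracks s y\<rbrakk> \<Longrightarrow>
     norm (g t (dyadic p s t y) - g s y - H s y (\<omega> t - \<omega> s)) \<le> G * (t - s) powr (\<nu> + \<nu>\<^sup>2)"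
    using gradient_remainder by blast
  define \<theta> where "\<theta> = 2 * \<nu> + \<nu>\<^sup>2"
  define M where "M = T powr (\<nu> - \<nu>\<^sup>2)"
  define K where "K = G * L + B * L\<^sup>2 * M"
  define C where "C = max (L ^ 4 * M) (K / (2 powr \<theta> - 2))"
  have \<theta>: "1 < \<theta>" using nu by (simp add: \<theta>_def)
  then have two: "2 < 2 powr \<theta>" using powr_less_mono[of 1 \<theta> 2] by simp
  have C: "L ^ 4 * M \<le> C" "K / (2 powr \<theta> - 2) \<le> C" by (auto simp: C_def)
  have C0: "0 \<le> C" using L_ge_1 by (intro order.trans[OF _ C(1)]) (auto simp: M_def)
  have M: "d powr (3 * \<nu>) \<le> M * d powr \<theta>" if "0 < d" "d \<le> T" for d
  proof -
    have "\<nu>\<^sup>2 \<le> 1 * \<nu>" unfolding power2_eq_square using nu by (intro mult_right_mono) auto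
    then show ?thesis
      using powr_le_scaled[of d T \<theta> "3 * \<nu>"] that by (simp add: M_def \<theta>_def)
  qed
  have "\<exists>I. ((\<lambda>u. D u (dyadic p s t y)) has_integral I) {s..t} \<and>
      \<bar>F t (dyadic p s t y) - F s y - I - g s y \<bullet> (\<omega> t - \<omega> s)
         - (H s y (\<omega> t - \<omega> s) \<bullet> (\<omega> t - \<omega> s)) / 2\<bar> \<le> C * (t - s) powr \<theta>"
    if "0 \<le> s" "s < t" "t \<le> T" "tracks s y" for p s t y
    using that
  proof (induction p arbitrary: s t y)
    case 0
    let ?z = "follow s t y"
    have "((\<lambda>u. D u ?z) has_integral (F t ?z - F s ?z)) {s..t}"
      using 0 by (intro hor_F follow_frozen) auto
    moreover have "\<bar>F t ?z - F s y - (F t ?z - F s ?z) - g s y \<bullet> (\<omega> t - \<omega> s)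
         - (H s y (\<omega> t - \<omega> s) \<bullet> (\<omega> t - \<omega> s)) / 2\<bar> \<le> C * (t - s) powr \<theta>"
    proof -
      have "\<bar>F s ?z - F s y - g s y \<bullet> (\<omega> t - \<omega> s) - (H s y (\<omega> t - \<omega> s) \<bullet> (\<omega> t - \<omega> s)) / 2\<bar>
          \<le> L * norm (\<omega> t - \<omega> s) ^ 3"
        using 0 by (intro taylor_F tracks_cadlag) auto
      also have "\<dots> \<le> L * (L * (t - s) powr \<nu>) ^ 3"
        using 0 L_ge_1 by (intro mult_left_mono power_mono increment_bound) auto
      also have "\<dots> = L ^ 4 * (t - s) powr (3 * \<nu>)"
      proof -
        have "((t - s) powr \<nu>) ^ 3 = (t - s) powr (3 * \<nu>)"
          using 0 by (simp add: powr_power mult.commute)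
        moreover have "L * (L * x) ^ 3 = L ^ 4 * x ^ 3" for x
          by (simp add: eval_nat_numeral)
        ultimately show ?thesis by simp
      qed
      also have "\<dots> \<le> L ^ 4 * (M * (t - s) powr \<theta>)"
        using 0 by (intro mult_left_mono M) auto
      also have "\<dots> \<le> C * (t - s) powr \<theta>"
        unfolding mult.assoc[symmetric] by (intro mult_right_mono C) auto
      finally show ?thesis by simp
    qed
    ultimately show ?case by (auto simp: algebra_simps)
  next
    case (Suc p)
    define u where "u = (s + t) / 2"
    define z where "z = dyadic p s u y"
    define z' where "z' = dyadic p u t z"
    define h where "h = (t - s) / 2"
    define a where "a = \<omega> u - \<omega> s"
    define b where "b = \<omega> t - \<omega> u"
    have u: "0 \<le> s" "s < u" "u < t" "t \<le> T" "u \<le> T" "0 \<le> u"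
      and h: "u - s = h" "t - u = h" "0 < h" "h \<le> T"
      using Suc.prems by (auto simp: u_def h_def field_simps)
    have y: "tracks s y" by fact
    have z: "tracks u z"
      using dyadic_tracks[of s y u p] y u by (auto simp: z_def)
    have z': "tracks t z'"
      using dyadic_tracks[of u z t p] z u by (auto simp: z'_def)
    have ab: "a + b = \<omega> t - \<omega> s" by (simp add: a_def b_def)
    obtain I where I: "((\<lambda>r. D r z) has_integral I) {s..u}"
      "\<bar>F u z - F s y - I - g s y \<bullet> a - (H s y a \<bullet> a) / 2\<bar> \<le> C * h powr \<theta>"
      using Suc.IH[of s u y] u y h unfolding z_def a_def by auto
    obtain J where J: "((\<lambda>r. D r z') has_integral J) {u..t}"
      "\<bar>F t z' - F u z - J - g u z \<bullet> b - (H u z b \<bullet> b) / 2\<bar> \<le> C * h powr \<theta>"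
      using Suc.IH[of u t z] u z h unfolding z'_def b_def by auto
    \<comment> \<open>the bisected path changes its value at \<open>u\<close>, which is invisible to the integral\<close>
    have "((\<lambda>r. D r z') has_integral I) {s..u}"
    proof (rule has_integral_spike_finite[OF _ _ I(1)])
      show "D r z' = D r z" if "r \<in> {s..u} - {u}" for r
      proof -
        have "\<bar>D r z' - D r z\<bar> \<le> L * 0"
          using that u dyadic_before[of u z t _ p, OF z] unfolding z'_def[symmetric]
          by (intro lip_D tracks_cadlag[OF z] tracks_cadlag[OF z']) auto
        then show ?thesis by simp
      qed
    qed auto
    then have int: "((\<lambda>r. D r z') has_integral (I + J)) {s..t}"
      using u J(1) by (intro has_integral_combine[of s u t]) auto
    have na: "norm a \<le> L * h powr \<nu>" and nb: "norm b \<le> L * h powr \<nu>"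
      using u h unfolding a_def b_def by (auto intro!: increment_bound)
    have "\<bar>(g u z - g s y - H s y a) \<bullet> b\<bar> \<le> norm (g u z - g s y - H s y a) * norm b"
      by (rule Cauchy_Schwarz_ineq2)
    also have "\<dots> \<le> (G * h powr (\<nu> + \<nu>\<^sup>2)) * (L * h powr \<nu>)"
      using G(2)[of s u y p] u y h nb L_ge_1 unfolding z_def[symmetric] a_def[symmetric]
      by (intro mult_mono) (auto simp: G(1))
    also have "\<dots> = G * L * h powr \<theta>"
      by (simp add: \<theta>_def powr_add[symmetric] mult.assoc mult.left_commute add.commute)
    finally have e1: "\<bar>(g u z - g s y - H s y a) \<bullet> b\<bar> \<le> G * L * h powr \<theta>" .
    have "\<bar>(H u z b - H s y b) \<bullet> b\<bar> \<le> norm (H u z b - H s y b) * norm b"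
      by (rule Cauchy_Schwarz_ineq2)
    also have "\<dots> \<le> (B * h powr \<nu> * norm b) * norm b"
      using B(2)[of s u y p b] u y h unfolding z_def[symmetric]
      by (intro mult_right_mono) auto
    also have "\<dots> \<le> (B * h powr \<nu> * (L * h powr \<nu>)) * (L * h powr \<nu>)"
      using nb B(1) L_ge_1 by (intro mult_mono mult_nonneg_nonneg) auto
    also have "\<dots> = B * L\<^sup>2 * h powr (3 * \<nu>)"
      by (simp add: powr_add[symmetric] power2_eq_square mult.assoc mult.left_commute)
    also have "\<dots> \<le> B * L\<^sup>2 * (M * h powr \<theta>)"
      using B(1) h by (intro mult_left_mono M) auto
    finally have e2: "\<bar>(H u z b - H s y b) \<bullet> b\<bar> \<le> B * L\<^sup>2 * M * h powr \<theta>"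
      by (simp add: mult.assoc)
    have lin: "H s y (a + b) = H s y a + H s y b"
      using y u by (intro linear_add linear_H tracks_cadlag) auto
    have sym: "H s y a \<bullet> b = H s y b \<bullet> a"
      using y u by (intro sym_H tracks_cadlag) auto
    \<comment> \<open>the symmetry of the Hessian makes the mixed terms add up to \<open>H s y a \<bullet> b\<close>\<close>
    have "F t z' - F s y - (I + J) - g s y \<bullet> (a + b) - (H s y (a + b) \<bullet> (a + b)) / 2 =
        (F u z - F s y - I - g s y \<bullet> a - (H s y a \<bullet> a) / 2)
      + (F t z' - F u z - J - g u z \<bullet> b - (H u z b \<bullet> b) / 2)
      + (g u z - g s y - H s y a) \<bullet> b + ((H u z b - H s y b) \<bullet> b) / 2"
      unfolding lin using sym by (simp add: inner_simps field_simps)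
    then have "\<bar>F t z' - F s y - (I + J) - g s y \<bullet> (a + b) - (H s y (a + b) \<bullet> (a + b)) / 2\<bar>
        \<le> C * h powr \<theta> + C * h powr \<theta> + G * L * h powr \<theta> + B * L\<^sup>2 * M * h powr \<theta>"
      using I(2) J(2) e1 e2 by linarith
    also have "\<dots> = (2 * C + K) * h powr \<theta>"
      by (simp add: K_def algebra_simps)
    also have "\<dots> = (2 * C + K) / 2 powr \<theta> * (t - s) powr \<theta>"
      using Suc.prems by (simp add: h_def powr_divide)
    also have "\<dots> \<le> C * (t - s) powr \<theta>"
      using C(2) two by (intro mult_right_mono) (auto simp: field_simps)
    finally show ?case
      using int unfolding ab z'_def z_def u_def by auto
  qed
  with C0 show ?thesis unfolding \<theta>_def by blast
qed

lemma stop_path_eq: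
  assumes "t \<in> {0..T}"
  shows "F t (stop T t \<omega>) = F t \<omega>" "g t (stop T t \<omega>) = g t \<omega>" "H t (stop T t \<omega>) a = H t \<omega> a"
proof -
  have c: "stop T t \<omega> \<in> cadlag T" using assms path by (rule stop_cadlag[rotated])
  have e: "norm (stop T t \<omega> r - \<omega> r) \<le> 0" if "r \<in> {0..t}" for r
    using that assms by (auto simp: stop_def)
  show "F t (stop T t \<omega>) = F t \<omega>" using lip_F[OF c path assms e] by simp
  show "g t (stop T t \<omega>) = g t \<omega>" using lip_g[OF c path assms e] by simp
  show "H t (stop T t \<omega>) a = H t \<omega> a" using lip_H[OF c path assms e] by simp
qed

text \<open>The limit \<open>p \<rightarrow> \<infinity>\<close>: the step paths converge
  uniformly to \<open>\<omega>\<close>. This also shows that \<open>D(\<cdot>,\<omega>)\<close> is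
  integrable, as a uniform limit of integrable functions.\<close>

lemma value_remainder:
  "\<exists>C\<ge>0. \<forall>s t. 0 \<le> s \<longrightarrow> s < t \<longrightarrow> t \<le> T \<longrightarrow>
     (\<lambda>u. D u \<omega>) integrable_on {s..t} \<and>
     \<bar>F t \<omega> - F s \<omega> - integral {s..t} (\<lambda>u. D u \<omega>) - g s \<omega> \<bullet> (\<omega> t - \<omega> s)
         - (H s \<omega> (\<omega> t - \<omega> s) \<bullet> (\<omega> t - \<omega> s)) / 2\<bar> \<le> C * (t - s) powr (2 * \<nu> + \<nu>\<^sup>2)"
proof -
  obtain C where C: "0 \<le> C" "\<And>p s t y. \<lbrakk>0 \<le> s; s < t; t \<le> T; tracks s y\<rbrakk> \<Longrightarrow>
     \<exists>I. ((\<lambda>u. D u (dyadic p s t y)) has_integral I) {s..t} \<and>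
       \<bar>F t (dyadic p s t y) - F s y - I - g s y \<bullet> (\<omega> t - \<omega> s)
         - (H s y (\<omega> t - \<omega> s) \<bullet> (\<omega> t - \<omega> s)) / 2\<bar> \<le> C * (t - s) powr (2 * \<nu> + \<nu>\<^sup>2)"
    using value_remainder_dyadic by metis
  have "(\<lambda>u. D u \<omega>) integrable_on {s..t} \<and>
     \<bar>F t \<omega> - F s \<omega> - integral {s..t} (\<lambda>u. D u \<omega>) - g s \<omega> \<bullet> (\<omega> t - \<omega> s)
         - (H s \<omega> (\<omega> t - \<omega> s) \<bullet> (\<omega> t - \<omega> s)) / 2\<bar> \<le> C * (t - s) powr (2 * \<nu> + \<nu>\<^sup>2)"
    if st: "0 \<le> s" "s < t" "t \<le> T" for s t
  proof -
    define y where "y = stop T s \<omega>"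
    define e where "e p = L * (L * ((t - s) / 2 ^ p) powr \<nu>)" for p
    have y: "tracks s y" using st stop_frozen[of s] by (simp add: y_def)
    have close: "norm (dyadic p s t y r - \<omega> r) \<le> L * ((t - s) / 2 ^ p) powr \<nu>" if "r \<in> {0..t}" for p r
    proof (cases "r < s")
      case True
      then have "dyadic p s t y r = \<omega> r"
        using dyadic_before[OF y st, of r p] that st by (simp add: y_def stop_def)
      then show ?thesis using L_ge_1 by simp
    next
      case False
      then show ?thesis using that by (intro dyadic_close[OF y st]) auto
    qed
    have dz: "dyadic p s t y \<in> cadlag T" for p
      using dyadic_tracks[OF y st] by (rule tracks_cadlag)
    have eD: "\<bar>D r (dyadic p s t y) - D r \<omega>\<bar> \<le> e p" if "r \<in> {s..t}" for p r
      unfolding e_def using that st by (intro lip_D[OF dz path] close) auto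
    have eF: "\<bar>F t (dyadic p s t y) - F t \<omega>\<bar> \<le> e p" for p
      unfolding e_def using st by (intro lip_F[OF dz path] close) auto
    have lim: "e \<longlonglongrightarrow> 0"
    proof -
      have "(\<lambda>p. ((t - s) / 2 ^ p) powr \<nu>) = (\<lambda>p. (t - s) powr \<nu> * ((1 / 2) powr \<nu>) ^ p)"
        using st by (auto simp: fun_eq_iff powr_divide powr_power powr_powr powr_realpow[symmetric] power_divide mult.commute)
      moreover have "(1 / 2) powr \<nu> < (1::real)"
        using powr_less_mono2[of \<nu> "1/2" 1] nu by simp
      then have "(\<lambda>p. (t - s) powr \<nu> * ((1 / 2) powr \<nu>) ^ p) \<longlonglongrightarrow> (t - s) powr \<nu> * 0"
        by (intro tendsto_mult tendsto_const LIMSEQ_realpow_zero) auto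
      ultimately show ?thesis
        unfolding e_def by (auto intro!: tendsto_mult_right_zero)
    qed
    obtain I where I: "\<And>p. ((\<lambda>u. D u (dyadic p s t y)) has_integral I p) {s..t}"
      "\<And>p. \<bar>F t (dyadic p s t y) - F s y - I p - g s y \<bullet> (\<omega> t - \<omega> s)
         - (H s y (\<omega> t - \<omega> s) \<bullet> (\<omega> t - \<omega> s)) / 2\<bar> \<le> C * (t - s) powr (2 * \<nu> + \<nu>\<^sup>2)"
      using C(2)[OF st y] by metis
    have int: "(\<lambda>u. D u \<omega>) integrable_on {s..t}"
      unfolding cbox_interval[symmetric]
    proof (rule integrable_uniform_limit)
      fix \<epsilon> :: real assume "0 < \<epsilon>"
      then obtain p where "e p < \<epsilon>"
        using order_tendstoD(2)[OF lim] by (auto simp: eventually_sequentially)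
      then show "\<exists>f. (\<forall>x\<in>cbox s t. norm (D x \<omega> - f x) \<le> \<epsilon>) \<and> f integrable_on cbox s t"
        using eD[of _ p] I(1)[of p]
        by (intro exI[of _ "\<lambda>u. D u (dyadic p s t y)"])
          (force simp: abs_minus_commute has_integral_integrable)
    qed
    have "\<bar>F t \<omega> - F s \<omega> - integral {s..t} (\<lambda>u. D u \<omega>) - g s \<omega> \<bullet> (\<omega> t - \<omega> s)
         - (H s \<omega> (\<omega> t - \<omega> s) \<bullet> (\<omega> t - \<omega> s)) / 2\<bar>
        \<le> C * (t - s) powr (2 * \<nu> + \<nu>\<^sup>2) + (e p + e p * (t - s))" for p
    proof -
      have "((\<lambda>u. D u (dyadic p s t y) - D u \<omega>) has_integral (I p - integral {s..t} (\<lambda>u. D u \<omega>))) {s..t}"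
        using I(1) int by (intro has_integral_diff integrable_integral) auto
      then have "norm (I p - integral {s..t} (\<lambda>u. D u \<omega>)) \<le> e p * measure lborel (cbox s t)"
        unfolding cbox_interval[symmetric]
        by (rule has_integral_bound[rotated]) (use eD[of _ p] L_ge_1 in \<open>auto simp: e_def\<close>)
      then have "\<bar>I p - integral {s..t} (\<lambda>u. D u \<omega>)\<bar> \<le> e p * (t - s)"
        using st by simp
      then show ?thesis
        using I(2)[of p] eF[of p] stop_path_eq[of s] st unfolding y_def by simp
    qed
    moreover have "(\<lambda>p. C * (t - s) powr (2 * \<nu> + \<nu>\<^sup>2) + (e p + e p * (t - s)))
        \<longlonglongrightarrow> C * (t - s) powr (2 * \<nu> + \<nu>\<^sup>2) + (0 + 0 * (t - s))"
      by (intro tendsto_intros lim)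
    ultimately show ?thesis
      using int by (intro conjI LIMSEQ_le_const) auto
  qed
  with C(1) show ?thesis by blast
qed

text \<open>The bound for intervals that are not short: if \<open>\<omega>\<close> hardly moves on
  \<open>[s,t]\<close>, then the expansion compares \<open>F\<close> along \<open>\<omega>\<close>
  with \<open>F\<close> along \<open>\<omega>\<close> stopped at \<open>s\<close>, for which the
  increment is exactly the integral of \<open>D\<close>.\<close>

lemma value_remainder_oscillation:
  "\<exists>C\<ge>0. \<forall>s t e. 0 \<le> s \<longrightarrow> s < t \<longrightarrow> t \<le> T \<longrightarrow> (\<forall>r\<in>{s..t}. norm (\<omega> r - \<omega> s) \<le> e) \<longrightarrow>
     \<bar>F t \<omega> - F s \<omega> - integral {s..t} (\<lambda>u. D u \<omega>) - g s \<omega> \<bullet> (\<omega> t - \<omega> s)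
         - (H s \<omega> (\<omega> t - \<omega> s) \<bullet> (\<omega> t - \<omega> s)) / 2\<bar> \<le> C * e"
proof (intro exI conjI allI impI)
  let ?C = "L + L * T + L + L * (L * T powr \<nu>)"
  show "0 \<le> ?C" using L_ge_1 T_pos by simp
  fix s t e assume st: "0 \<le> s" "s < t" "t \<le> T" and e: "\<forall>r\<in>{s..t}. norm (\<omega> r - \<omega> s) \<le> e"
  define y where "y = stop T s \<omega>"
  define a where "a = \<omega> t - \<omega> s"
  have y: "y \<in> cadlag T" "frozen T \<omega> s y"
    using st stop_frozen[of s] path by (auto simp: y_def frozen_def)
  have "norm (\<omega> s - \<omega> s) \<le> e" using e st by (intro e[rule_format]) auto
  then have e0: "0 \<le> e" by simp
  have ye: "norm (\<omega> r - y r) \<le> e" if "r \<in> {0..t}" for r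
    using that e e0 st by (auto simp: y_def stop_def min_def)
  have F: "\<bar>F t \<omega> - F t y\<bar> \<le> L * e"
    using st by (intro lip_F path y ye) auto
  have "((\<lambda>u. D u \<omega> - D u y) has_integral (integral {s..t} (\<lambda>u. D u \<omega>) - (F t y - F s y))) {s..t}"
    using value_remainder st y by (intro has_integral_diff integrable_integral hor_F) auto
  then have "norm (integral {s..t} (\<lambda>u. D u \<omega>) - (F t y - F s y)) \<le> L * e * measure lborel (cbox s t)"
    unfolding cbox_interval[symmetric]
  proof (rule has_integral_bound[rotated])
    show "norm (D u \<omega> - D u y) \<le> L * e" if "u \<in> cbox s t" for u
      using that st unfolding real_norm_def by (intro lip_D path y ye) auto
  qed (use e0 L_ge_1 in auto)
  then have I: "\<bar>integral {s..t} (\<lambda>u. D u \<omega>) - (F t y - F s y)\<bar> \<le> L * e * (t - s)"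
    using st by simp
  have "L * e * (t - s) \<le> L * e * T"
    using st e0 L_ge_1 by (intro mult_left_mono) auto
  moreover have a: "norm a \<le> e" "norm a \<le> L * T powr \<nu>"
    using e st increment_bound[of s t T] by (auto simp: a_def)
  have "\<bar>g s y \<bullet> a\<bar> \<le> L * e"
    using Cauchy_Schwarz_ineq2[of "g s y" a] mult_mono[OF bound_g[of s y] a(1)] st y L_ge_1
    by fastforce
  moreover have "\<bar>H s y a \<bullet> a\<bar> \<le> L * (L * T powr \<nu>) * e"
  proof -
    have "\<bar>H s y a \<bullet> a\<bar> \<le> norm (H s y a) * norm a" by (rule Cauchy_Schwarz_ineq2)
    also have "\<dots> \<le> (L * norm a) * norm a"
      using st y by (intro mult_right_mono bound_H) auto
    also have "\<dots> \<le> (L * (L * T powr \<nu>)) * e"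
      using a L_ge_1 e0 by (intro mult_mono mult_left_mono mult_nonneg_nonneg) auto
    finally show ?thesis .
  qed
  moreover have "F s y = F s \<omega>" "g s y = g s \<omega>" "H s y a = H s \<omega> a"
    using stop_path_eq[of s] st by (auto simp: y_def)
  moreover have "0 \<le> L * (L * T powr \<nu>) * e" using L_ge_1 e0 by simp
  ultimately show "\<bar>F t \<omega> - F s \<omega> - integral {s..t} (\<lambda>u. D u \<omega>) - g s \<omega> \<bullet> (\<omega> t - \<omega> s)
      - (H s \<omega> (\<omega> t - \<omega> s) \<bullet> (\<omega> t - \<omega> s)) / 2\<bar> \<le> ?C * e"
    unfolding a_def[symmetric] using F I by (simp add: algebra_simps abs_le_iff) linarith
qed

end

section \<open>Riemann sums along a sequence of partitions\<close>

text \<open>Interpolation between the bound \<open>C d powr \<theta>\<close> with weight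
  \<open>1/\<theta>\<close> and the bound \<open>C e\<close>: the result is linear in the length
  \<open>d\<close>, hence summable over a partition, and still small with the oscillation
  \<open>e\<close>.\<close>

lemma geometric_interpolation:
  fixes a C d e \<theta> :: real
  assumes "0 \<le> a" "a \<le> C * d powr \<theta>" "a \<le> C * e" "1 < \<theta>" "0 < d" "0 \<le> e" "0 \<le> C"
  shows "a \<le> C * e powr (1 - 1 / \<theta>) * d"
proof (cases "a = 0")
  case True
  then show ?thesis using assms by simp
next
  case False
  have "a = a powr (1 / \<theta>) * a powr (1 - 1 / \<theta>)"
    using assms by (simp add: powr_add[symmetric])
  also have "\<dots> \<le> (C * d powr \<theta>) powr (1 / \<theta>) * (C * e) powr (1 - 1 / \<theta>)"
    using assms False by (intro mult_mono powr_mono2) auto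
  also have "\<dots> = (C powr (1 / \<theta>) * C powr (1 - 1 / \<theta>)) * (e powr (1 - 1 / \<theta>) * d)"
    using assms by (simp add: powr_mult powr_powr)
  also have "C powr (1 / \<theta>) * C powr (1 - 1 / \<theta>) = C"
    using assms by (simp add: powr_add[symmetric])
  finally show ?thesis by (simp add: mult.assoc)
qed

context path_expansion
begin

text \<open>Stopping \<open>\<omega>\<close> at the earlier of two times splits the increment of
  the Hessian into a change of the path at the later time and a purely horizontal one.\<close>

lemma hessian_continuous: "continuous_on {0..T} (\<lambda>t. H t \<omega> a)"
proof -
  have bound: "norm (H t \<omega> a - H s \<omega> a) \<le> L * (L * \<bar>t - s\<bar> powr \<nu>) * norm a + L * \<bar>t - s\<bar> * norm a"
    if st: "0 \<le> s" "s \<le> t" "t \<le> T" for s t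
  proof -
    define y where "y = stop T s \<omega>"
    have y: "frozen T \<omega> s y" "y \<in> cadlag T"
      using st stop_frozen[of s] by (auto simp: y_def frozen_def)
    have "norm (H t \<omega> a - H t y a) \<le> L * (L * \<bar>t - s\<bar> powr \<nu>) * norm a"
    proof (rule lip_H[OF path y(2)])
      fix r assume r: "r \<in> {0..t}"
      show "norm (\<omega> r - y r) \<le> L * \<bar>t - s\<bar> powr \<nu>"
        using increment_bound[of s r "t - s"] r st L_ge_1 by (cases "r \<le> s") (auto simp: y_def stop_def)
    qed (use st in auto)
    moreover have "norm (H t y a - H s y a) \<le> L * (t - s) * norm a"
      using st y by (intro hor_H) auto
    moreover have "H s y a = H s \<omega> a" using stop_path_eq(3)[of s] st by (simp add: y_def)
    ultimately show ?thesis
      using norm_triangle_split2[of "H t \<omega> a - H s \<omega> a" "H t \<omega> a - H t y a" "H t y a - H s y a"] st by simp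
  qed
  have bound': "norm (H t \<omega> a - H s \<omega> a) \<le> L * (L * \<bar>t - s\<bar> powr \<nu>) * norm a + L * \<bar>t - s\<bar> * norm a"
    if "s \<in> {0..T}" "t \<in> {0..T}" for s t
    using bound[of s t] bound[of t s] that by (cases "s \<le> t") (auto simp: norm_minus_commute abs_minus_commute)
  show ?thesis
    unfolding continuous_on_def
  proof
    fix s assume s: "s \<in> {0..T}"
    have "((\<lambda>t. \<bar>t - s\<bar> powr \<nu>) \<longlongrightarrow> 0) (at s within {0..T})"
      using nu by (intro tendsto_zero_powrI[where b = \<nu>] tendsto_rabs_zero LIM_zero tendsto_intros) auto
    moreover have "((\<lambda>t. \<bar>t - s\<bar>) \<longlongrightarrow> 0) (at s within {0..T})"
      by (intro tendsto_rabs_zero LIM_zero tendsto_ident_at)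
    ultimately have "((\<lambda>t. L * (L * \<bar>t - s\<bar> powr \<nu>) * norm a + L * \<bar>t - s\<bar> * norm a)
        \<longlongrightarrow> L * (L * 0) * norm a + L * 0 * norm a) (at s within {0..T})"
      by (intro tendsto_intros)
    then have lim: "((\<lambda>t. L * (L * \<bar>t - s\<bar> powr \<nu>) * norm a + L * \<bar>t - s\<bar> * norm a)
        \<longlongrightarrow> 0) (at s within {0..T})" by simp
    have "((\<lambda>t. H t \<omega> a - H s \<omega> a) \<longlongrightarrow> 0) (at s within {0..T})"
      by (rule Lim_null_comparison[OF _ lim]) (use bound'[OF s] in \<open>auto simp: eventually_at_filter\<close>)
    then show "((\<lambda>t. H t \<omega> a) \<longlongrightarrow> H s \<omega> a) (at s within {0..T})" by (simp add: LIM_zero_iff)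
  qed
qed

text \<open>The step path along a partition that enters the pathwise integral: on \<open>[p j, p
  (j+1))\<close> with \<open>j < i\<close> it has the value \<open>\<omega> (p (j+1))\<close>, and
  from \<open>p i\<close> on the value \<open>\<omega> (p i)\<close>.\<close>

primrec step_path :: "(nat \<Rightarrow> real) \<Rightarrow> nat \<Rightarrow> real \<Rightarrow> 'v" where
  "step_path p 0 = stop T 0 \<omega>"
| "step_path p (Suc i) = follow (p i) (p (Suc i)) (step_path p i)"

context
  fixes p :: "nat \<Rightarrow> real" and M :: nat
  assumes p: "p 0 = 0" "p M = T" "\<forall>i<M. p i < p (Suc i)"
begin

lemma p_range: "i \<le> M \<Longrightarrow> p i \<in> {0..T}"
  using partition_mono[OF p(3), of 0 i] partition_mono[OF p(3), of i M] p by auto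

lemma step_path_tracks: "i \<le> M \<Longrightarrow> tracks (p i) (step_path p i)"
proof (induction i)
  case 0
  then show ?case using stop_frozen[of 0] T_pos p by simp
next
  case (Suc i)
  then show ?case
    using p_range[of i] p_range[of "Suc i"] p(3) by (auto intro!: follow_tracks simp: less_imp_le)
qed

lemma step_path_after: "i \<le> M \<Longrightarrow> r \<in> {p i..T} \<Longrightarrow> step_path p i r = \<omega> (p i)"
  using tracks_const[OF step_path_tracks] by simp

lemma step_path_within:
  "\<lbrakk>j < i; i \<le> M; r \<in> {p j..<p (Suc j)}\<rbrakk> \<Longrightarrow> step_path p i r = \<omega> (p (Suc j))"
proof (induction i)
  case (Suc i)
  have r: "r \<in> {0..T}"
    using p_range[of j] p_range[of "Suc j"] Suc.prems by auto
  have eq: "step_path p (Suc i) r = (if r < p i then step_path p i r else \<omega> (p (Suc i)))"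
    using follow_apply[OF step_path_tracks, of i r] Suc.prems p_range[of i] r by simp
  show ?case
  proof (cases "j = i")
    case True
    then show ?thesis using eq Suc.prems by simp
  next
    case False
    then have "p (Suc j) \<le> p i"
      using Suc.prems by (intro partition_mono[OF p(3)]) auto
    then show ?thesis using eq Suc False by auto
  qed
qed simp

lemma step_path_close:
  assumes osc: "\<And>j r. j < M \<Longrightarrow> r \<in> {p j..p (Suc j)} \<Longrightarrow> norm (\<omega> r - \<omega> (p j)) \<le> e"
    and "0 \<le> e" "i \<le> M" "r \<in> {0..p i}"
  shows "norm (step_path p i r - \<omega> r) \<le> 2 * e"
proof (cases "r = p i")
  case True
  then show ?thesis using step_path_after[of i r] p_range[of i] assms by simp
next
  case False
  then obtain j where j: "j < i" "r \<in> {p j..<p (Suc j)}"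
    using partition_locate[of p r i] p(1) assms by auto
  have "p j < p (Suc j)" using p(3) j assms by auto
  then have "norm (\<omega> (p (Suc j)) - \<omega> (p j)) \<le> e" "norm (\<omega> r - \<omega> (p j)) \<le> e"
    using osc[of j] j assms by auto
  moreover have "norm (\<omega> (p (Suc j)) - \<omega> r)
      \<le> norm (\<omega> (p (Suc j)) - \<omega> (p j)) + norm (\<omega> (p j) - \<omega> r)"
    by (rule norm_triangle_split2) simp
  moreover have "step_path p i r = \<omega> (p (Suc j))"
    using step_path_within[of j i r] j assms by simp
  ultimately show ?thesis
    using norm_minus_commute[of "\<omega> r" "\<omega> (p j)"] by simp
qed

lemma sum_integrals:
  assumes int: "\<And>s t. 0 \<le> s \<Longrightarrow> s < t \<Longrightarrow> t \<le> T \<Longrightarrow> f integrable_on {s..t}"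
  shows "(\<Sum>i<M. integral {p i..p (Suc i)} f) = integral {0..T} (f :: real \<Rightarrow> real)"
proof -
  have "k \<le> M \<Longrightarrow> (\<Sum>i<k. integral {p i..p (Suc i)} f) = integral {0..p k} f" for k
  proof (induction k)
    case (Suc k)
    then have "p k < p (Suc k)" using p(3) by simp
    then have "integral {0..p k} f + integral {p k..p (Suc k)} f = integral {0..p (Suc k)} f"
      using p_range[of k] p_range[of "Suc k"] Suc.prems
      by (intro Henstock_Kurzweil_Integration.integral_combine int) auto
    then show ?case using Suc by simp
  qed (simp add: p)
  then show ?thesis using p(2) by (metis order.refl)
qed

lemma sum_steps: "(\<Sum>i<M. p (Suc i) - p i) = T"
  using p by (simp add: sum_lessThan_telescope)

end

lemma riemann_sum_error:
  "\<exists>C\<ge>0. \<forall>p M e. p 0 = 0 \<longrightarrow> p M = T \<longrightarrow> (\<forall>i<M. p i < p (Suc i)) \<longrightarrow> 0 \<le> e \<longrightarrow>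
     (\<forall>j<M. \<forall>r\<in>{p j..p (Suc j)}. norm (\<omega> r - \<omega> (p j)) \<le> e) \<longrightarrow>
     \<bar>F T \<omega> - F 0 \<omega> - integral {0..T} (\<lambda>u. D u \<omega>) - (\<Sum>i<M. g (p i) \<omega> \<bullet> (\<omega> (p (Suc i)) - \<omega> (p i)))
        - (\<Sum>i<M. H (p i) \<omega> (\<omega> (p (Suc i)) - \<omega> (p i)) \<bullet> (\<omega> (p (Suc i)) - \<omega> (p i))) / 2\<bar>
      \<le> C * e powr (1 - 1 / (2 * \<nu> + \<nu>\<^sup>2))"
proof -
  define \<theta> where "\<theta> = 2 * \<nu> + \<nu>\<^sup>2"
  have \<theta>: "1 < \<theta>" using nu by (simp add: \<theta>_def)
  define R where "R s t = F t \<omega> - F s \<omega> - integral {s..t} (\<lambda>u. D u \<omega>) - g s \<omega> \<bullet> (\<omega> t - \<omega> s)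
         - (H s \<omega> (\<omega> t - \<omega> s) \<bullet> (\<omega> t - \<omega> s)) / 2" for s t
  obtain A where A: "0 \<le> A" "\<And>s t. 0 \<le> s \<Longrightarrow> s < t \<Longrightarrow> t \<le> T \<Longrightarrow> (\<lambda>u. D u \<omega>) integrable_on {s..t}"
    "\<And>s t. 0 \<le> s \<Longrightarrow> s < t \<Longrightarrow> t \<le> T \<Longrightarrow> \<bar>R s t\<bar> \<le> A * (t - s) powr \<theta>"
    using value_remainder unfolding R_def \<theta>_def by metis
  obtain B where B: "0 \<le> B" "\<And>s t e. \<lbrakk>0 \<le> s; s < t; t \<le> T; \<forall>r\<in>{s..t}. norm (\<omega> r - \<omega> s) \<le> e\<rbrakk>
      \<Longrightarrow> \<bar>R s t\<bar> \<le> B * e"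
    using value_remainder_oscillation unfolding R_def by metis
  define C where "C = max A B"
  have C: "0 \<le> C" "A \<le> C" "B \<le> C" using A(1) by (auto simp: C_def)
  have "\<bar>F T \<omega> - F 0 \<omega> - integral {0..T} (\<lambda>u. D u \<omega>) - (\<Sum>i<M. g (p i) \<omega> \<bullet> (\<omega> (p (Suc i)) - \<omega> (p i)))
        - (\<Sum>i<M. H (p i) \<omega> (\<omega> (p (Suc i)) - \<omega> (p i)) \<bullet> (\<omega> (p (Suc i)) - \<omega> (p i))) / 2\<bar>
      \<le> C * T * e powr (1 - 1 / \<theta>)"
    if p: "p 0 = 0" "p M = T" "\<forall>i<M. p i < p (Suc i)" and e: "0 \<le> e"
      and osc: "\<forall>j<M. \<forall>r\<in>{p j..p (Suc j)}. norm (\<omega> r - \<omega> (p j)) \<le> e" for p M e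
  proof -
    have tele: "(\<Sum>i<M. F (p (Suc i)) \<omega>) - (\<Sum>i<M. F (p i) \<omega>) = F T \<omega> - F 0 \<omega>"
      unfolding sum_subtractf[symmetric] sum_lessThan_telescope[of "\<lambda>i. F (p i) \<omega>"] p(1,2) by simp
    have int: "(\<Sum>i<M. integral {p i..p (Suc i)} (\<lambda>u. D u \<omega>)) = integral {0..T} (\<lambda>u. D u \<omega>)"
      by (rule sum_integrals[OF p A(2)])
    have "(\<Sum>i<M. R (p i) (p (Suc i))) = F T \<omega> - F 0 \<omega> - integral {0..T} (\<lambda>u. D u \<omega>)
        - (\<Sum>i<M. g (p i) \<omega> \<bullet> (\<omega> (p (Suc i)) - \<omega> (p i)))
        - (\<Sum>i<M. H (p i) \<omega> (\<omega> (p (Suc i)) - \<omega> (p i)) \<bullet> (\<omega> (p (Suc i)) - \<omega> (p i))) / 2"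
      unfolding R_def sum_subtractf sum_divide_distrib[symmetric] tele int by simp
    moreover have "\<bar>\<Sum>i<M. R (p i) (p (Suc i))\<bar> \<le> (\<Sum>i<M. C * e powr (1 - 1 / \<theta>) * (p (Suc i) - p i))"
    proof (rule order.trans[OF sum_abs sum_mono])
      fix i assume i: "i \<in> {..<M}"
      have r: "0 \<le> p i" "p (Suc i) \<le> T" "p i < p (Suc i)"
        using p_range[OF p, of i] p_range[OF p, of "Suc i"] p(3) i by auto
      have "\<bar>R (p i) (p (Suc i))\<bar> \<le> A * (p (Suc i) - p i) powr \<theta>"
        using r by (intro A(3)) auto
      also have "\<dots> \<le> C * (p (Suc i) - p i) powr \<theta>"
        by (intro mult_right_mono C) auto
      finally have 1: "\<bar>R (p i) (p (Suc i))\<bar> \<le> C * (p (Suc i) - p i) powr \<theta>" .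
      have "\<bar>R (p i) (p (Suc i))\<bar> \<le> B * e"
        using r osc i by (intro B(2)) auto
      also have "\<dots> \<le> C * e"
        using e by (intro mult_right_mono C) auto
      finally show "\<bar>R (p i) (p (Suc i))\<bar> \<le> C * e powr (1 - 1 / \<theta>) * (p (Suc i) - p i)"
        using 1 r C(1) e \<theta> by (intro geometric_interpolation) auto
    qed
    moreover have "(\<Sum>i<M. C * e powr (1 - 1 / \<theta>) * (p (Suc i) - p i)) = C * e powr (1 - 1 / \<theta>) * T"
      using sum_steps[OF p] by (simp add: sum_distrib_left[symmetric])
    ultimately show ?thesis by (simp add: mult.commute mult.left_commute)
  qed
  moreover have "0 \<le> C * T" using C T_pos by simp
  ultimately show ?thesis unfolding \<theta>_def by blast
qed

text \<open>Along the step path every increment of \<open>F\<close> splits into a jump at \<open>p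
  i\<close>, expanded to second order with an error of order
  \<open>|\<omega>(t\<^sub>i,t\<^sub>i\<^sub>+\<^sub>1)|\<^sup>3\<close>, and a horizontal part.
  The cubic errors sum to at most the oscillation times the sum of squares.\<close>

lemma step_sum_error:
  assumes p: "p 0 = 0" "p M = T" "\<forall>i<M. p i < p (Suc i)" and e: "0 \<le> e"
    and osc: "\<And>j r. j < M \<Longrightarrow> r \<in> {p j..p (Suc j)} \<Longrightarrow> norm (\<omega> r - \<omega> (p j)) \<le> e"
  shows "\<bar>F T \<omega> - F 0 \<omega> - integral {0..T} (\<lambda>u. D u \<omega>)
        - (\<Sum>i<M. g (p i) (step_path p i) \<bullet> (\<omega> (p (Suc i)) - \<omega> (p i)))
        - (\<Sum>i<M. H (p i) \<omega> (\<omega> (p (Suc i)) - \<omega> (p i)) \<bullet> (\<omega> (p (Suc i)) - \<omega> (p i))) / 2\<bar>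
      \<le> 2 * L * e * (1 + T + (\<Sum>i<M. (norm (\<omega> (p (Suc i)) - \<omega> (p i)))\<^sup>2))"
proof -
  define z where "z i = step_path p i" for i
  define a where "a i = \<omega> (p (Suc i)) - \<omega> (p i)" for i
  define J where "J i = integral {p i..p (Suc i)} (\<lambda>u. D u \<omega>)" for i
  define E where "E i = F (p (Suc i)) (z (Suc i)) - F (p i) (z i) - J i - g (p i) (z i) \<bullet> a i
    - (H (p i) \<omega> (a i) \<bullet> a i) / 2" for i
  have int: "(\<lambda>u. D u \<omega>) integrable_on {s..t}" if "0 \<le> s" "s < t" "t \<le> T" for s t
    using value_remainder that by blast
  have z: "tracks (p i) (z i)" "z i \<in> cadlag T" if "i \<le> M" for i
    using step_path_tracks[OF p that] tracks_cadlag by (auto simp: z_def)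
  have close: "norm (z i r - \<omega> r) \<le> 2 * e" if "i \<le> M" "r \<in> {0..p i}" for i r
    using step_path_close[OF p osc e] that by (simp add: z_def)
  have Ebound: "\<bar>E i\<bar> \<le> 2 * L * e * (p (Suc i) - p i) + 2 * L * e * (norm (a i))\<^sup>2" if i: "i < M" for i
  proof -
    have r: "0 \<le> p i" "p (Suc i) \<le> T" "p i < p (Suc i)" "p i \<le> T"
      using p_range[OF p, of i] p_range[OF p, of "Suc i"] p(3) i by auto
    have zs: "z (Suc i) = bump T (p i) (z i) (a i)" by (simp add: z_def a_def)
    have ai: "norm (a i) \<le> e"
      unfolding a_def using r i by (intro osc) auto
    have "frozen T \<omega> (p i) (z (Suc i))"
      unfolding zs a_def using r z[of i] i by (intro follow_frozen) auto
    then have "((\<lambda>u. D u (z (Suc i))) has_integral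
        (F (p (Suc i)) (z (Suc i)) - F (p i) (z (Suc i)))) {p i..p (Suc i)}"
      using r by (intro hor_F) auto
    then have "((\<lambda>u. D u (z (Suc i)) - D u \<omega>) has_integral
        (F (p (Suc i)) (z (Suc i)) - F (p i) (z (Suc i)) - J i)) {p i..p (Suc i)}"
      unfolding J_def using r int by (intro has_integral_diff integrable_integral) auto
    then have "norm (F (p (Suc i)) (z (Suc i)) - F (p i) (z (Suc i)) - J i)
        \<le> L * (2 * e) * measure lborel (cbox (p i) (p (Suc i)))"
      unfolding cbox_interval[symmetric]
    proof (rule has_integral_bound[rotated])
      show "norm (D u (z (Suc i)) - D u \<omega>) \<le> L * (2 * e)" if "u \<in> cbox (p i) (p (Suc i))" for u
        using that r i unfolding real_norm_def by (intro lip_D path z close) auto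
    qed (use e L_ge_1 in auto)
    then have 1: "\<bar>F (p (Suc i)) (z (Suc i)) - F (p i) (z (Suc i)) - J i\<bar> \<le> 2 * L * e * (p (Suc i) - p i)"
      using r by simp
    have "\<bar>F (p i) (z (Suc i)) - F (p i) (z i) - g (p i) (z i) \<bullet> a i - (H (p i) (z i) (a i) \<bullet> a i) / 2\<bar>
        \<le> L * norm (a i) ^ 3"
      unfolding zs using r i by (intro taylor_F z) auto
    also have "norm (a i) ^ 3 = norm (a i) * (norm (a i))\<^sup>2"
      by (simp add: eval_nat_numeral)
    also have "L * (norm (a i) * (norm (a i))\<^sup>2) \<le> L * (e * (norm (a i))\<^sup>2)"
      using L_ge_1 ai by (intro mult_left_mono mult_right_mono) auto
    finally have 2: "\<bar>F (p i) (z (Suc i)) - F (p i) (z i) - g (p i) (z i) \<bullet> a i - (H (p i) (z i) (a i) \<bullet> a i) / 2\<bar>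
        \<le> L * e * (norm (a i))\<^sup>2" by simp
    have "\<bar>(H (p i) (z i) (a i) - H (p i) \<omega> (a i)) \<bullet> a i\<bar> \<le> norm (H (p i) (z i) (a i) - H (p i) \<omega> (a i)) * norm (a i)"
      by (rule Cauchy_Schwarz_ineq2)
    also have "\<dots> \<le> (L * (2 * e) * norm (a i)) * norm (a i)"
      using r i by (intro mult_right_mono lip_H path z close) auto
    finally have 3: "\<bar>(H (p i) (z i) (a i) - H (p i) \<omega> (a i)) \<bullet> a i\<bar> / 2 \<le> L * e * (norm (a i))\<^sup>2"
      by (simp add: power2_eq_square)
    have "E i = (F (p (Suc i)) (z (Suc i)) - F (p i) (z (Suc i)) - J i)
      + (F (p i) (z (Suc i)) - F (p i) (z i) - g (p i) (z i) \<bullet> a i - (H (p i) (z i) (a i) \<bullet> a i) / 2)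
      + ((H (p i) (z i) (a i) - H (p i) \<omega> (a i)) \<bullet> a i) / 2"
      by (simp add: E_def inner_diff_left diff_divide_distrib)
    then show ?thesis using 1 2 3 by linarith
  qed
  have tele: "(\<Sum>i<M. F (p (Suc i)) (z (Suc i))) - (\<Sum>i<M. F (p i) (z i)) = F T (z M) - F 0 (z 0)"
    unfolding sum_subtractf[symmetric] sum_lessThan_telescope[of "\<lambda>i. F (p i) (z i)"] p(1,2) by simp
  have sum_J: "(\<Sum>i<M. J i) = integral {0..T} (\<lambda>u. D u \<omega>)"
    unfolding J_def by (rule sum_integrals[OF p int])
  have "(\<Sum>i<M. E i) = F T (z M) - F 0 (z 0) - integral {0..T} (\<lambda>u. D u \<omega>)
      - (\<Sum>i<M. g (p i) (z i) \<bullet> a i) - (\<Sum>i<M. H (p i) \<omega> (a i) \<bullet> a i) / 2"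
    unfolding E_def sum_subtractf sum_divide_distrib[symmetric] tele sum_J by simp
  moreover have "\<bar>\<Sum>i<M. E i\<bar> \<le> (\<Sum>i<M. 2 * L * e * (p (Suc i) - p i) + 2 * L * e * (norm (a i))\<^sup>2)"
    by (rule order.trans[OF sum_abs sum_mono]) (simp add: Ebound)
  moreover have "(\<Sum>i<M. 2 * L * e * (p (Suc i) - p i) + 2 * L * e * (norm (a i))\<^sup>2)
      = 2 * L * e * (T + (\<Sum>i<M. (norm (a i))\<^sup>2))"
    unfolding sum.distrib sum_distrib_left[symmetric] sum_steps[OF p] by (simp add: distrib_left)
  moreover have "\<bar>F T (z M) - F T \<omega>\<bar> \<le> L * (2 * e)"
    using p T_pos by (intro lip_F z path close) auto
  moreover have "F 0 (z 0) = F 0 \<omega>"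
    using stop_path_eq(1)[of 0] T_pos by (simp add: z_def)
  ultimately show ?thesis
    unfolding z_def[symmetric] a_def[symmetric] by (simp add: algebra_simps)
qed

lemma riemann_sums_converge:
  assumes \<pi>: "partition_seq T m \<pi>"
    and osc: "\<And>n j r. j < m n \<Longrightarrow> r \<in> {\<pi> n j..\<pi> n (Suc j)} \<Longrightarrow> norm (\<omega> r - \<omega> (\<pi> n j)) \<le> e n"
    and e: "\<And>n. 0 \<le> e n" "e \<longlonglongrightarrow> 0"
    and B: "\<And>n. (\<Sum>i<m n. (norm (\<omega> (\<pi> n (Suc i)) - \<omega> (\<pi> n i)))\<^sup>2) \<le> B"
    and q: "(\<lambda>n. \<Sum>i<m n. H (\<pi> n i) \<omega> (\<omega> (\<pi> n (Suc i)) - \<omega> (\<pi> n i))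
              \<bullet> (\<omega> (\<pi> n (Suc i)) - \<omega> (\<pi> n i))) \<longlonglongrightarrow> q"
  defines "l \<equiv> F T \<omega> - F 0 \<omega> - integral {0..T} (\<lambda>u. D u \<omega>) - q / 2"
  shows "(\<lambda>n. \<Sum>i<m n. g (\<pi> n i) \<omega> \<bullet> (\<omega> (\<pi> n (Suc i)) - \<omega> (\<pi> n i))) \<longlonglongrightarrow> l"
    and "(\<lambda>n. \<Sum>i<m n. g (\<pi> n i) (step_path (\<pi> n) i) \<bullet> (\<omega> (\<pi> n (Suc i)) - \<omega> (\<pi> n i))) \<longlonglongrightarrow> l"
proof -
  define Q where "Q n = (\<Sum>i<m n. H (\<pi> n i) \<omega> (\<omega> (\<pi> n (Suc i)) - \<omega> (\<pi> n i))
    \<bullet> (\<omega> (\<pi> n (Suc i)) - \<omega> (\<pi> n i)))" for n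
  define l0 where "l0 = F T \<omega> - F 0 \<omega> - integral {0..T} (\<lambda>u. D u \<omega>)"
  have \<pi>': "\<pi> n 0 = 0" "\<pi> n (m n) = T" "\<forall>i<m n. \<pi> n i < \<pi> n (Suc i)" for n
    using \<pi> by (auto simp: partition_seq_def)
  have main: "S \<longlonglongrightarrow> l" if "\<And>n. \<bar>l0 - S n - Q n / 2\<bar> \<le> b n" "b \<longlonglongrightarrow> 0" for S b :: "nat \<Rightarrow> real"
  proof -
    have "(\<lambda>n. l0 - S n - Q n / 2) \<longlonglongrightarrow> 0"
      using that by (intro Lim_null_comparison[OF _ that(2)]) (simp add: eventually_sequentially)
    then have "(\<lambda>n. l0 - Q n / 2 - (l0 - S n - Q n / 2)) \<longlonglongrightarrow> l0 - q / 2 - 0"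
      using q unfolding Q_def[symmetric] by (intro tendsto_intros) auto
    then show ?thesis by (simp add: l_def l0_def)
  qed
  obtain C where C: "\<And>p M e. \<lbrakk>p 0 = 0; p M = T; \<forall>i<M. p i < p (Suc i); 0 \<le> e;
        \<forall>j<M. \<forall>r\<in>{p j..p (Suc j)}. norm (\<omega> r - \<omega> (p j)) \<le> e\<rbrakk> \<Longrightarrow>
     \<bar>F T \<omega> - F 0 \<omega> - integral {0..T} (\<lambda>u. D u \<omega>) - (\<Sum>i<M. g (p i) \<omega> \<bullet> (\<omega> (p (Suc i)) - \<omega> (p i)))
        - (\<Sum>i<M. H (p i) \<omega> (\<omega> (p (Suc i)) - \<omega> (p i)) \<bullet> (\<omega> (p (Suc i)) - \<omega> (p i))) / 2\<bar>
      \<le> C * e powr (1 - 1 / (2 * \<nu> + \<nu>\<^sup>2))"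
    using riemann_sum_error by blast
  have bound: "\<bar>l0 - (\<Sum>i<m n. g (\<pi> n i) \<omega> \<bullet> (\<omega> (\<pi> n (Suc i)) - \<omega> (\<pi> n i))) - Q n / 2\<bar>
      \<le> C * e n powr (1 - 1 / (2 * \<nu> + \<nu>\<^sup>2))" for n
    unfolding l0_def Q_def using osc e(1) by (intro C \<pi>') auto
  have "1 / (2 * \<nu> + \<nu>\<^sup>2) < 1" using nu by simp
  then have "(\<lambda>n. C * e n powr (1 - 1 / (2 * \<nu> + \<nu>\<^sup>2))) \<longlonglongrightarrow> C * 0"
    using e by (intro tendsto_mult tendsto_const tendsto_zero_powrI[of _ _ _ "1 - 1 / (2 * \<nu> + \<nu>\<^sup>2)"]) auto
  then show "(\<lambda>n. \<Sum>i<m n. g (\<pi> n i) \<omega> \<bullet> (\<omega> (\<pi> n (Suc i)) - \<omega> (\<pi> n i))) \<longlonglongrightarrow> l"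
    by (intro main[OF bound]) simp
  have "\<bar>l0 - (\<Sum>i<m n. g (\<pi> n i) (step_path (\<pi> n) i) \<bullet> (\<omega> (\<pi> n (Suc i)) - \<omega> (\<pi> n i))) - Q n / 2\<bar>
      \<le> 2 * L * e n * (1 + T + B)" for n
  proof -
    have "\<bar>l0 - (\<Sum>i<m n. g (\<pi> n i) (step_path (\<pi> n) i) \<bullet> (\<omega> (\<pi> n (Suc i)) - \<omega> (\<pi> n i))) - Q n / 2\<bar>
      \<le> 2 * L * e n * (1 + T + (\<Sum>i<m n. (norm (\<omega> (\<pi> n (Suc i)) - \<omega> (\<pi> n i)))\<^sup>2))"
      unfolding l0_def Q_def by (intro step_sum_error \<pi>' e osc)
    also have "\<dots> \<le> 2 * L * e n * (1 + T + B)"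
      using B[of n] e(1)[of n] L_ge_1 by (intro mult_left_mono) auto
    finally show ?thesis .
  qed
  moreover have "(\<lambda>n. 2 * L * e n * (1 + T + B)) \<longlonglongrightarrow> 2 * L * 0 * (1 + T + B)"
    by (intro tendsto_intros e)
  ultimately show "(\<lambda>n. \<Sum>i<m n. g (\<pi> n i) (step_path (\<pi> n) i) \<bullet> (\<omega> (\<pi> n (Suc i)) - \<omega> (\<pi> n i))) \<longlonglongrightarrow> l"
    by (intro main) auto
qed

text \<open>At \<open>p 0 = 0\<close> the convention \<open>x(0-) = x(0)\<close> makes the
  left-stopped approximation constant with value \<open>\<omega> (p 1)\<close>, not
  \<open>\<omega> (p 0)\<close>; this is the step path after its first jump. The resulting error
  in the first summand is handled by \<open>pathwise_integrand_correction\<close>.\<close>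

lemma stop_left_pc_approx:
  assumes p: "p 0 = 0" "p M = T" "\<forall>i<M. p i < p (Suc i)" and i: "i < M"
  shows "stop_left T (p i) (pc_approx T M p \<omega>) = step_path p (if i = 0 then 1 else i)"
proof -
  have M: "0 < M" using i by simp
  have pc: "pc_approx T M p \<omega> r = \<omega> (p (Suc j))" if "j < M" "r \<in> {p j..<p (Suc j)}" for j r
  proof -
    have r: "r \<in> {0..T}" "r \<noteq> T"
      using p_range[OF p, of j] p_range[OF p, of "Suc j"] that by auto
    have "indicator {p k..<p (Suc k)} r *\<^sub>R \<omega> (p (Suc k)) = (if k = j then \<omega> (p (Suc j)) else 0)"
      if "k < M" for k
    proof -
      have "r \<notin> {p k..<p (Suc k)}" if "k \<noteq> j"
      proof (cases "k < j")
        case True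
        then have "p (Suc k) \<le> p j"
          using \<open>j < M\<close> by (intro partition_mono[OF p(3)]) auto
        then show ?thesis using \<open>r \<in> {p j..<p (Suc j)}\<close> by auto
      next
        case False
        then have "p (Suc j) \<le> p k"
          using \<open>k < M\<close> \<open>k \<noteq> j\<close> by (intro partition_mono[OF p(3)]) auto
        then show ?thesis using \<open>r \<in> {p j..<p (Suc j)}\<close> by auto
      qed
      then show ?thesis using \<open>r \<in> {p j..<p (Suc j)}\<close> by (auto simp: indicator_def)
    qed
    then have "(\<Sum>k<M. indicator {p k..<p (Suc k)} r *\<^sub>R \<omega> (p (Suc k)))
        = (\<Sum>k<M. if k = j then \<omega> (p (Suc j)) else 0)"
      by (intro sum.cong) auto
    also have "\<dots> = \<omega> (p (Suc j))" using \<open>j < M\<close> by simp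
    finally show ?thesis using r by (simp add: pc_approx_def)
  qed
  have left: "left_lim (pc_approx T M p \<omega>) (p i) = \<omega> (p (if i = 0 then 1 else i))"
  proof (cases i)
    case 0
    then have "p 0 < p (Suc 0)" using p(3) M by simp
    then show ?thesis using pc[of 0 0] p(1) M 0 by (simp add: left_lim_def)
  next
    case (Suc k)
    have k: "k < M" "p k < p (Suc k)" using p(3) i Suc by auto
    have "0 < p i" using p_range[OF p, of k] k Suc by auto
    have "eventually (\<lambda>r. \<omega> (p (Suc k)) = pc_approx T M p \<omega> r) (at_left (p (Suc k)))"
      using eventually_at_left_real[OF k(2)] by eventually_elim (use pc[OF k(1)] in auto)
    then have "(pc_approx T M p \<omega> \<longlongrightarrow> \<omega> (p (Suc k))) (at_left (p (Suc k)))"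
      by (rule Lim_transform_eventually[OF tendsto_const])
    then show ?thesis
      using \<open>0 < p i\<close> Suc by (simp add: left_lim_def tendsto_Lim)
  qed
  define i' where "i' = (if i = 0 then 1 else i)"
  have i': "i \<le> i'" "i' \<le> M" "i' > 0" using i by (auto simp: i'_def)
  have ext: "step_path p i' \<in> extensional {0..T}"
    using step_path_tracks[OF p, of i'] i' tracks_cadlag by (auto simp: cadlag_def)
  have "stop_left T (p i) (pc_approx T M p \<omega>) r = step_path p i' r" if r: "r \<in> {0..T}" for r
  proof (cases "r < p i")
    case True
    then obtain j where j: "j < i" "r \<in> {p j..<p (Suc j)}"
      using partition_locate[of p r i] p(1) r i by auto
    then have "step_path p i' r = \<omega> (p (Suc j))"
      using i' by (intro step_path_within[OF p]) auto
    then show ?thesis using True pc[of j r] j i r by (simp add: stop_left_def)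
  next
    case False
    have "step_path p i' r = \<omega> (p i')"
    proof (cases "r < p i'")
      case True
      then have "i = 0" "i' = 1" using False by (auto simp: i'_def split: if_splits)
      then show ?thesis using step_path_within[OF p, of 0 i' r] True False i' by auto
    qed (use step_path_after[OF p, of i' r] i' r in auto)
    then show ?thesis using False left r by (simp add: stop_left_def i'_def)
  qed
  then have "stop_left T (p i) (pc_approx T M p \<omega>) = step_path p i'"
    using ext by (intro extensionalityI[of _ "{0..T}"]) (auto simp: stop_left_def)
  then show ?thesis by (simp add: i'_def)
qed

lemma pathwise_integrand_correction:
  assumes p: "p 0 = 0" "p M = T" "\<forall>i<M. p i < p (Suc i)"
  shows "\<bar>(\<Sum>i<M. g (p i) (stop_left T (p i) (pc_approx T M p \<omega>)) \<bullet> (\<omega> (p (Suc i)) - \<omega> (p i)))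
    - (\<Sum>i<M. g (p i) (step_path p i) \<bullet> (\<omega> (p (Suc i)) - \<omega> (p i)))\<bar>
    \<le> L * (norm (\<omega> (p 1) - \<omega> (p 0)))\<^sup>2"
proof -
  have M: "0 < M" using p T_pos by (cases M) auto
  define a where "a = \<omega> (p 1) - \<omega> (p 0)"
  define G where "G z i = g (p i) z \<bullet> (\<omega> (p (Suc i)) - \<omega> (p i))" for z i
  have r: "p 0 \<in> {0..T}" "p 1 \<in> {0..T}" using p_range[OF p, of 0] p_range[OF p, of 1] M by auto
  have "(\<Sum>i<M. G (stop_left T (p i) (pc_approx T M p \<omega>)) i - G (step_path p i) i)
      = (\<Sum>i<M. if i = 0 then G (step_path p 1) 0 - G (step_path p 0) 0 else 0)"
    using stop_left_pc_approx[OF p] by (intro sum.cong) auto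
  also have "\<dots> = G (step_path p 1) 0 - G (step_path p 0) 0"
    using M by simp
  also have "\<dots> = (g (p 0) (step_path p 1) - g (p 0) (step_path p 0)) \<bullet> a"
    unfolding G_def a_def One_nat_def inner_diff_left ..
  finally have eq: "(\<Sum>i<M. G (stop_left T (p i) (pc_approx T M p \<omega>)) i) - (\<Sum>i<M. G (step_path p i) i)
      = (g (p 0) (step_path p 1) - g (p 0) (step_path p 0)) \<bullet> a"
    by (simp add: sum_subtractf)
  have "norm (g (p 0) (step_path p 1) - g (p 0) (step_path p 0)) \<le> L * norm a"
  proof (intro lip_g)
    show "norm (step_path p 1 s - step_path p 0 s) \<le> norm a" if "s \<in> {0..p 0}" for s
      using that p r by (simp add: bump_apply a_def)
    show "p 0 \<in> {0..T}" by (rule r)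
    show "step_path p 1 \<in> cadlag T" "step_path p 0 \<in> cadlag T"
      using M by (auto intro: tracks_cadlag[OF step_path_tracks[OF p]] simp del: step_path.simps)
  qed
  then have "\<bar>(g (p 0) (step_path p 1) - g (p 0) (step_path p 0)) \<bullet> a\<bar> \<le> (L * norm a) * norm a"
    by (intro order.trans[OF Cauchy_Schwarz_ineq2] mult_right_mono) auto
  then show ?thesis
    using eq unfolding G_def a_def by (simp add: power2_eq_square)
qed

end

section \<open>Right derivatives and vertical gradients\<close>

text \<open>Horizontal derivatives are one-sided, so the usual mean value theorem does not apply.
  At the last point \<open>c\<close> where \<open>f x - B x\<close> does not exceed its initial
  value, a right derivative below \<open>B\<close> would allow to go on a little further.\<close>

lemma right_derivative_upper_bound:
  fixes f f' :: "real \<Rightarrow> real"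
  assumes "u \<le> v" and cont: "continuous_on {u..v} f"
    and deriv: "\<And>x. x \<in> {u..<v} \<Longrightarrow> ((\<lambda>h. (f (x + h) - f x) / h) \<longlongrightarrow> f' x) (at_right 0)"
    and bound: "\<And>x. x \<in> {u..<v} \<Longrightarrow> f' x < B"
  shows "f v - f u \<le> B * (v - u)"
proof (rule ccontr)
  assume neg: "\<not> f v - f u \<le> B * (v - u)"
  define g where "g x = f x - B * x" for x
  define S where "S = {x \<in> {u..v}. g x \<le> g u}"
  have g: "continuous_on {u..v} g"
    unfolding g_def by (intro continuous_intros cont)
  have "S = {u..v} \<inter> g -` {..g u}" by (auto simp: S_def)
  moreover have "closed ({u..v} \<inter> g -` {..g u})"
    using g by (rule continuous_closed_preimage) auto
  moreover have "bounded S"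
    by (rule bounded_subset[of "{u..v}"]) (auto simp: S_def)
  ultimately have "compact S" by (simp add: compact_eq_bounded_closed)
  moreover have "u \<in> S" using assms(1) by (simp add: S_def)
  ultimately obtain c where c: "c \<in> S" "\<And>x. x \<in> S \<Longrightarrow> x \<le> c"
    using compact_attains_sup[of S] by auto
  have "v \<notin> S" using neg by (simp add: S_def g_def algebra_simps)
  then have cv: "c \<in> {u..<v}" using c(1) by (cases "c = v") (auto simp: S_def)
  have "eventually (\<lambda>h. (f (c + h) - f c) / h < B) (at_right 0)"
    using deriv[OF cv] bound[OF cv] by (rule order_tendstoD(2))
  moreover have "eventually (\<lambda>h. h \<in> {0<..<v - c}) (at_right 0)"
    using cv by (intro eventually_at_right_real) auto
  ultimately have "eventually (\<lambda>h. c + h \<in> S \<and> 0 < h) (at_right 0)"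
  proof eventually_elim
    case (elim h)
    then have "f (c + h) - f c < B * h" by (simp add: pos_divide_less_eq)
    then have "g (c + h) \<le> g c" by (simp add: g_def algebra_simps)
    then show ?case using elim c(1) cv by (auto simp: S_def)
  qed
  then obtain h where "c + h \<in> S" "0 < h"
    using eventually_happens'[of "at_right (0::real)"] by (auto simp: trivial_limit_at_right_real)
  then show False using c(2) by fastforce
qed

lemma right_derivative_lipschitz:
  fixes f f' :: "real \<Rightarrow> real"
  assumes "u \<le> v" and cont: "continuous_on {u..v} f"
    and deriv: "\<And>x. x \<in> {u..<v} \<Longrightarrow> ((\<lambda>h. (f (x + h) - f x) / h) \<longlongrightarrow> f' x) (at_right 0)"
    and bound: "\<And>x. x \<in> {u..<v} \<Longrightarrow> \<bar>f' x\<bar> < B"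
  shows "\<bar>f v - f u\<bar> \<le> B * (v - u)"
proof -
  have "f v - f u \<le> B * (v - u)"
    by (rule right_derivative_upper_bound[OF assms(1) cont deriv]) (use bound in \<open>auto simp: abs_less_iff\<close>)
  moreover have "- f v - (- f u) \<le> B * (v - u)"
  proof (rule right_derivative_upper_bound[of u v "\<lambda>x. - f x" "\<lambda>x. - f' x"])
    show "((\<lambda>h. (- f (x + h) - - f x) / h) \<longlongrightarrow> - f' x) (at_right 0)" if "x \<in> {u..<v}" for x
      using tendsto_minus[OF deriv[OF that]] by (simp add: minus_divide_left)
    show "- f' x < B" if "x \<in> {u..<v}" for x
      using bound[OF that] by linarith
  qed (use assms(1) cont in \<open>auto intro: continuous_intros\<close>)
  ultimately show ?thesis by linarith
qed

text \<open>The fundamental theorem for bounded right derivatives. With \<open>P\<close> a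
  primitive of a continuation of \<open>f\<close> beyond \<open>[a,b]\<close>, the integral of the
  difference quotient of \<open>f\<close> with step \<open>h\<close> is a difference of difference
  quotients of \<open>P\<close> at \<open>b\<close> and \<open>a\<close>, which tends to \<open>f
  b - f a\<close>; on the other side the quotients converge boundedly to \<open>f'\<close>.\<close>

lemma has_integral_right_derivative:
  fixes f f' :: "real \<Rightarrow> real"
  assumes "a \<le> b" and cont: "continuous_on {a..b} f"
    and deriv: "\<And>x. x \<in> {a..<b} \<Longrightarrow> ((\<lambda>h. (f (x + h) - f x) / h) \<longlongrightarrow> f' x) (at_right 0)"
    and bound: "\<And>x. x \<in> {a..<b} \<Longrightarrow> \<bar>f' x\<bar> < B"
  shows "(f' has_integral (f b - f a)) {a..b}"
proof (cases "a = b")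
  case True
  then show ?thesis by (simp add: has_integral_refl(2)[of f' b, unfolded cbox_interval, simplified])
next
  case False
  then have ab: "a < b" using assms(1) by simp
  \<comment> \<open>a continuation beyond \<open>[a,b]\<close>, so that difference quotients make sense on all of \<open>[a,b]\<close>\<close>
  define G where "G x = f (max a (min b x))" for x
  have G: "G x = f x" if "x \<in> {a..b}" for x using that by (simp add: G_def)
  have lip: "\<bar>G y - G x\<bar> \<le> B * (y - x)" if "x \<le> y" for x y
  proof -
    let ?x = "max a (min b x)" and ?y = "max a (min b y)"
    have xy: "?x \<le> ?y" "?x \<in> {a..b}" "?y \<in> {a..b}" "?y - ?x \<le> y - x"
      using that ab by (auto simp: max_def min_def)
    have "\<bar>f ?y - f ?x\<bar> \<le> B * (?y - ?x)"
      using xy by (intro right_derivative_lipschitz[where f' = f'] continuous_on_subset[OF cont] deriv bound) auto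
    also have "\<dots> \<le> B * (y - x)"
      using xy bound[of a] ab by (intro mult_left_mono) auto
    finally show ?thesis by (simp add: G_def)
  qed
  have contG: "continuous_on S G" for S
    unfolding G_def by (rule continuous_on_compose2[OF cont]) (use ab in \<open>auto intro!: continuous_intros\<close>)
  obtain P where P: "\<And>x. x \<in> {a - 1..b + 2} \<Longrightarrow> (P has_vector_derivative G x) (at x within {a - 1..b + 2})"
    using antiderivative_continuous[OF contG] by blast
  have P': "(P has_real_derivative G x) (at x)" if "x \<in> {a - 1<..<b + 2}" for x
    using P[of x] that by (simp add: at_within_Icc_at has_real_derivative_iff_has_vector_derivative)
  define h where "h n = 1 / real (Suc n)" for n
  have h: "0 < h n" "h n \<le> 1" for n by (auto simp: h_def)
  have hlim: "filterlim h (at_right 0) sequentially" "filterlim h (at 0) sequentially"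
  proof -
    have "h = (\<lambda>n. inverse (real (Suc n)))" by (simp add: h_def inverse_eq_divide fun_eq_iff)
    then have "h \<longlonglongrightarrow> 0" using LIMSEQ_inverse_real_of_nat by simp
    moreover have "h n \<noteq> 0" for n using h(1)[of n] by simp
    ultimately show "filterlim h (at_right 0) sequentially" "filterlim h (at 0) sequentially"
      using h by (auto simp: filterlim_at)
  qed
  define q where "q n x = (G (x + h n) - G x) / h n" for n x
  have int: "(q n has_integral ((P (b + h n) - P b) / h n - (P (a + h n) - P a) / h n)) {a..b}" for n
  proof -
    have "(q n has_integral ((P (b + h n) - P b) / h n - (P (a + h n) - P a) / h n)) {a..b}"
      unfolding diff_divide_distrib[symmetric] q_def
    proof (rule has_integral_divide)
      have "((\<lambda>x. G (x + h n) - G x) has_integral (P (b + h n) - P b) - (P (a + h n) - P a)) {a..b}"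
      proof (rule fundamental_theorem_of_calculus)
        fix x assume x: "x \<in> {a..b}"
        have "((\<lambda>x. P (x + h n) - P x) has_real_derivative G (x + h n) * 1 - G x) (at x)"
          using x h[of n] ab
          by (intro DERIV_diff DERIV_chain2[OF P'] P') (auto intro!: derivative_eq_intros)
        then show "((\<lambda>x. P (x + h n) - P x) has_vector_derivative G (x + h n) - G x) (at x within {a..b})"
          by (simp add: has_real_derivative_iff_has_vector_derivative has_vector_derivative_at_within)
      qed (use ab in auto)
      then show "((\<lambda>x. G (x + h n) - G x) has_integral (P (b + h n) - P b - (P (a + h n) - P a))) {a..b}"
        by simp
    qed
    then show ?thesis .
  qed
  have lim_end: "(\<lambda>n. (P (x + h n) - P x) / h n) \<longlonglongrightarrow> f x" if "x \<in> {a..b}" for x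
    using filterlim_compose[OF P'[of x, unfolded DERIV_def] hlim(2)] that G[OF that] by simp
  \<comment> \<open>at \<open>b\<close> the difference quotients of the continuation vanish\<close>
  define f1 where "f1 x = (if x = b then 0 else f' x)" for x
  have q_le: "norm (q n x) \<le> B" for n x
    using lip[of x "x + h n"] h[of n] by (simp add: q_def abs_divide pos_divide_le_eq)
  have q_lim: "(\<lambda>n. q n x) \<longlonglongrightarrow> f1 x" if x: "x \<in> {a..b}" for x
  proof (cases "x = b")
    case True
    then have "q n x = 0" for n using h[of n] ab by (simp add: q_def G_def)
    then show ?thesis using True by (simp add: f1_def)
  next
    case False
    then have x': "x \<in> {a..<b}" using x by auto
    have "(\<lambda>n. (f (x + h n) - f x) / h n) \<longlonglongrightarrow> f' x"
      using filterlim_compose[OF deriv[OF x'] hlim(1)] .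
    moreover have "eventually (\<lambda>h. h \<in> {0<..<b - x}) (at_right 0)"
      using x' by (intro eventually_at_right_real) auto
    then have "eventually (\<lambda>n. h n \<in> {0<..<b - x}) sequentially"
      using hlim(1) by (rule eventually_compose_filterlim)
    then have "eventually (\<lambda>n. (f (x + h n) - f x) / h n = q n x) sequentially"
      by eventually_elim (use x' in \<open>auto simp: q_def G\<close>)
    ultimately show ?thesis
      using False by (auto simp: f1_def intro: Lim_transform_eventually)
  qed
  have intq: "q n integrable_on {a..b}" for n
    using int by (rule has_integral_integrable)
  note dom = dominated_convergence[of q "{a..b}" "\<lambda>_. B" f1, OF intq integrable_const_ivl q_le q_lim]
  have "integral {a..b} (q n) = (P (b + h n) - P b) / h n - (P (a + h n) - P a) / h n" for n
    using int by (rule integral_unique)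
  then have "(\<lambda>n. integral {a..b} (q n)) \<longlonglongrightarrow> f b - f a"
    using tendsto_diff[OF lim_end[of b] lim_end[of a]] ab by simp
  then have "(f1 has_integral (f b - f a)) {a..b}"
    using dom LIMSEQ_unique by (metis has_integral_integrable_integral)
  then show ?thesis
    by (rule has_integral_spike_finite[of "{b}", rotated 2]) (auto simp: f1_def)
qed

lemma differentiable_imp_GDERIV:
  fixes f :: "'a::euclidean_space \<Rightarrow> real"
  assumes "f differentiable (at x)"
  obtains D where "GDERIV f x :> D"
proof -
  obtain f' where f': "(f has_derivative f') (at x)"
    using assms by (auto simp: differentiable_def)
  then have "linear f'" by (rule has_derivative_linear)
  then have "f' = (\<lambda>h. h \<bullet> adjoint f' 1)"
    using adjoint_works[of f' _ 1] by (auto simp: fun_eq_iff)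
  then show ?thesis using f' that by (metis gderiv_def)
qed

lemma GDERIV_unique:
  fixes f :: "'a::euclidean_space \<Rightarrow> real"
  assumes "GDERIV f x :> D" "GDERIV f x :> D'"
  shows "D = D'"
  using has_derivative_unique[OF assms[unfolded gderiv_def]]
  by (metis inner_commute vector_eq_rdot)

lemma bump_bump:
  assumes "t \<in> {0..T}"
  shows "bump T t (bump T t x e) e' = bump T t x (e + e')"
  using assms by (auto simp: bump_def stop_def fun_eq_iff restrict_def indicator_def)

lemma non_anticipative_bump_zero: "t \<in> {0..T} \<Longrightarrow> \<phi> \<in> non_anticipative T \<Longrightarrow> x \<in> cadlag T \<Longrightarrow> \<phi> t (bump T t x 0) = \<phi> t x"
  by (simp add: bump_zero non_anticipative_def)

lemma vert_grad_derivative: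
  assumes "vert_differentiable T \<phi>" "t \<in> {0..T}" "x \<in> cadlag T"
  shows "GDERIV (\<lambda>e. \<phi> t (bump T t x e)) e :> vert_grad T \<phi> t (bump T t x e)"
proof -
  let ?x = "bump T t x e"
  have "(\<lambda>e'. \<phi> t (bump T t ?x e')) differentiable (at 0)"
    using assms bump_cadlag[of x T t e] by (auto simp: vert_differentiable_def)
  then obtain D where D: "GDERIV (\<lambda>e'. \<phi> t (bump T t ?x e')) 0 :> D"
    by (rule differentiable_imp_GDERIV)
  then have "vert_grad T \<phi> t ?x = D"
    unfolding vert_grad_def by (intro the_equality) (auto intro: GDERIV_unique)
  then have "((\<lambda>e'. \<phi> t (bump T t x (e + e'))) has_derivative (\<lambda>h. h \<bullet> vert_grad T \<phi> t ?x)) (at 0)"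
    using D assms(2) by (simp add: gderiv_def bump_bump)
  then have "((\<lambda>e'. \<phi> t (bump T t x (e + e'))) has_derivative (\<lambda>h. h \<bullet> vert_grad T \<phi> t ?x)) (at (e - e))"
    by simp
  then have "((\<lambda>e'. \<phi> t (bump T t x (e + (e' - e)))) has_derivative (\<lambda>h. h \<bullet> vert_grad T \<phi> t ?x)) (at e)"
    by (rule has_derivative_compose[rotated]) (auto intro!: derivative_eq_intros)
  then show ?thesis by (simp add: gderiv_def)
qed

lemma vert_line_derivative:
  assumes "vert_differentiable T \<phi>" "t \<in> {0..T}" "x \<in> cadlag T"
  shows "((\<lambda>r. \<phi> t (bump T t x (c + r *\<^sub>R a))) has_real_derivative
     vert_grad T \<phi> t (bump T t x (c + r *\<^sub>R a)) \<bullet> a) (at r)"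
proof -
  have "((\<lambda>r. \<phi> t (bump T t x (c + r *\<^sub>R a))) has_derivative
     (\<lambda>h. (h *\<^sub>R a) \<bullet> vert_grad T \<phi> t (bump T t x (c + r *\<^sub>R a)))) (at r)"
    by (rule has_derivative_compose[OF _ vert_grad_derivative[OF assms, unfolded gderiv_def]])
      (auto intro!: derivative_eq_intros)
  then show ?thesis
    unfolding has_field_derivative_def by (simp add: inner_commute mult_commute_abs)
qed

lemma second_order_expansion:
  fixes f f' f'' :: "real \<Rightarrow> real"
  assumes "\<And>r. (f has_real_derivative f' r) (at r)" "\<And>r. (f' has_real_derivative f'' r) (at r)"
  obtains r where "\<bar>r\<bar> \<le> 1" "f 1 = f 0 + f' 0 + f'' r / 2"
proof -
  let ?d = "\<lambda>m::nat. if m = 0 then f else if m = 1 then f' else f''"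
  have "\<exists>r. \<bar>r\<bar> \<le> \<bar>1\<bar> \<and> f 1 = (\<Sum>m<2. ?d m 0 / fact m * 1 ^ m) + ?d 2 r / fact 2 * 1 ^ 2"
    using assms by (intro Maclaurin_bi_le) (auto simp: less_2_cases_iff)
  then show ?thesis using that by (auto simp: numeral_2_eq_2)
qed

lemma third_order_expansion:
  fixes f f' f'' f''' :: "real \<Rightarrow> real"
  assumes "\<And>r. (f has_real_derivative f' r) (at r)" "\<And>r. (f' has_real_derivative f'' r) (at r)"
    "\<And>r. (f'' has_real_derivative f''' r) (at r)"
  obtains r where "f h = f 0 + f' 0 * h + f'' 0 / 2 * h\<^sup>2 + f''' r / 6 * h ^ 3"
proof -
  let ?d = "\<lambda>m::nat. if m = 0 then f else if m = 1 then f' else if m = 2 then f'' else f'''"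
  have "\<exists>r. \<bar>r\<bar> \<le> \<bar>h\<bar> \<and> f h = (\<Sum>m<3. ?d m 0 / fact m * h ^ m) + ?d 3 r / fact 3 * h ^ 3"
    using assms by (intro Maclaurin_bi_le) (auto simp: eval_nat_numeral less_Suc_eq)
  then show ?thesis using that by (auto simp: eval_nat_numeral)
qed

section \<open>Functionals that are Lipschitz in the past\<close>

text \<open>Lipschitz continuity in the uniform distance, stated with an arbitrary pointwise bound
  \<open>e\<close> in place of the supremum. So no boundedness of the paths has to be checked when
  it is used.\<close>

definition lipschitz_past :: "real \<Rightarrow> real \<Rightarrow> (real \<Rightarrow> (real \<Rightarrow> 'a::real_normed_vector) \<Rightarrow> 'b::real_normed_vector) \<Rightarrow> bool" where
  "lipschitz_past T K \<phi> \<longleftrightarrow> (\<forall>t\<in>{0..T}. \<forall>x\<in>cadlag T. \<forall>y\<in>cadlag T. \<forall>e.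
     (\<forall>r\<in>{0..t}. norm (x r - y r) \<le> e) \<longrightarrow> norm (\<phi> t x - \<phi> t y) \<le> K * e)"

lemma lipschitz_pastD:
  "\<lbrakk>lipschitz_past T K \<phi>; t \<in> {0..T}; x \<in> cadlag T; y \<in> cadlag T; \<And>r. r \<in> {0..t} \<Longrightarrow> norm (x r - y r) \<le> e\<rbrakk>
    \<Longrightarrow> norm (\<phi> t x - \<phi> t y) \<le> K * e"
  by (simp add: lipschitz_past_def)

lemma lipschitz_pastI:
  assumes "\<And>t x y e. \<lbrakk>t \<in> {0..T}; x \<in> cadlag T; y \<in> cadlag T; \<forall>r\<in>{0..t}. norm (x r - y r) \<le> e\<rbrakk>
    \<Longrightarrow> norm (\<phi> t x - \<phi> t y) \<le> K * e"
  shows "lipschitz_past T K \<phi>"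
  using assms by (simp add: lipschitz_past_def)

lemma past_bound_nonneg:
  fixes x y :: "real \<Rightarrow> 'a::real_normed_vector"
  assumes "t \<in> {0..T}" "\<And>r. r \<in> {0..t} \<Longrightarrow> norm (x r - y r) \<le> e"
  shows "0 \<le> e"
  using order.trans[OF norm_ge_zero assms(2)[of 0]] assms(1) by simp

lemma lip_functional_past:
  fixes \<phi> :: "('d::finite, real) functional"
  assumes "\<phi> \<in> lip_functionals T" "0 \<le> T"
  obtains K where "0 \<le> K" "lipschitz_past T K \<phi>"
proof -
  obtain K where K: "K > 0" "\<And>t x x'. \<lbrakk>t\<in>{0..T}; x\<in>cadlag T; x'\<in>cadlag T\<rbrakk> \<Longrightarrow>
       \<bar>\<phi> t x - \<phi> t x'\<bar> \<le> K * sup_norm T (\<lambda>s. stop T t x s - stop T t x' s)"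
    using assms unfolding lip_functionals_def by blast
  have "lipschitz_past T K \<phi>"
  proof (rule lipschitz_pastI)
    fix t e and x y :: "real \<Rightarrow> real ^ 'd" assume t: "t \<in> {0..T}" and xy: "x \<in> cadlag T" "y \<in> cadlag T"
      and e: "\<forall>r\<in>{0..t}. norm (x r - y r) \<le> e"
    have "sup_norm T (\<lambda>s. stop T t x s - stop T t y s) \<le> e"
      unfolding sup_norm_def
    proof (rule cSUP_least)
      show "norm (stop T t x s - stop T t y s) \<le> e" if "s \<in> {0..T}" for s
        using e that t by (simp add: stop_def)
    qed (use assms(2) in auto)
    then have "K * sup_norm T (\<lambda>s. stop T t x s - stop T t y s) \<le> K * e"
      using K(1) by (intro mult_left_mono) auto
    then show "norm (\<phi> t x - \<phi> t y) \<le> K * e"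
      using K(2)[OF t xy] by simp
  qed
  then show ?thesis using that[of K] K(1) by simp
qed

lemma lipschitz_past_mono:
  fixes \<phi> :: "real \<Rightarrow> (real \<Rightarrow> 'a::real_normed_vector) \<Rightarrow> 'b::real_normed_vector"
  assumes "lipschitz_past T K \<phi>" "K \<le> K'"
  shows "lipschitz_past T K' \<phi>"
proof (rule lipschitz_pastI)
  fix t e and x y :: "real \<Rightarrow> 'a" assume *: "t \<in> {0..T}" "x \<in> cadlag T" "y \<in> cadlag T" "\<forall>r\<in>{0..t}. norm (x r - y r) \<le> e"
  have "norm (\<phi> t x - \<phi> t y) \<le> K * e"
    using * by (intro lipschitz_pastD[OF assms(1)]) auto
  also have "\<dots> \<le> K' * e"
    using past_bound_nonneg[of t T x y e] * assms(2) by (intro mult_right_mono) auto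
  finally show "norm (\<phi> t x - \<phi> t y) \<le> K' * e" .
qed

lemma lipschitz_past_bump:
  assumes "lipschitz_past T K \<phi>" "t \<in> {0..T}" "x \<in> cadlag T" "y \<in> cadlag T"
    "\<And>r. r \<in> {0..t} \<Longrightarrow> norm (x r - y r) \<le> e"
  shows "norm (\<phi> t (bump T t x a) - \<phi> t (bump T t y a)) \<le> K * e"
  using assms(2-5) by (intro lipschitz_pastD[OF assms(1)] bump_cadlag) (auto simp: bump_apply)

lemma lipschitz_past_vertical:
  assumes "lipschitz_past T K \<phi>" "t \<in> {0..T}" "x \<in> cadlag T"
  shows "norm (\<phi> t (bump T t x a) - \<phi> t (bump T t x b)) \<le> K * norm (a - b)"
  using assms(2,3) by (intro lipschitz_pastD[OF assms(1)] bump_cadlag) (auto simp: bump_apply)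

lemma vert_axis_derivative:
  assumes "vert_differentiable T \<phi>" "t \<in> {0..T}" "x \<in> cadlag T"
  shows "((\<lambda>r. \<phi> t (bump T t x (c + r *\<^sub>R axis j 1))) has_real_derivative
     vert_comp T \<phi> [j] t (bump T t x (c + r *\<^sub>R axis j 1))) (at r)"
  using vert_line_derivative[OF assms, of c "axis j 1" r] by (simp add: inner_axis)

text \<open>For two paths let \<open>f r\<close> be the difference of the values of
  \<open>\<phi>\<close> after both have been bumped by \<open>r\<close> in direction
  \<open>j\<close>. Then \<open>f 1 - f (-1) = 2 f' 0\<close> up to third derivatives, in which
  the second derivative cancels. Both \<open>f\<close> and its third derivative are controlled by
  the distance of the paths, hence so is \<open>f' 0\<close>.\<close>

lemma lipschitz_past_from_third_derivative:
  fixes \<phi> :: "('d::finite, real) functional"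
  assumes "lipschitz_past T K \<phi>" "lipschitz_past T K (vert_comp T \<phi> [j, j, j])"
    and d: "vert_differentiable T \<phi>" "vert_differentiable T (vert_comp T \<phi> [j])"
      "vert_differentiable T (vert_comp T \<phi> [j, j])"
    and na: "vert_comp T \<phi> [j] \<in> non_anticipative T"
  shows "lipschitz_past T (2 * K) (vert_comp T \<phi> [j])"
proof (rule lipschitz_pastI)
  fix t e and x y :: "real \<Rightarrow> real ^ 'd" assume t: "t \<in> {0..T}" and xy: "x \<in> cadlag T" "y \<in> cadlag T"
    and e: "\<forall>r\<in>{0..t}. norm (x r - y r) \<le> e"
  define f where "f js r = vert_comp T \<phi> js t (bump T t x (r *\<^sub>R axis j 1))
    - vert_comp T \<phi> js t (bump T t y (r *\<^sub>R axis j 1))" for js r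
  have deriv: "(f js has_real_derivative f (j # js) r) (at r)"
    if "vert_differentiable T (vert_comp T \<phi> js)" for js r
    using vert_axis_derivative[OF that t xy(1), of 0 j r] vert_axis_derivative[OF that t xy(2), of 0 j r]
    unfolding f_def by (intro DERIV_diff) simp_all
  have le: "\<bar>f js r\<bar> \<le> K * e" if "lipschitz_past T K (vert_comp T \<phi> js)" for js r
    using lipschitz_past_bump[OF that t xy, of e "r *\<^sub>R axis j 1"] e by (simp add: f_def)
  have ff: "(f [] has_real_derivative f [j] r) (at r)" "(f [j] has_real_derivative f [j, j] r) (at r)"
    "(f [j, j] has_real_derivative f [j, j, j] r) (at r)" for r
    using deriv d by auto
  obtain r1 where "f [] 1 = f [] 0 + f [j] 0 * 1 + f [j, j] 0 / 2 * 1\<^sup>2 + f [j, j, j] r1 / 6 * 1 ^ 3"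
    by (rule third_order_expansion[of "f []" "f [j]" "f [j, j]" "f [j, j, j]", OF ff])
  moreover obtain r2 where "f [] (- 1) = f [] 0 + f [j] 0 * (- 1) + f [j, j] 0 / 2 * (- 1)\<^sup>2 + f [j, j, j] r2 / 6 * (- 1) ^ 3"
    by (rule third_order_expansion[of "f []" "f [j]" "f [j, j]" "f [j, j, j]", OF ff])
  ultimately have "2 * f [j] 0 = f [] 1 - f [] (- 1) - f [j, j, j] r1 / 6 - f [j, j, j] r2 / 6"
    by (simp add: power3_eq_cube)
  moreover have "\<bar>f [] 1\<bar> \<le> K * e" "\<bar>f [] (- 1)\<bar> \<le> K * e" "\<bar>f [j, j, j] r1\<bar> \<le> K * e" "\<bar>f [j, j, j] r2\<bar> \<le> K * e"
    using le assms(1,2) by auto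
  ultimately have "\<bar>f [j] 0\<bar> \<le> 2 * (K * e)" by linarith
  then show "norm (vert_comp T \<phi> [j] t x - vert_comp T \<phi> [j] t y) \<le> 2 * K * e"
    using non_anticipative_bump_zero[OF t na] xy by (simp add: f_def)
qed

text \<open>The same with \<open>f 1 - f 0 = f' 0\<close> up to second derivatives. It is applied
  to the first derivatives of a functional.\<close>

lemma lipschitz_past_from_second_derivative:
  fixes \<phi> :: "('d::finite, real) functional"
  assumes "lipschitz_past T K \<phi>" "lipschitz_past T K (vert_comp T \<phi> [j, j])"
    and d: "vert_differentiable T \<phi>" "vert_differentiable T (vert_comp T \<phi> [j])"
    and na: "vert_comp T \<phi> [j] \<in> non_anticipative T" "\<phi> \<in> non_anticipative T"
  shows "lipschitz_past T (3 * K) (vert_comp T \<phi> [j])"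
proof (rule lipschitz_pastI)
  fix t e and x y :: "real \<Rightarrow> real ^ 'd" assume t: "t \<in> {0..T}" and xy: "x \<in> cadlag T" "y \<in> cadlag T"
    and e: "\<forall>r\<in>{0..t}. norm (x r - y r) \<le> e"
  define f where "f js r = vert_comp T \<phi> js t (bump T t x (r *\<^sub>R axis j 1))
    - vert_comp T \<phi> js t (bump T t y (r *\<^sub>R axis j 1))" for js r
  have deriv: "(f js has_real_derivative f (j # js) r) (at r)"
    if "vert_differentiable T (vert_comp T \<phi> js)" for js r
    using vert_axis_derivative[OF that t xy(1), of 0 j r] vert_axis_derivative[OF that t xy(2), of 0 j r]
    unfolding f_def by (intro DERIV_diff) simp_all
  have le: "\<bar>f js r\<bar> \<le> K * e" if "lipschitz_past T K (vert_comp T \<phi> js)" for js r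
    using lipschitz_past_bump[OF that t xy, of e "r *\<^sub>R axis j 1"] e by (simp add: f_def)
  have ff: "(f [] has_real_derivative f [j] r) (at r)" "(f [j] has_real_derivative f [j, j] r) (at r)" for r
    using deriv d by auto
  obtain r where "f [] 1 = f [] 0 + f [j] 0 + f [j, j] r / 2"
    using second_order_expansion[of "f []" "f [j]" "f [j, j]", OF ff] by blast
  moreover have "\<bar>f [] 1\<bar> \<le> K * e" "\<bar>f [] 0\<bar> \<le> K * e" "\<bar>f [j, j] r\<bar> \<le> K * e"
    using le assms(1,2) by auto
  ultimately have "\<bar>f [j] 0\<bar> \<le> 3 * (K * e)" by linarith
  then show "norm (vert_comp T \<phi> [j] t x - vert_comp T \<phi> [j] t y) \<le> 3 * K * e"
    using non_anticipative_bump_zero[OF t na(1)] xy by (simp add: f_def)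
qed

lemma norm_le_components:
  fixes v :: "real ^ 'd::finite"
  assumes "\<And>i. \<bar>v $ i\<bar> \<le> b"
  shows "norm v \<le> real CARD('d) * b"
proof -
  have "norm v \<le> (\<Sum>i\<in>UNIV. \<bar>v $ i\<bar>)" by (rule norm_le_l1_cart)
  also have "\<dots> \<le> (\<Sum>i\<in>(UNIV :: 'd set). b)" by (intro sum_mono assms)
  finally show ?thesis by simp
qed

lemma lipschitz_past_vert_grad:
  fixes \<phi> :: "('d::finite, real) functional"
  assumes "\<And>j. lipschitz_past T K (vert_comp T \<phi> [j])"
  shows "lipschitz_past T (real CARD('d) * K) (vert_grad T \<phi>)"
proof (rule lipschitz_pastI)
  fix t e and x y :: "real \<Rightarrow> real ^ 'd" assume *: "t \<in> {0..T}" "x \<in> cadlag T" "y \<in> cadlag T" "\<forall>r\<in>{0..t}. norm (x r - y r) \<le> e"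
  have "\<bar>(vert_grad T \<phi> t x - vert_grad T \<phi> t y) $ j\<bar> \<le> K * e" for j
    using lipschitz_pastD[OF assms, of t x y e j] * by simp
  then show "norm (vert_grad T \<phi> t x - vert_grad T \<phi> t y) \<le> real CARD('d) * K * e"
    unfolding mult.assoc by (rule norm_le_components)
qed

section \<open>Vertical Taylor expansions and the symmetry of the Hessian\<close>

definition hessian :: "real \<Rightarrow> ('d::finite, real) functional \<Rightarrow> real \<Rightarrow> (real \<Rightarrow> real ^ 'd) \<Rightarrow> real ^ 'd \<Rightarrow> real ^ 'd" where
  "hessian T F t x a = (\<chi> i. vert_grad T (vert_comp T F [i]) t x \<bullet> a)"

lemma hessian_linear: "linear (hessian T F t x)"
  by (rule linearI) (auto simp: hessian_def vec_eq_iff inner_add_right)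

lemma hessian_inner:
  "hessian T F t x a \<bullet> b = (\<Sum>i\<in>UNIV. \<Sum>j\<in>UNIV. vert_comp T F [j, i] t x * (a $ j * b $ i))"
  by (simp add: hessian_def inner_vec_def sum_distrib_right mult.assoc)

lemma hessian_diff_bound:
  fixes F :: "('d::finite, real) functional"
  assumes "\<And>i. norm (vert_grad T (vert_comp T F [i]) t x - vert_grad T (vert_comp T F [i]) s y) \<le> b"
  shows "norm (hessian T F t x a - hessian T F s y a) \<le> real CARD('d) * b * norm a"
proof -
  have "\<bar>(hessian T F t x a - hessian T F s y a) $ i\<bar> \<le> b * norm a" for i
  proof -
    have "(hessian T F t x a - hessian T F s y a) $ i
        = (vert_grad T (vert_comp T F [i]) t x - vert_grad T (vert_comp T F [i]) s y) \<bullet> a"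
      by (simp add: hessian_def inner_diff_left)
    then show ?thesis
      using order.trans[OF Cauchy_Schwarz_ineq2 mult_right_mono[OF assms norm_ge_zero]] by simp
  qed
  then show ?thesis unfolding mult.assoc by (rule norm_le_components)
qed

lemma vertical_taylor_first:
  assumes "vert_differentiable T \<phi>" "lipschitz_past T K (vert_grad T \<phi>)" "0 \<le> K" "\<phi> \<in> non_anticipative T"
    "t \<in> {0..T}" "x \<in> cadlag T" "vert_grad T \<phi> t (bump T t x 0) = vert_grad T \<phi> t x"
  shows "\<bar>\<phi> t (bump T t x a) - \<phi> t x - vert_grad T \<phi> t x \<bullet> a\<bar> \<le> K * (norm a)\<^sup>2"
proof -
  have "\<exists>r>0. r < 1 \<and> \<phi> t (bump T t x (0 + 1 *\<^sub>R a)) - \<phi> t (bump T t x (0 + 0 *\<^sub>R a))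
      = (1 - 0) * (vert_grad T \<phi> t (bump T t x (0 + r *\<^sub>R a)) \<bullet> a)"
    by (rule MVT2[OF zero_less_one]) (rule vert_line_derivative[OF assms(1,5,6)])
  then obtain r where r: "0 < r" "r < 1" "\<phi> t (bump T t x a) - \<phi> t (bump T t x 0)
      = vert_grad T \<phi> t (bump T t x (r *\<^sub>R a)) \<bullet> a"
    by auto
  have "norm (vert_grad T \<phi> t (bump T t x (r *\<^sub>R a)) - vert_grad T \<phi> t (bump T t x 0)) \<le> K * norm (r *\<^sub>R a - 0)"
    by (rule lipschitz_past_vertical[OF assms(2,5,6)])
  also have "\<dots> \<le> K * norm a"
    using r assms(3) mult_left_le_one_le[of "norm a" r] by (intro mult_left_mono) auto
  finally have "norm (vert_grad T \<phi> t (bump T t x (r *\<^sub>R a)) - vert_grad T \<phi> t x) * norm a \<le> K * norm a * norm a"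
    using assms(7) by (intro mult_right_mono) auto
  moreover have "\<phi> t (bump T t x a) - \<phi> t x - vert_grad T \<phi> t x \<bullet> a
      = (vert_grad T \<phi> t (bump T t x (r *\<^sub>R a)) - vert_grad T \<phi> t x) \<bullet> a"
    using r non_anticipative_bump_zero[OF assms(5,4,6)] by (simp add: inner_diff_left)
  ultimately show ?thesis
    using Cauchy_Schwarz_ineq2[of "vert_grad T \<phi> t (bump T t x (r *\<^sub>R a)) - vert_grad T \<phi> t x" a]
    by (simp add: power2_eq_square mult.assoc)
qed

lemma vert_grad_bump_zero: "t \<in> {0..T} \<Longrightarrow> vert_grad T \<phi> t (bump T t x 0) = vert_grad T \<phi> t x"
  unfolding vert_grad_def by (simp add: bump_bump)

lemma hessian_bump_zero: "t \<in> {0..T} \<Longrightarrow> hessian T F t (bump T t x 0) a = hessian T F t x a"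
  by (simp add: hessian_def vert_grad_bump_zero)

lemma vertical_taylor_second:
  fixes F :: "('d::finite, real) functional"
  assumes d: "vert_differentiable T F" "\<And>i. vert_differentiable T (vert_comp T F [i])"
    and lip: "\<And>i. lipschitz_past T K (vert_grad T (vert_comp T F [i]))" "0 \<le> K"
    and na: "F \<in> non_anticipative T" and t: "t \<in> {0..T}" and x: "x \<in> cadlag T"
  shows "\<bar>F t (bump T t x a) - F t x - vert_grad T F t x \<bullet> a - (hessian T F t x a \<bullet> a) / 2\<bar>
    \<le> real CARD('d) * K * norm a ^ 3"
proof -
  define X where "X r = bump T t x (0 + r *\<^sub>R a)" for r :: real
  have X: "X 0 = bump T t x 0" "X 1 = bump T t x a" by (auto simp: X_def)
  have d1: "((\<lambda>r. F t (X r)) has_real_derivative vert_grad T F t (X r) \<bullet> a) (at r)" for r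
    unfolding X_def by (rule vert_line_derivative[OF d(1) t x])
  have "((\<lambda>r. \<Sum>i\<in>UNIV. vert_comp T F [i] t (X r) * a $ i) has_real_derivative
      (\<Sum>i\<in>UNIV. (vert_grad T (vert_comp T F [i]) t (X r) \<bullet> a) * a $ i)) (at r)" for r
    unfolding X_def by (intro DERIV_sum DERIV_cmult_right vert_line_derivative[OF d(2) t x])
  then have d2: "((\<lambda>r. vert_grad T F t (X r) \<bullet> a) has_real_derivative hessian T F t (X r) a \<bullet> a) (at r)" for r
    by (simp add: inner_vec_def hessian_def)
  obtain r where r: "\<bar>r\<bar> \<le> 1" "F t (X 1) = F t (X 0) + vert_grad T F t (X 0) \<bullet> a + (hessian T F t (X r) a \<bullet> a) / 2"
    using second_order_expansion[of "\<lambda>r. F t (X r)" "\<lambda>r. vert_grad T F t (X r) \<bullet> a", OF d1 d2] by blast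
  have "norm (hessian T F t (X r) a - hessian T F t (X 0) a) \<le> real CARD('d) * (K * norm (r *\<^sub>R a)) * norm a"
  proof (rule hessian_diff_bound)
    show "norm (vert_grad T (vert_comp T F [i]) t (X r) - vert_grad T (vert_comp T F [i]) t (X 0)) \<le> K * norm (r *\<^sub>R a)" for i
      using lipschitz_past_vertical[OF lip(1) t x, of i "r *\<^sub>R a" 0] by (simp add: X_def)
  qed
  also have "\<dots> \<le> real CARD('d) * (K * norm a) * norm a"
    using r(1) lip(2) mult_left_le_one_le[of "norm a" "\<bar>r\<bar>"] by (intro mult_right_mono mult_left_mono) auto
  finally have h: "norm (hessian T F t (X r) a - hessian T F t x a) * norm a \<le> real CARD('d) * (K * norm a) * norm a * norm a"
    using hessian_bump_zero[OF t, of F x a] X by (intro mult_right_mono) auto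
  have "F t (bump T t x a) - F t x - vert_grad T F t x \<bullet> a - (hessian T F t x a \<bullet> a) / 2
      = ((hessian T F t (X r) a - hessian T F t x a) \<bullet> a) / 2"
    using r(2) non_anticipative_bump_zero[OF t na x] vert_grad_bump_zero[OF t, of F x] X by (simp add: inner_diff_left diff_divide_distrib)
  moreover have "\<bar>(hessian T F t (X r) a - hessian T F t x a) \<bullet> a\<bar> \<le> real CARD('d) * K * norm a ^ 3"
    using Cauchy_Schwarz_ineq2[of "hessian T F t (X r) a - hessian T F t x a" a] h
    by (simp add: power3_eq_cube mult.assoc)
  ultimately show ?thesis by linarith
qed

text \<open>Two applications of the mean value theorem, first in direction \<open>i\<close> and
  then in direction \<open>j\<close>.\<close>

lemma second_difference:
  assumes d: "vert_differentiable T F" "vert_differentiable T (vert_comp T F [i])"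
    and lip: "lipschitz_past T K (vert_comp T F [j, i])" "0 \<le> K"
    and t: "t \<in> {0..T}" and x: "x \<in> cadlag T" and h: "0 < h"
  defines "\<Phi> \<equiv> \<lambda>a b. F t (bump T t x (a *\<^sub>R axis i 1 + b *\<^sub>R axis j 1))"
  shows "\<bar>\<Phi> h h - \<Phi> h 0 - \<Phi> 0 h + \<Phi> 0 0 - h\<^sup>2 * vert_comp T F [j, i] t (bump T t x 0)\<bar> \<le> 2 * K * h ^ 3"
proof -
  let ?i = "axis i 1 :: real ^ 'a" and ?j = "axis j 1 :: real ^ 'a"
  have "((\<lambda>r. \<Phi> r h - \<Phi> r 0) has_real_derivative
      (vert_comp T F [i] t (bump T t x (h *\<^sub>R ?j + r *\<^sub>R ?i)) - vert_comp T F [i] t (bump T t x (0 + r *\<^sub>R ?i)))) (at r)" for r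
    using vert_axis_derivative[OF d(1) t x, of "h *\<^sub>R ?j" i r] vert_axis_derivative[OF d(1) t x, of 0 i r]
    unfolding \<Phi>_def by (intro DERIV_diff) (simp_all add: add.commute)
  then have "\<exists>\<xi>>0. \<xi> < h \<and> (\<Phi> h h - \<Phi> h 0) - (\<Phi> 0 h - \<Phi> 0 0) = (h - 0) *
      (vert_comp T F [i] t (bump T t x (h *\<^sub>R ?j + \<xi> *\<^sub>R ?i)) - vert_comp T F [i] t (bump T t x (0 + \<xi> *\<^sub>R ?i)))"
    by (intro MVT2[OF h])
  then obtain \<xi> where \<xi>: "0 < \<xi>" "\<xi> < h" "(\<Phi> h h - \<Phi> h 0) - (\<Phi> 0 h - \<Phi> 0 0) = (h - 0) *
      (vert_comp T F [i] t (bump T t x (h *\<^sub>R ?j + \<xi> *\<^sub>R ?i)) - vert_comp T F [i] t (bump T t x (0 + \<xi> *\<^sub>R ?i)))"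
    by blast
  have "((\<lambda>r. vert_comp T F [i] t (bump T t x (\<xi> *\<^sub>R ?i + r *\<^sub>R ?j))) has_real_derivative
      vert_comp T F [j, i] t (bump T t x (\<xi> *\<^sub>R ?i + r *\<^sub>R ?j))) (at r)" for r
    using vert_axis_derivative[OF d(2) t x, of "\<xi> *\<^sub>R ?i" j r] by simp
  then have "\<exists>\<eta>>0. \<eta> < h \<and> vert_comp T F [i] t (bump T t x (\<xi> *\<^sub>R ?i + h *\<^sub>R ?j))
      - vert_comp T F [i] t (bump T t x (\<xi> *\<^sub>R ?i + 0 *\<^sub>R ?j))
      = (h - 0) * vert_comp T F [j, i] t (bump T t x (\<xi> *\<^sub>R ?i + \<eta> *\<^sub>R ?j))"
    by (intro MVT2[OF h])
  then obtain \<eta> where \<eta>: "0 < \<eta>" "\<eta> < h" "vert_comp T F [i] t (bump T t x (\<xi> *\<^sub>R ?i + h *\<^sub>R ?j))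
      - vert_comp T F [i] t (bump T t x (\<xi> *\<^sub>R ?i + 0 *\<^sub>R ?j))
      = (h - 0) * vert_comp T F [j, i] t (bump T t x (\<xi> *\<^sub>R ?i + \<eta> *\<^sub>R ?j))"
    by blast
  have "\<Phi> h h - \<Phi> h 0 - \<Phi> 0 h + \<Phi> 0 0 = (\<Phi> h h - \<Phi> h 0) - (\<Phi> 0 h - \<Phi> 0 0)" by simp
  also have "\<dots> = h\<^sup>2 * vert_comp T F [j, i] t (bump T t x (\<xi> *\<^sub>R ?i + \<eta> *\<^sub>R ?j))"
    unfolding \<xi>(3) using \<eta>(3) by (simp add: add.commute power2_eq_square)
  finally have eq: "\<Phi> h h - \<Phi> h 0 - \<Phi> 0 h + \<Phi> 0 0 - h\<^sup>2 * vert_comp T F [j, i] t (bump T t x 0)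
      = h\<^sup>2 * (vert_comp T F [j, i] t (bump T t x (\<xi> *\<^sub>R ?i + \<eta> *\<^sub>R ?j)) - vert_comp T F [j, i] t (bump T t x 0))"
    by (simp add: right_diff_distrib)
  have "norm (vert_comp T F [j, i] t (bump T t x (\<xi> *\<^sub>R ?i + \<eta> *\<^sub>R ?j)) - vert_comp T F [j, i] t (bump T t x 0))
      \<le> K * norm (\<xi> *\<^sub>R ?i + \<eta> *\<^sub>R ?j - 0)"
    by (rule lipschitz_past_vertical[OF lip(1) t x])
  also have "\<dots> \<le> K * (2 * h)"
    using norm_triangle_ineq[of "\<xi> *\<^sub>R ?i" "\<eta> *\<^sub>R ?j"] \<xi> \<eta> lip(2) by (intro mult_left_mono) auto
  finally have "h\<^sup>2 * \<bar>vert_comp T F [j, i] t (bump T t x (\<xi> *\<^sub>R ?i + \<eta> *\<^sub>R ?j)) - vert_comp T F [j, i] t (bump T t x 0)\<bar>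
      \<le> h\<^sup>2 * (K * (2 * h))"
    by (intro mult_left_mono) auto
  then show ?thesis
    unfolding eq abs_mult by (simp add: power2_eq_square power3_eq_cube mult.assoc mult.left_commute)
qed

text \<open>The second difference quotient is symmetric in \<open>i\<close> and \<open>j\<close>,
  and it converges to both mixed derivatives.\<close>

lemma vert_comp_symmetric:
  assumes d: "vert_differentiable T F" "\<And>i. vert_differentiable T (vert_comp T F [i])"
    and lip: "\<And>i j. lipschitz_past T K (vert_comp T F [j, i])" "0 \<le> K"
    and t: "t \<in> {0..T}" and x: "x \<in> cadlag T"
  shows "vert_comp T F [i, j] t x = vert_comp T F [j, i] t x"
proof (rule ccontr)
  let ?D = "\<lambda>i j. vert_comp T F [j, i] t (bump T t x 0)"
  assume "vert_comp T F [i, j] t x \<noteq> vert_comp T F [j, i] t x"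
  then have pos: "0 < \<bar>?D i j - ?D j i\<bar>" by (simp add: vert_grad_bump_zero[OF t])
  \<comment> \<open>small enough that the error \<open>4 K h\<close> is less than the difference of the mixed derivatives\<close>
  define h where "h = \<bar>?D i j - ?D j i\<bar> / (8 * (K + 1))"
  have h: "0 < h" using pos lip(2) by (simp add: h_def)
  define \<Phi> where "\<Phi> a b = F t (bump T t x (a *\<^sub>R axis i 1 + b *\<^sub>R axis j 1))" for a b
  have "\<bar>\<Phi> h h - \<Phi> h 0 - \<Phi> 0 h + \<Phi> 0 0 - h\<^sup>2 * ?D i j\<bar> \<le> 2 * K * h ^ 3"
    using second_difference[OF d(1) d(2) lip(1) lip(2) t x h, of i j] by (simp add: \<Phi>_def)
  moreover have "\<bar>\<Phi> h h - \<Phi> h 0 - \<Phi> 0 h + \<Phi> 0 0 - h\<^sup>2 * ?D j i\<bar> \<le> 2 * K * h ^ 3"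
    using second_difference[OF d(1) d(2) lip(1) lip(2) t x h, of j i] by (simp add: \<Phi>_def algebra_simps)
  ultimately have "\<bar>h\<^sup>2 * ?D i j - h\<^sup>2 * ?D j i\<bar> \<le> 4 * K * h ^ 3" by linarith
  then have "h\<^sup>2 * \<bar>?D i j - ?D j i\<bar> \<le> h\<^sup>2 * (4 * K * h)"
    unfolding right_diff_distrib[symmetric] abs_mult by (simp add: power2_eq_square power3_eq_cube mult.assoc mult.left_commute)
  then have "\<bar>?D i j - ?D j i\<bar> \<le> 4 * K * h" using h by (simp del: vert_comp.simps)
  also have "\<dots> \<le> 4 * (K + 1) * h" using h by (intro mult_right_mono) auto
  also have "\<dots> = \<bar>?D i j - ?D j i\<bar> / 2"
  proof -
    have "h * (8 * (K + 1)) = \<bar>?D i j - ?D j i\<bar>"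
      using lip(2) by (simp add: h_def del: vert_comp.simps)
    moreover have "4 * (K + 1) * h = (h * (8 * (K + 1))) / 2" by (simp add: algebra_simps)
    ultimately show ?thesis by (simp only:)
  qed
  finally have "\<bar>?D i j - ?D j i\<bar> \<le> \<bar>?D i j - ?D j i\<bar> / 2" .
  moreover have "\<not> z \<le> z / 2" if "0 < z" for z :: real using that by simp
  ultimately show False using pos by blast
qed

section \<open>Expansions for regular functionals\<close>

lemma frozen_stop:
  assumes "frozen T \<omega> s y" "0 \<le> s" "s \<le> u" "u \<le> T"
  shows "stop T u y = y"
proof (rule extensionalityI[of _ "{0..T}"])
  obtain c where c: "\<forall>r\<in>{s..T}. y r = c" using assms(1) by (auto simp: frozen_def)
  show "stop T u y r = y r" if "r \<in> {0..T}" for r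
    using that c assms by (auto simp: stop_def min_def)
qed (use assms in \<open>auto simp: stop_def frozen_def cadlag_def\<close>)

text \<open>Along a frozen path, \<open>u \<mapsto> \<phi> u y\<close> has the horizontal
  derivative as its right derivative, which makes it right-continuous; left-continuity of the
  functional gives the other side.\<close>

lemma horizontal_integral:
  assumes lc: "\<phi> \<in> left_cont T" and hd: "horiz_differentiable T \<phi>"
    and B: "\<And>u x. \<lbrakk>u \<in> {0..T}; x \<in> cadlag T; x ` {0..u} \<subseteq> \<omega> ` {0..T}\<rbrakk> \<Longrightarrow> \<bar>horiz_deriv T \<phi> u x\<bar> < B"
    and st: "0 \<le> s" "s \<le> t" "t \<le> T" and y: "frozen T \<omega> s y"
  shows "((\<lambda>u. horiz_deriv T \<phi> u y) has_integral (\<phi> t y - \<phi> s y)) {s..t}"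
    and "\<bar>\<phi> t y - \<phi> s y\<bar> \<le> B * (t - s)"
proof -
  have yc: "y \<in> cadlag T" and yim: "y ` {0..T} \<subseteq> \<omega> ` {0..T}" using y by (auto simp: frozen_def)
  have stop: "stop T u y = y" if "u \<in> {s..t}" for u
    using frozen_stop[OF y st(1), of u] that st by auto
  have deriv: "((\<lambda>h. (\<phi> (u + h) y - \<phi> u y) / h) \<longlongrightarrow> horiz_deriv T \<phi> u y) (at_right 0)" if u: "u \<in> {s..<t}" for u
  proof -
    have "\<exists>l. ((\<lambda>h. (\<phi> (u + h) (stop T u y) - \<phi> u (stop T u y)) / h) \<longlongrightarrow> l) (at_right 0)"
      using hd u st yc unfolding horiz_differentiable_def by auto
    then obtain l where l: "((\<lambda>h. (\<phi> (u + h) (stop T u y) - \<phi> u (stop T u y)) / h) \<longlongrightarrow> l) (at_right 0)" ..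
    then have "horiz_deriv T \<phi> u y = l"
      using u st by (simp add: horiz_deriv_def tendsto_Lim)
    then show ?thesis using l u stop[of u] by simp
  qed
  have bound: "\<bar>horiz_deriv T \<phi> u y\<bar> < B" if "u \<in> {s..<t}" for u
    using that st yc yim by (intro B) auto
  have right: "((\<lambda>v. \<phi> v y) \<longlongrightarrow> \<phi> u y) (at_right u)" if u: "u \<in> {s..<t}" for u
  proof -
    have "((\<lambda>h. h * ((\<phi> (u + h) y - \<phi> u y) / h)) \<longlongrightarrow> 0 * horiz_deriv T \<phi> u y) (at_right 0)"
      by (intro tendsto_mult deriv[OF u] tendsto_ident_at)
    moreover have "eventually (\<lambda>h. h * ((\<phi> (u + h) y - \<phi> u y) / h) = \<phi> (u + h) y - \<phi> u y) (at_right 0)"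
      using eventually_at_right_less[of "0::real"] by eventually_elim simp
    ultimately have "((\<lambda>h. \<phi> (u + h) y - \<phi> u y) \<longlongrightarrow> 0) (at_right 0)"
      by (auto intro: Lim_transform_eventually)
    then have "((\<lambda>h. \<phi> (h + u) y) \<longlongrightarrow> \<phi> u y) (at_right 0)"
      by (simp add: LIM_zero_iff add.commute)
    then show ?thesis
      by (subst filterlim_at_right_to_0) simp
  qed
  have left: "((\<lambda>v. \<phi> v y) \<longlongrightarrow> \<phi> u y) (at u within {s..<u})" if u: "u \<in> {s..t}" for u
  proof (rule tendstoI)
    fix \<epsilon> :: real assume \<epsilon>: "0 < \<epsilon>"
    have sp: "(v, y) \<in> stopped_paths T" if "v \<in> {s..t}" for v
      unfolding stopped_paths_def using stop[OF that] that st yc by (auto intro!: exI[of _ y])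
    obtain \<eta> where \<eta>: "\<eta> > 0" "\<And>t' x'. \<lbrakk>(t', x') \<in> stopped_paths T; t' < u; d_inf T (u, y) (t', x') < \<eta>\<rbrakk>
        \<Longrightarrow> \<bar>\<phi> u y - \<phi> t' x'\<bar> < \<epsilon>"
      using lc sp[OF u] \<epsilon> unfolding left_cont_def by fastforce
    have "dist (\<phi> v y) (\<phi> u y) < \<epsilon>" if v: "v \<in> {s..<u}" "dist v u < \<eta>" for v
    proof -
      have "d_inf T (u, y) (v, y) = \<bar>u - v\<bar>"
        using stop[of u] stop[of v] u v st by (simp add: d_inf_def sup_norm_def)
      then have "\<bar>\<phi> u y - \<phi> v y\<bar> < \<epsilon>"
        using v u by (intro \<eta>(2) sp) (auto simp: dist_real_def)
      then show ?thesis by (simp add: dist_real_def abs_minus_commute)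
    qed
    then show "eventually (\<lambda>v. dist (\<phi> v y) (\<phi> u y) < \<epsilon>) (at u within {s..<u})"
      using \<eta>(1) by (auto simp: eventually_at)
  qed
  have cont: "continuous_on {s..t} (\<lambda>u. \<phi> u y)"
    unfolding continuous_on_def
  proof
    fix u assume u: "u \<in> {s..t}"
    have "((\<lambda>v. \<phi> v y) \<longlongrightarrow> \<phi> u y) (at u within ({s..<u} \<union> {u<..t}))"
    proof (rule Lim_Un[OF left[OF u]])
      show "((\<lambda>v. \<phi> v y) \<longlongrightarrow> \<phi> u y) (at u within {u<..t})"
      proof (cases "u = t")
        case False
        then show ?thesis using u by (intro tendsto_within_subset[OF right]) auto
      qed simp
    qed
    moreover have "at u within {s..t} = at u within ({s..<u} \<union> {u<..t})"
    proof -
      have "{s..t} - {u} = ({s..<u} \<union> {u<..t}) - {u}" using u by auto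
      then show ?thesis by (simp add: at_within_def)
    qed
    ultimately show "((\<lambda>v. \<phi> v y) \<longlongrightarrow> \<phi> u y) (at u within {s..t})" by simp
  qed
  show "((\<lambda>u. horiz_deriv T \<phi> u y) has_integral (\<phi> t y - \<phi> s y)) {s..t}"
    by (rule has_integral_right_derivative[OF st(2) cont deriv bound])
  show "\<bar>\<phi> t y - \<phi> s y\<bar> \<le> B * (t - s)"
    by (rule right_derivative_lipschitz[OF st(2) cont deriv bound])
qed

lemma uniform_constant:
  fixes P :: "'i::finite \<Rightarrow> real \<Rightarrow> bool"
  assumes ex: "\<And>i. \<exists>K\<ge>0. P i K" and mono: "\<And>i K K'. P i K \<Longrightarrow> K \<le> K' \<Longrightarrow> P i K'"
  shows "\<exists>K\<ge>0. \<forall>i. P i K"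
proof -
  obtain k where k: "\<And>i. 0 \<le> k i" "\<And>i. P i (k i)" using ex by metis
  have "P i (\<Sum>j\<in>UNIV. k j)" for i
    using k by (intro mono[OF k(2)] member_le_sum) auto
  then show ?thesis using k(1) by (intro exI[of _ "\<Sum>j\<in>UNIV. k j"]) (auto intro: sum_nonneg)
qed

lemma bdd_preserving_bound:
  assumes "\<phi> \<in> bdd_preserving T" "compact (\<omega> ` {0..T})" "0 \<le> T"
  shows "\<exists>B\<ge>0. \<forall>u\<in>{0..T}. \<forall>x\<in>cadlag T. x ` {0..u} \<subseteq> \<omega> ` {0..T} \<longrightarrow> \<bar>\<phi> u x\<bar> < B"
proof -
  have "T \<in> {0..T}" using assms(3) by simp
  then have "\<exists>C>0. \<forall>t\<in>{0..T}. \<forall>x\<in>cadlag T. x ` {0..t} \<subseteq> \<omega> ` {0..T} \<longrightarrow> \<bar>\<phi> t x\<bar> < C"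
    using assms(1,2) unfolding bdd_preserving_def by blast
  then show ?thesis using less_imp_le by blast
qed

text \<open>All constants are made uniform over the finitely many components. The Lipschitz
  constants of the components are \<open>K\<close> for \<open>F\<close> and its third derivatives,
  \<open>2K\<close> for the first and \<open>3 * 2K\<close> for the second ones; \<open>c\<close>
  is the dimension, which bounds the norm of a vector by its components.\<close>

lemma regular_path_expansion:
  fixes F :: "('d::finite, real) functional" and \<omega> :: "real \<Rightarrow> real ^ 'd"
  assumes F: "F \<in> regular_functionals T" and T: "0 < T"
    and nu: "0 < \<nu>" "\<nu> \<le> 1/2" "1 < 2 * \<nu> + \<nu>\<^sup>2"
    and path: "\<omega> \<in> cadlag T"
    and holder: "\<And>s t. s \<in> {0..T} \<Longrightarrow> t \<in> {0..T} \<Longrightarrow> norm (\<omega> t - \<omega> s) \<le> C * \<bar>t - s\<bar> powr \<nu>"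
  shows "\<exists>L. path_expansion T \<nu> L \<omega> F (horiz_deriv T F) (vert_grad T F) (hessian T F)"
proof -
  have F2: "F \<in> C1b T 2" and F1: "vert_comp T F [i] \<in> C1b T 1" "vert_comp T F [i, j] \<in> C1b T 1"
    and lipF: "F \<in> lip_functionals T" "horiz_deriv T F \<in> lip_functionals T"
      "vert_comp T F [i, j, k] \<in> lip_functionals T" for i j k
    using F by (auto simp: regular_functionals_def simp del: vert_comp.simps)
  have lc: "F \<in> left_cont T" "vert_comp T F [i] \<in> left_cont T" "vert_comp T F [i, j] \<in> left_cont T" for i j
  proof -
    have "vert_comp T F js \<in> left_cont T" if "length js \<le> 2" for js
      using F2 that unfolding C1b_def by blast
    from this[of "[]"] this[of "[i]"] this[of "[i, j]"]
    show "F \<in> left_cont T" "vert_comp T F [i] \<in> left_cont T" "vert_comp T F [i, j] \<in> left_cont T"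
      by (simp_all del: vert_comp.simps(2))
  qed
  have na: "F \<in> non_anticipative T" "vert_comp T F [i] \<in> non_anticipative T"
    "vert_comp T F [i, j] \<in> non_anticipative T" for i j
    using lc by (auto simp: left_cont_def simp del: vert_comp.simps)
  have d: "vert_differentiable T F" "vert_differentiable T (vert_comp T F [i])"
    "vert_differentiable T (vert_comp T F [i, j])" for i j
  proof -
    have "vert_differentiable T (vert_comp T F js)" if "length js < 2" for js
      using F2 that unfolding C1b_def by blast
    from this[of "[]"] this[of "[i]"] show "vert_differentiable T F" "vert_differentiable T (vert_comp T F [i])"
      by simp_all
    have "vert_differentiable T (vert_comp T (vert_comp T F [i, j]) [])"
      using F1(2)[of i j] unfolding C1b_def by fastforce
    then show "vert_differentiable T (vert_comp T F [i, j])" by simp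
  qed
  have hd: "horiz_differentiable T F" "horiz_differentiable T (vert_comp T F [i])"
    "horiz_differentiable T (vert_comp T F [i, j])" for i j
    using F2 F1 unfolding C1b_def by blast+
  have bd: "horiz_deriv T F \<in> bdd_preserving T" "horiz_deriv T (vert_comp T F [i]) \<in> bdd_preserving T"
    "horiz_deriv T (vert_comp T F [i, j]) \<in> bdd_preserving T"
    "vert_comp T F [i] \<in> bdd_preserving T" "vert_comp T F [i, j] \<in> bdd_preserving T" for i j
  proof -
    have "vert_comp T F js \<in> bdd_preserving T" if "1 \<le> length js" "length js \<le> 2" for js
      using F2 that unfolding C1b_def by blast
    from this[of "[i]"] this[of "[i, j]"] show "vert_comp T F [i] \<in> bdd_preserving T" "vert_comp T F [i, j] \<in> bdd_preserving T"
      by (simp_all del: vert_comp.simps)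
  qed (use F2 F1 in \<open>unfold C1b_def, blast+\<close>)

  obtain K1 where K1: "0 \<le> K1" "lipschitz_past T K1 F" using lip_functional_past[OF lipF(1)] T by auto
  obtain KD where KD: "0 \<le> KD" "lipschitz_past T KD (horiz_deriv T F)" using lip_functional_past[OF lipF(2)] T by auto
  obtain K3 where K3: "0 \<le> K3" "\<And>p. lipschitz_past T K3 (vert_comp T F [fst p, fst (snd p), snd (snd p)])"
  proof -
    let ?P = "\<lambda>p K. lipschitz_past T K (vert_comp T F [fst p, fst (snd p), snd (snd p)])"
    have "\<exists>K\<ge>0. ?P p K" for p
      using lip_functional_past[OF lipF(3)] T less_imp_le by metis
    then have "\<exists>K\<ge>0. \<forall>p. ?P p K"
      by (rule uniform_constant[of ?P]) (rule lipschitz_past_mono)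
    then show ?thesis using that by blast
  qed
  define K where "K = K1 + K3"
  have K: "0 \<le> K" "lipschitz_past T K F" "lipschitz_past T K (vert_comp T F [i, j, k])" for i j k
    using K1 K3(1) lipschitz_past_mono[OF K1(2), of K] lipschitz_past_mono[of T K3 "vert_comp T F [i, j, k]" K] K3(2)[of "(i, j, k)"]
    by (auto simp: K_def simp del: vert_comp.simps)
  have lip1: "lipschitz_past T (2 * K) (vert_comp T F [j])" for j
    using K d na by (intro lipschitz_past_from_third_derivative) auto
  have lip2: "lipschitz_past T (6 * K) (vert_comp T F [j, i])" for i j
  proof -
    have "lipschitz_past T (2 * K) (vert_comp T (vert_comp T F [i]) [j, j])"
      using lipschitz_past_mono[OF K(3), of "2 * K" j j i] K(1) by simp
    then have "lipschitz_past T (3 * (2 * K)) (vert_comp T (vert_comp T F [i]) [j])"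
      using lip1[of i] d(2)[of i] d(3)[of j i] na(3)[of j i] na(2)[of i]
      by (intro lipschitz_past_from_second_derivative) simp_all
    then show ?thesis by simp
  qed
  define c where "c = real CARD('d)"
  have c1: "1 \<le> c" unfolding c_def by (simp add: Suc_leI)
  have lip_grad: "lipschitz_past T (c * (2 * K)) (vert_grad T F)"
    unfolding c_def by (rule lipschitz_past_vert_grad) (rule lip1)
  have lip_grad2: "lipschitz_past T (c * (6 * K)) (vert_grad T (vert_comp T F [i]))" for i
    unfolding c_def by (rule lipschitz_past_vert_grad) (use lip2 in simp)

  have "continuous_on {0..T} \<omega>"
    unfolding continuous_on_def
  proof
    fix s assume s: "s \<in> {0..T}"
    have "((\<lambda>t. \<bar>t - s\<bar> powr \<nu>) \<longlongrightarrow> 0) (at s within {0..T})"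
      using nu by (intro tendsto_zero_powrI[where b = \<nu>] tendsto_rabs_zero LIM_zero tendsto_intros) auto
    then have "((\<lambda>t. C * \<bar>t - s\<bar> powr \<nu>) \<longlongrightarrow> 0) (at s within {0..T})"
      by (rule tendsto_mult_right_zero)
    then have "((\<lambda>t. \<omega> t - \<omega> s) \<longlongrightarrow> 0) (at s within {0..T})"
      by (rule Lim_null_comparison[rotated]) (use holder[OF s] in \<open>simp add: eventually_at_filter\<close>)
    then show "(\<omega> \<longlongrightarrow> \<omega> s) (at s within {0..T})" by (simp add: LIM_zero_iff)
  qed
  then have comp: "compact (\<omega> ` {0..T})" by (rule compact_continuous_image) simp
  define bounded_by where "bounded_by \<phi> B \<longleftrightarrow> (\<forall>u\<in>{0..T}. \<forall>x\<in>cadlag T. x ` {0..u} \<subseteq> \<omega> ` {0..T} \<longrightarrow> \<bar>\<phi> u x\<bar> < B)"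
    for \<phi> :: "('d, real) functional" and B
  have bmono: "bounded_by \<phi> B \<Longrightarrow> B \<le> B' \<Longrightarrow> bounded_by \<phi> B'" for \<phi> B B'
    unfolding bounded_by_def by (meson order_less_le_trans)
  have bex: "\<exists>B\<ge>0. bounded_by \<phi> B" if "\<phi> \<in> bdd_preserving T" for \<phi>
    using bdd_preserving_bound[OF that comp] T by (auto simp: bounded_by_def)
  have unif: "\<exists>B\<ge>0. \<forall>p. bounded_by (\<phi> p) B" if "\<And>p. \<phi> p \<in> bdd_preserving T"
    for \<phi> :: "'d \<times> 'd \<Rightarrow> ('d, real) functional"
  proof (rule uniform_constant[of "\<lambda>p. bounded_by (\<phi> p)"])
    show "\<exists>B\<ge>0. bounded_by (\<phi> p) B" for p by (rule bex[OF that])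
  qed (rule bmono)
  obtain B0 where B0: "0 \<le> B0" "bounded_by (horiz_deriv T F) B0" using bex[OF bd(1)] by (elim exE conjE) (rule that)
  obtain B1 where B1: "0 \<le> B1" "\<forall>p::'d \<times> 'd. bounded_by (horiz_deriv T (vert_comp T F [fst p])) B1"
    using unif[of "\<lambda>p::'d \<times> 'd. horiz_deriv T (vert_comp T F [fst p])", OF bd(2)] by (elim exE conjE) (rule that)
  obtain B2 where B2: "0 \<le> B2" "\<forall>p::'d \<times> 'd. bounded_by (horiz_deriv T (vert_comp T F [fst p, snd p])) B2"
    using unif[of "\<lambda>p::'d \<times> 'd. horiz_deriv T (vert_comp T F [fst p, snd p])", OF bd(3)] by (elim exE conjE) (rule that)
  obtain B3 where B3: "0 \<le> B3" "\<forall>p::'d \<times> 'd. bounded_by (vert_comp T F [fst p]) B3"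
    using unif[of "\<lambda>p::'d \<times> 'd. vert_comp T F [fst p]", OF bd(4)] by (elim exE conjE) (rule that)
  obtain B4 where B4: "0 \<le> B4" "\<forall>p::'d \<times> 'd. bounded_by (vert_comp T F [fst p, snd p]) B4"
    using unif[of "\<lambda>p::'d \<times> 'd. vert_comp T F [fst p, snd p]", OF bd(5)] by (elim exE conjE) (rule that)
  define B where "B = B0 + B1 + B2 + B3 + B4"
  have Bnn: "0 \<le> B" using B0(1) B1(1) B2(1) B3(1) B4(1) by (simp add: B_def)
  have B: "bounded_by (horiz_deriv T F) B" "bounded_by (horiz_deriv T (vert_comp T F [i])) B"
    "bounded_by (horiz_deriv T (vert_comp T F [i, j])) B" "bounded_by (vert_comp T F [i]) B"
    "bounded_by (vert_comp T F [i, j]) B" for i j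
  proof -
    have le: "B0 \<le> B" "B1 \<le> B" "B2 \<le> B" "B3 \<le> B" "B4 \<le> B"
      using B0(1) B1(1) B2(1) B3(1) B4(1) by (auto simp: B_def)
    show "bounded_by (horiz_deriv T F) B" by (rule bmono[OF B0(2) le(1)])
    show "bounded_by (horiz_deriv T (vert_comp T F [i])) B"
      using bmono[OF spec[OF B1(2), of "(i, j)"] le(2)] by (simp only: fst_conv)
    show "bounded_by (horiz_deriv T (vert_comp T F [i, j])) B"
      using bmono[OF spec[OF B2(2), of "(i, j)"] le(3)] by (simp only: fst_conv snd_conv)
    show "bounded_by (vert_comp T F [i]) B"
      using bmono[OF spec[OF B3(2), of "(i, j)"] le(4)] by (simp only: fst_conv)
    show "bounded_by (vert_comp T F [i, j]) B"
      using bmono[OF spec[OF B4(2), of "(i, j)"] le(5)] by (simp only: fst_conv snd_conv)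
  qed
  have bnd: "\<bar>\<phi> u x\<bar> < B" if "bounded_by \<phi> B" "u \<in> {0..T}" "x \<in> cadlag T" "x ` {0..u} \<subseteq> \<omega> ` {0..T}" for \<phi> u x
    using that by (auto simp: bounded_by_def)

  define L where "L = 1 + \<bar>C\<bar> + KD + c * (c * (6 * K)) + c * (c * B)"
  have cK: "0 \<le> c * (c * (6 * K))" "0 \<le> c * (c * B)" using c1 K(1) Bnn by simp_all
  have up: "a \<le> c * a" if "0 \<le> a" for a using mult_right_mono[OF c1 that] by simp
  have L: "1 \<le> L" "C \<le> L" "KD \<le> L" "c * (c * (6 * K)) \<le> L" "c * (c * B) \<le> L"
    using cK KD(1) abs_ge_self[of C] abs_ge_zero[of C] unfolding L_def by linarith+
  have "c * (2 * K) \<le> c * (6 * K)" using c1 K(1) by (intro mult_left_mono) auto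
  moreover have "6 * K \<le> c * (6 * K)" "B \<le> c * B"
    using K(1) Bnn by (auto intro: up)
  moreover have "c * (6 * K) \<le> c * (c * (6 * K))" "c * B \<le> c * (c * B)"
    using K(1) Bnn c1 by (auto intro!: up)
  ultimately have L': "K \<le> L" "c * (2 * K) \<le> L" "c * B \<le> L" "B \<le> L"
    using L(4,5) K(1) by linarith+
  have hess_comp: "(hessian T F t x a) $ i = vert_grad T (vert_comp T F [i]) t x \<bullet> a" for t x a i
    by (simp add: hessian_def)
  have hor1: "\<bar>vert_comp T F [i] t y - vert_comp T F [i] s y\<bar> \<le> B * (t - s)"
    if "0 \<le> s" "s \<le> t" "t \<le> T" "frozen T \<omega> s y" for s t y i
    by (rule horizontal_integral(2)[OF lc(2) hd(2) bnd[OF B(2)] that])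
  have hor2: "\<bar>vert_comp T F [i, j] t y - vert_comp T F [i, j] s y\<bar> \<le> B * (t - s)"
    if "0 \<le> s" "s \<le> t" "t \<le> T" "frozen T \<omega> s y" for s t y i j
    by (rule horizontal_integral(2)[OF lc(3) hd(3) bnd[OF B(3)] that])
  have grad_comp: "norm (vert_grad T (vert_comp T F js) t x - vert_grad T (vert_comp T F js) s y) \<le> c * b"
    if "\<And>i. \<bar>vert_comp T F (i # js) t x - vert_comp T F (i # js) s y\<bar> \<le> b" for js t x s y b
    using that unfolding c_def by (intro norm_le_components) simp
  have mono: "a * b \<le> L * b" if "a \<le> L" "0 \<le> b" for a b
    using that by (rule mult_right_mono)

  show ?thesis
  proof (rule exI[of _ L], rule path_expansion.intro)
    show "0 < T" "1 \<le> L" "0 < \<nu>" "\<nu> \<le> 1 / 2" "1 < 2 * \<nu> + \<nu>\<^sup>2" "\<omega> \<in> cadlag T" by fact+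
  next
    fix s t assume "s \<in> {0..T}" "t \<in> {0..T}"
    then show "norm (\<omega> t - \<omega> s) \<le> L * \<bar>t - s\<bar> powr \<nu>"
      using order.trans[OF holder mono[OF L(2)]] by simp
  next
    fix x y :: "real \<Rightarrow> real ^ 'd" and t e a assume *: "x \<in> cadlag T" "y \<in> cadlag T" "t \<in> {0..T}" "\<And>r. r \<in> {0..t} \<Longrightarrow> norm (x r - y r) \<le> e"
    then have e: "0 \<le> e" by (intro past_bound_nonneg[of t T x y e])
    show "\<bar>F t x - F t y\<bar> \<le> L * e"
      using lipschitz_pastD[OF lipschitz_past_mono[OF K(2) L'(1)] *(3,1,2,4)] by simp
    show "\<bar>horiz_deriv T F t x - horiz_deriv T F t y\<bar> \<le> L * e"
      using lipschitz_pastD[OF lipschitz_past_mono[OF KD(2) L(3)] *(3,1,2,4)] by simp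
    show "norm (vert_grad T F t x - vert_grad T F t y) \<le> L * e"
      using lipschitz_pastD[OF lipschitz_past_mono[OF lip_grad L'(2)] *(3,1,2,4)] by simp
    have "norm (hessian T F t x a - hessian T F t y a) \<le> c * (c * (6 * K) * e) * norm a"
      unfolding c_def by (rule hessian_diff_bound, fold c_def, rule lipschitz_pastD[OF lip_grad2 *(3,1,2,4)])
    also have "\<dots> = c * (c * (6 * K)) * (e * norm a)" by simp
    also have "\<dots> \<le> L * (e * norm a)" using e by (intro mono L) auto
    finally show "norm (hessian T F t x a - hessian T F t y a) \<le> L * e * norm a" by simp
  next
    fix s t a and y :: "real \<Rightarrow> real ^ 'd" assume *: "0 \<le> s" "s \<le> t" "t \<le> T" "frozen T \<omega> s y"
    show "((\<lambda>u. horiz_deriv T F u y) has_integral (F t y - F s y)) {s..t}"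
      by (rule horizontal_integral(1)[OF lc(1) hd(1) bnd[OF B(1)] *])
    have "norm (vert_grad T F t y - vert_grad T F s y) \<le> c * (B * (t - s))"
      using grad_comp[of "[]" t y s y] hor1[OF *] by simp
    also have "\<dots> = c * B * (t - s)" by simp
    also have "\<dots> \<le> L * (t - s)" using * by (intro mono L') auto
    finally show "norm (vert_grad T F t y - vert_grad T F s y) \<le> L * (t - s)" .
    have "norm (hessian T F t y a - hessian T F s y a) \<le> c * (c * (B * (t - s))) * norm a"
      unfolding c_def by (rule hessian_diff_bound, fold c_def, rule grad_comp, rule hor2[OF *])
    also have "\<dots> = c * (c * B) * ((t - s) * norm a)" by simp
    also have "\<dots> \<le> L * ((t - s) * norm a)" using * by (intro mono L) auto
    finally show "norm (hessian T F t y a - hessian T F s y a) \<le> L * (t - s) * norm a" by simp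
  next
    fix x :: "real \<Rightarrow> real ^ 'd" and t a assume *: "x \<in> cadlag T" "t \<in> {0..T}"
    have "\<bar>F t (bump T t x a) - F t x - vert_grad T F t x \<bullet> a - (hessian T F t x a \<bullet> a) / 2\<bar> \<le> c * (c * (6 * K)) * norm a ^ 3"
      using c1 K(1) * unfolding c_def[symmetric]
      by (intro vertical_taylor_second[of T F "c * (6 * K)", folded c_def] d lip_grad2 na) auto
    also have "\<dots> \<le> L * norm a ^ 3" by (intro mono L) auto
    finally show "\<bar>F t (bump T t x a) - F t x - vert_grad T F t x \<bullet> a - (hessian T F t x a \<bullet> a) / 2\<bar> \<le> L * norm a ^ 3" .
    have "norm (vert_grad T F t (bump T t x a) - vert_grad T F t x - hessian T F t x a) \<le> c * (c * (6 * K) * (norm a)\<^sup>2)"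
      unfolding c_def
    proof (rule norm_le_components, fold c_def)
      fix i
      have "\<bar>vert_comp T F [i] t (bump T t x a) - vert_comp T F [i] t x - vert_grad T (vert_comp T F [i]) t x \<bullet> a\<bar>
          \<le> c * (6 * K) * (norm a)\<^sup>2"
        using c1 K(1) * by (intro vertical_taylor_first d lip_grad2 na vert_grad_bump_zero) auto
      then show "\<bar>(vert_grad T F t (bump T t x a) - vert_grad T F t x - hessian T F t x a) $ i\<bar> \<le> c * (6 * K) * (norm a)\<^sup>2"
        by (simp add: hess_comp)
    qed
    also have "\<dots> = c * (c * (6 * K)) * (norm a)\<^sup>2" by simp
    also have "\<dots> \<le> L * (norm a)\<^sup>2" by (intro mono L) auto
    finally show "norm (vert_grad T F t (bump T t x a) - vert_grad T F t x - hessian T F t x a) \<le> L * (norm a)\<^sup>2" .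
    show "linear (hessian T F t x)" by (rule hessian_linear)
    fix b
    have sym: "vert_comp T F [i, j] t x = vert_comp T F [j, i] t x" for i j
      using K(1) * by (intro vert_comp_symmetric[OF d(1) d(2) lip2]) auto
    have "hessian T F t x a \<bullet> b = (\<Sum>i\<in>UNIV. \<Sum>j\<in>UNIV. vert_comp T F [j, i] t x * (a $ j * b $ i))"
      by (rule hessian_inner)
    also have "\<dots> = (\<Sum>j\<in>UNIV. \<Sum>i\<in>UNIV. vert_comp T F [j, i] t x * (a $ j * b $ i))"
      by (rule sum.swap)
    also have "\<dots> = (\<Sum>j\<in>UNIV. \<Sum>i\<in>UNIV. vert_comp T F [i, j] t x * (b $ i * a $ j))"
      by (intro sum.cong refl) (simp only: sym mult.commute[of "a $ _"])
    also have "\<dots> = hessian T F t x b \<bullet> a" by (rule hessian_inner[symmetric])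
    finally show "hessian T F t x a \<bullet> b = hessian T F t x b \<bullet> a" .
  next
    fix s a and y :: "real \<Rightarrow> real ^ 'd" assume s: "0 \<le> s" "s \<le> T" and y: "frozen T \<omega> s y"
    have yb: "s \<in> {0..T}" "y \<in> cadlag T" "y ` {0..s} \<subseteq> \<omega> ` {0..T}"
      using s y by (auto simp: frozen_def)
    have "\<bar>vert_grad T F s y $ i\<bar> \<le> B" for i
      using bnd[OF B(4) yb, of i] by simp
    then have "norm (vert_grad T F s y) \<le> c * B" unfolding c_def by (rule norm_le_components)
    then show "norm (vert_grad T F s y) \<le> L" using L'(3) by simp
    have "\<bar>vert_grad T (vert_comp T F [i]) s y $ j\<bar> \<le> B" for i j
      using bnd[OF B(5) yb, of j i] by simp
    then have g2: "norm (vert_grad T (vert_comp T F [i]) s y) \<le> c * B" for i unfolding c_def by (rule norm_le_components)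
    have "\<bar>hessian T F s y a $ i\<bar> \<le> c * B * norm a" for i
      unfolding hess_comp by (rule order.trans[OF Cauchy_Schwarz_ineq2]) (intro mult_right_mono g2, simp)
    then have "norm (hessian T F s y a) \<le> c * (c * B * norm a)" unfolding c_def by (rule norm_le_components)
    also have "\<dots> = c * (c * B) * norm a" by simp
    also have "\<dots> \<le> L * norm a" by (intro mono L) auto
    finally show "norm (hessian T F s y a) \<le> L * norm a" .
  qed
qed

section \<open>Weighted sums along the partitions\<close>

lemma convergent_if_approximable:
  fixes S :: "nat \<Rightarrow> real"
  assumes "\<And>\<epsilon>. \<epsilon> > 0 \<Longrightarrow> \<exists>c. convergent c \<and> (\<forall>n. \<bar>S n - c n\<bar> \<le> \<epsilon>)"
  shows "convergent S"
proof -
  have "Cauchy S"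
  proof (rule metric_CauchyI)
    fix \<epsilon> :: real assume "0 < \<epsilon>"
    then obtain c where c: "convergent c" "\<And>n. \<bar>S n - c n\<bar> \<le> \<epsilon> / 4"
      using assms[of "\<epsilon> / 4"] by auto
    obtain N where N: "\<And>k n. k \<ge> N \<Longrightarrow> n \<ge> N \<Longrightarrow> dist (c k) (c n) < \<epsilon> / 4"
      using metric_CauchyD[OF convergent_Cauchy[OF c(1)], of "\<epsilon> / 4"] \<open>0 < \<epsilon>\<close> by auto
    have "dist (S k) (S n) < \<epsilon>" if "k \<ge> N" "n \<ge> N" for k n
      using N[OF that] c(2)[of k] c(2)[of n] \<open>0 < \<epsilon>\<close> unfolding dist_real_def by linarith
    then show "\<exists>M. \<forall>k\<ge>M. \<forall>n\<ge>M. dist (S k) (S n) < \<epsilon>" by blast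
  qed
  then show ?thesis by (rule real_Cauchy_convergent)
qed

text \<open>A continuous \<open>f\<close> is uniformly close to a step function, whose weighted
  sums are linear combinations of the sums \<open>W n t\<close> of the weights of the intervals
  that begin before \<open>t\<close>. The hypothesis is about the intervals that end by
  \<open>t\<close>; at most one interval, of vanishing weight, makes the difference.\<close>

lemma weighted_sums_convergent:
  fixes w :: "nat \<Rightarrow> nat \<Rightarrow> real" and f :: "real \<Rightarrow> real"
  assumes \<pi>: "partition_seq T m \<pi>" and T: "0 < T"
    and f: "continuous_on {0..T} f"
    and conv: "\<And>t. t \<in> {0..T} \<Longrightarrow> convergent (\<lambda>n. \<Sum>i | i < m n \<and> \<pi> n (Suc i) \<le> t. w n i)"
    and small: "\<And>n i. i < m n \<Longrightarrow> \<bar>w n i\<bar> \<le> e n" "e \<longlonglongrightarrow> 0"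
    and bound: "\<And>n. (\<Sum>i<m n. \<bar>w n i\<bar>) \<le> B"
  shows "convergent (\<lambda>n. \<Sum>i<m n. f (\<pi> n i) * w n i)"
proof -
  have \<pi>': "\<pi> n 0 = 0" "\<pi> n (m n) = T" "\<forall>i<m n. \<pi> n i < \<pi> n (Suc i)" for n
    using \<pi> by (auto simp: partition_seq_def)
  define W where "W n t = (\<Sum>i<m n. if \<pi> n i < t then w n i else 0)" for n t
  \<comment> \<open>\<open>W n t\<close> differs from the sum in the hypothesis by the interval that contains \<open>t\<close> in its interior\<close>
  have W_conv: "convergent (\<lambda>n. W n t)" if t: "t \<in> {0..T}" for t
  proof -
    define V where "V n = (\<Sum>i | i < m n \<and> \<pi> n (Suc i) \<le> t. w n i)" for n
    have "\<bar>W n t - V n\<bar> \<le> e n" for n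
    proof -
      let ?A = "{i. i < m n \<and> \<pi> n (Suc i) \<le> t}" and ?X = "{i. i < m n \<and> \<pi> n i < t \<and> t < \<pi> n (Suc i)}"
      have "W n t = (\<Sum>i | i < m n \<and> \<pi> n i < t. w n i)"
        unfolding W_def by (simp add: sum.inter_filter[symmetric])
      also have "{i. i < m n \<and> \<pi> n i < t} = ?A \<union> ?X"
        using \<pi>'(3)[of n] by force
      also have "sum (w n) (?A \<union> ?X) = V n + sum (w n) ?X"
        unfolding V_def by (rule sum.union_disjoint) auto
      finally have eq: "W n t - V n = sum (w n) ?X" by simp
      have one: "i = j" if "i \<in> ?X" "j \<in> ?X" for i j
      proof (rule ccontr)
        assume "i \<noteq> j"
        then consider "Suc i \<le> j" | "Suc j \<le> i" by linarith
        then show False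
        proof cases
          case 1
          then show False using partition_mono[OF \<pi>'(3), of "Suc i" j n] that by auto
        next
          case 2
          then show False using partition_mono[OF \<pi>'(3), of "Suc j" i n] that by auto
        qed
      qed
      show ?thesis
      proof (cases "?X = {}")
        case True
        have "0 < m n" using \<pi>'[of n] T by (cases "m n") auto
        then show ?thesis using eq True small(1)[of 0 n] by simp
      next
        case False
        then obtain i where i: "i \<in> ?X" by blast
        then have "?X = {i}" "i < m n" using one by blast+
        then show ?thesis using eq small(1)[of i n] by simp
      qed
    qed
    then have "(\<lambda>n. W n t - V n) \<longlonglongrightarrow> 0"
      by (intro Lim_null_comparison[OF _ small(2)]) auto
    then have "convergent (\<lambda>n. W n t - V n)" by (rule convergentI)
    moreover have "convergent V" unfolding V_def[abs_def] by (rule conv[OF t])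
    ultimately have "convergent (\<lambda>n. (W n t - V n) + V n)" by (rule convergent_add)
    then show ?thesis by simp
  qed
  have B: "0 \<le> B" using order.trans[OF sum_nonneg bound[of 0]] by simp
  show ?thesis
  proof (rule convergent_if_approximable)
    fix \<epsilon> :: real assume \<epsilon>: "0 < \<epsilon>"
    have "uniformly_continuous_on {0..T} f"
      using f by (rule compact_uniformly_continuous) simp
    moreover have "0 < \<epsilon> / (B + 1)" using \<epsilon> B by simp
    ultimately obtain \<delta> where \<delta>: "0 < \<delta>"
      "\<And>s t. s \<in> {0..T} \<Longrightarrow> t \<in> {0..T} \<Longrightarrow> dist s t < \<delta> \<Longrightarrow> dist (f s) (f t) < \<epsilon> / (B + 1)"
      unfolding uniformly_continuous_on_def by metis
    obtain N where N: "T / \<delta> < real N" using reals_Archimedean2 by blast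
    have N0: "0 < real N" using N T \<delta>(1) by (smt (verit) divide_pos_pos)
    define u where "u k = T * real k / real N" for k
    have u: "u 0 = 0" "u N = T" using N0 by (auto simp: u_def)
    have u_step: "u (Suc k) - u k < \<delta>" for k
    proof -
      have "u (Suc k) - u k = T / real N" using N0 by (simp add: u_def field_simps)
      also have "\<dots> < \<delta>" using N N0 \<delta>(1) by (simp add: field_simps)
      finally show ?thesis .
    qed
    have u_mono: "u i \<le> u j" if "i \<le> j" for i j
      using that T N0 unfolding u_def by (intro divide_right_mono mult_left_mono) auto
    have u_range: "u k \<in> {0..T}" if "k \<le> N" for k
      using u_mono[of 0 k] u_mono[of k N] u that by simp
    define c where "c n = (\<Sum>k<N. f (u k) * (W n (u (Suc k)) - W n (u k)))" for n
    have "convergent c"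
      unfolding c_def using u_range
      by (intro convergent_sum convergent_mult convergent_const convergent_diff W_conv) auto
    moreover have "\<bar>(\<Sum>i<m n. f (\<pi> n i) * w n i) - c n\<bar> \<le> \<epsilon>" for n
    proof -
      define step where "step i k = (if \<pi> n i < u (Suc k) then 1 else 0) - (if \<pi> n i < u k then 1 else (0::real))" for i k
      define a where "a i = (\<Sum>k<N. f (u k) * step i k)" for i
      have "c n = (\<Sum>k<N. \<Sum>i<m n. f (u k) * step i k * w n i)"
        unfolding c_def W_def step_def sum_subtractf[symmetric] sum_distrib_left by (intro sum.cong) auto
      also have "\<dots> = (\<Sum>i<m n. a i * w n i)"
        unfolding a_def sum_distrib_right by (rule sum.swap)
      finally have "(\<Sum>i<m n. f (\<pi> n i) * w n i) - c n = (\<Sum>i<m n. (f (\<pi> n i) - a i) * w n i)"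
        by (simp add: sum_subtractf left_diff_distrib)
      moreover have "\<bar>f (\<pi> n i) - a i\<bar> \<le> \<epsilon> / (B + 1)" if i: "i < m n" for i
      proof -
        have r: "0 \<le> \<pi> n i" "\<pi> n i < T"
          using partition_mono[OF \<pi>'(3), of 0 i n] partition_mono[OF \<pi>'(3), of "Suc i" "m n" n] \<pi>'[of n] i
          by (auto simp: less_le_trans)
        then obtain j where j: "j < N" "\<pi> n i \<in> {u j..<u (Suc j)}"
          using partition_locate[of u "\<pi> n i" N] u by auto
        have "step i k = (if k = j then 1 else 0)" for k
        proof -
          consider "k = j" | "Suc k \<le> j" | "Suc j \<le> k" by linarith
          then show ?thesis
          proof cases
            case 1
            then show ?thesis using j(2) by (simp add: step_def)
          next
            case 2
            then show ?thesis using j(2) u_mono[of "Suc k" j] u_mono[of k j] by (auto simp: step_def)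
          next
            case 3
            then show ?thesis using j(2) u_mono[of "Suc j" k] u_mono[of "Suc j" "Suc k"] by (auto simp: step_def)
          qed
        qed
        then have "a i = (\<Sum>k<N. if k = j then f (u k) else 0)"
          unfolding a_def by (intro sum.cong) auto
        then have a: "a i = f (u j)" using j(1) by simp
        have "dist (\<pi> n i) (u j) < \<delta>"
          using j(2) u_step[of j] by (auto simp: dist_real_def)
        then have "dist (f (\<pi> n i)) (f (u j)) < \<epsilon> / (B + 1)"
          using r u_range[of j] j(1) by (intro \<delta>(2)) auto
        then show ?thesis unfolding a by (simp add: dist_real_def)
      qed
      then have "\<bar>\<Sum>i<m n. (f (\<pi> n i) - a i) * w n i\<bar> \<le> (\<Sum>i<m n. \<epsilon> / (B + 1) * \<bar>w n i\<bar>)"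
        by (intro order.trans[OF sum_abs] sum_mono, unfold abs_mult) (intro mult_right_mono, auto)
      moreover have "(\<Sum>i<m n. \<epsilon> / (B + 1) * \<bar>w n i\<bar>) \<le> \<epsilon> / (B + 1) * B"
        unfolding sum_distrib_left[symmetric] using bound \<epsilon> B by (intro mult_left_mono) auto
      moreover have "\<epsilon> / (B + 1) * B \<le> \<epsilon>" using \<epsilon> B by (simp add: field_simps)
      ultimately show ?thesis by linarith
    qed
    ultimately show "\<exists>c. convergent c \<and> (\<forall>n. \<bar>(\<Sum>i<m n. f (\<pi> n i) * w n i) - c n\<bar> \<le> \<epsilon>)" by blast
  qed
qed

text \<open>Polarization: \<open>2ab = (a+b)\<^sup>2 - a\<^sup>2 - b\<^sup>2\<close>.\<close>

lemma quadratic_covariation_convergent: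
  fixes \<omega> :: "real \<Rightarrow> real ^ 'd::finite"
  assumes \<pi>: "partition_seq T m \<pi>" and \<omega>: "\<omega> \<in> finite_qv T m \<pi>" and t: "t \<in> {0..T}"
  shows "convergent (\<lambda>n. \<Sum>i | i < m n \<and> \<pi> n (Suc i) \<le> t.
     (\<omega> (\<pi> n (Suc i)) - \<omega> (\<pi> n i)) $ a * (\<omega> (\<pi> n (Suc i)) - \<omega> (\<pi> n i)) $ b)"
proof -
  have \<pi>': "\<pi> n 0 = 0" "\<pi> n (m n) = T" "\<forall>i<m n. \<pi> n i < \<pi> n (Suc i)" for n
    using \<pi> by (auto simp: partition_seq_def)
  have range: "\<pi> n i \<in> {0..T}" if "i \<le> m n" for n i
    using partition_mono[OF \<pi>'(3), of 0 i n] partition_mono[OF \<pi>'(3), of i "m n" n] \<pi>'[of n] that by auto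
  define S where "S x n = (\<Sum>i | i < m n \<and> \<pi> n (Suc i) \<le> t. (x (\<pi> n (Suc i)) - x (\<pi> n i))\<^sup>2)"
    for x :: "real \<Rightarrow> real" and n
  have restr: "S (restrict x {0..T}) = S x" for x
    unfolding S_def using range by (intro ext sum.cong) auto
  have qv: "convergent (S x)" if "restrict x {0..T} \<in> finite_qv_real T m \<pi>" for x
    using that t unfolding finite_qv_real_def restr[of x, symmetric] S_def convergent_def by blast
  have "convergent (S (\<lambda>s. \<omega> s $ i))" "convergent (S (\<lambda>s. \<omega> s $ i + \<omega> s $ j))" for i j
    using \<omega> by (auto intro!: qv simp: finite_qv_def)
  then have "convergent (\<lambda>n. 1 / 2 * (S (\<lambda>s. \<omega> s $ a + \<omega> s $ b) n - S (\<lambda>s. \<omega> s $ a) n - S (\<lambda>s. \<omega> s $ b) n))"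
    by (intro convergent_mult convergent_diff convergent_const)
  also have "(\<lambda>n. 1 / 2 * (S (\<lambda>s. \<omega> s $ a + \<omega> s $ b) n - S (\<lambda>s. \<omega> s $ a) n - S (\<lambda>s. \<omega> s $ b) n))
      = (\<lambda>n. \<Sum>i | i < m n \<and> \<pi> n (Suc i) \<le> t.
     (\<omega> (\<pi> n (Suc i)) - \<omega> (\<pi> n i)) $ a * (\<omega> (\<pi> n (Suc i)) - \<omega> (\<pi> n i)) $ b)"
    unfolding S_def sum_subtractf[symmetric] sum_distrib_left
    by (intro ext sum.cong) (auto simp: power2_eq_square algebra_simps)
  finally show ?thesis .
qed

lemma sum_norm_squared_bounded:
  fixes \<omega> :: "real \<Rightarrow> real ^ 'd::finite"
  assumes \<pi>: "partition_seq T m \<pi>" and \<omega>: "\<omega> \<in> finite_qv T m \<pi>" and T: "0 \<le> T"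
  obtains B where "\<And>n. (\<Sum>i<m n. (norm (\<omega> (\<pi> n (Suc i)) - \<omega> (\<pi> n i)))\<^sup>2) \<le> B"
proof -
  have \<pi>': "\<pi> n 0 = 0" "\<pi> n (m n) = T" "\<forall>i<m n. \<pi> n i < \<pi> n (Suc i)" for n
    using \<pi> by (auto simp: partition_seq_def)
  have eq: "{i. i < m n \<and> \<pi> n (Suc i) \<le> T} = {..<m n}" for n
    using partition_mono[OF \<pi>'(3), of "Suc _" "m n" n] \<pi>'[of n] by auto
  have "convergent (\<lambda>n. \<Sum>a\<in>UNIV. \<Sum>i | i < m n \<and> \<pi> n (Suc i) \<le> T.
     (\<omega> (\<pi> n (Suc i)) - \<omega> (\<pi> n i)) $ a * (\<omega> (\<pi> n (Suc i)) - \<omega> (\<pi> n i)) $ a)"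
    using T by (intro convergent_sum quadratic_covariation_convergent[OF \<pi> \<omega>]) auto
  also have "(\<lambda>n. \<Sum>a\<in>UNIV. \<Sum>i | i < m n \<and> \<pi> n (Suc i) \<le> T.
     (\<omega> (\<pi> n (Suc i)) - \<omega> (\<pi> n i)) $ a * (\<omega> (\<pi> n (Suc i)) - \<omega> (\<pi> n i)) $ a)
     = (\<lambda>n. \<Sum>i<m n. (norm (\<omega> (\<pi> n (Suc i)) - \<omega> (\<pi> n i)))\<^sup>2)"
    unfolding eq by (subst sum.swap) (simp add: power2_norm_eq_inner inner_vec_def)
  finally have "Bseq (\<lambda>n. \<Sum>i<m n. (norm (\<omega> (\<pi> n (Suc i)) - \<omega> (\<pi> n i)))\<^sup>2)"
    by (rule convergent_imp_Bseq)
  then obtain K where "\<And>n. norm (\<Sum>i<m n. (norm (\<omega> (\<pi> n (Suc i)) - \<omega> (\<pi> n i)))\<^sup>2) \<le> K"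
    by (auto simp: Bseq_def)
  then show ?thesis using that[of K] by (auto simp: abs_le_iff)
qed

section \<open>Convergence of the Riemann sums to the pathwise integral\<close>

text \<open>The expansion is used with the exponent \<open>\<mu> = min \<nu> (1/2)\<close>. The
  lower bound on \<open>\<nu>\<close> enters through \<open>\<mu> > 3/7\<close>, which gives
  \<open>2\<mu> + \<mu>\<^sup>2 > 51/49\<close>.\<close>

lemma regular_sums_limit:
  fixes \<omega> :: "real \<Rightarrow> real ^ 'd::finite" and F :: "('d, real) functional"
  assumes T: "T > 0" and \<pi>: "partition_seq T m \<pi>" and \<omega>: "\<omega> \<in> finite_qv T m \<pi>"
    and \<nu>: "(sqrt 13 - 1) / 6 < \<nu>" and hol: "\<omega> \<in> holder_paths T \<nu>"
    and osc: "(\<lambda>n. MAX j\<in>{..<m n}. SUP t\<in>{\<pi> n j<..\<pi> n (Suc j)}. norm (\<omega> t - \<omega> (\<pi> n j))) \<longlonglongrightarrow> 0"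
    and F: "F \<in> regular_functionals T"
  shows "\<exists>l. pathwise_sum T m \<pi> F \<omega> \<longlonglongrightarrow> l \<and>
    (\<lambda>n. \<Sum>i<m n. vert_grad T F (\<pi> n i) \<omega> \<bullet> (\<omega> (\<pi> n (Suc i)) - \<omega> (\<pi> n i))) \<longlonglongrightarrow> l"
proof -
  have \<pi>': "\<pi> n 0 = 0" "\<pi> n (m n) = T" "\<forall>i<m n. \<pi> n i < \<pi> n (Suc i)" for n
    using \<pi> by (auto simp: partition_seq_def)
  have range: "\<pi> n i \<in> {0..T}" if "i \<le> m n" for n i
    using partition_mono[OF \<pi>'(3), of 0 i n] partition_mono[OF \<pi>'(3), of i "m n" n] \<pi>'[of n] that by auto
  have m0: "0 < m n" for n using \<pi>'[of n] T by (cases "m n") auto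
  have path: "\<omega> \<in> cadlag T" using \<omega> by (simp add: finite_qv_def)
  obtain C where C: "\<And>s t. s \<in> {0..T} \<Longrightarrow> t \<in> {0..T} \<Longrightarrow> norm (\<omega> t - \<omega> s) \<le> C * \<bar>t - s\<bar> powr \<nu>"
    using hol unfolding holder_paths_def by blast

  have "(25 / 7)\<^sup>2 < (13::real)" by (simp add: power2_eq_square)
  then have "25 / 7 < sqrt 13" by (rule real_less_rsqrt)
  then have "(25 / 7 - 1) / 6 < (sqrt 13 - 1) / 6" by (intro divide_strict_right_mono) auto
  also note \<nu>
  finally have \<nu>37: "3 / 7 < \<nu>" by simp
  define \<mu> where "\<mu> = min \<nu> (1 / 2)"
  have \<mu>: "3 / 7 < \<mu>" "\<mu> \<le> 1 / 2" "\<mu> \<le> \<nu>" using \<nu>37 by (auto simp: \<mu>_def)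
  have "(3 / 7)\<^sup>2 \<le> \<mu>\<^sup>2" using \<mu> by (intro power_mono) auto
  then have \<mu>2: "1 < 2 * \<mu> + \<mu>\<^sup>2" using \<mu> by (simp add: power2_eq_square)
  have hol': "norm (\<omega> t - \<omega> s) \<le> \<bar>C\<bar> * T powr (\<nu> - \<mu>) * \<bar>t - s\<bar> powr \<mu>"
    if st: "s \<in> {0..T}" "t \<in> {0..T}" for s t
  proof (cases "s = t")
    case False
    have "norm (\<omega> t - \<omega> s) \<le> C * \<bar>t - s\<bar> powr \<nu>" by (rule C[OF st])
    also have "\<dots> \<le> \<bar>C\<bar> * \<bar>t - s\<bar> powr \<nu>" by (intro mult_right_mono) auto
    also have "\<dots> \<le> \<bar>C\<bar> * (T powr (\<nu> - \<mu>) * \<bar>t - s\<bar> powr \<mu>)"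
      using st False \<mu> by (intro mult_left_mono powr_le_scaled) auto
    finally show ?thesis by simp
  qed simp
  obtain L where "path_expansion T \<mu> L \<omega> F (horiz_deriv T F) (vert_grad T F) (hessian T F)"
    using regular_path_expansion[OF F T _ \<mu>(2) \<mu>2 path hol'] \<mu>(1) by auto
  then interpret path_expansion T \<mu> L \<omega> F "horiz_deriv T F" "vert_grad T F" "hessian T F" .

  define e where "e n = (MAX j\<in>{..<m n}. SUP t\<in>{\<pi> n j<..\<pi> n (Suc j)}. norm (\<omega> t - \<omega> (\<pi> n j)))" for n
  have e_osc: "norm (\<omega> r - \<omega> (\<pi> n j)) \<le> e n" if j: "j < m n" and r: "r \<in> {\<pi> n j<..\<pi> n (Suc j)}" for n j r
  proof -
    have "bdd_above ((\<lambda>t. norm (\<omega> t - \<omega> (\<pi> n j))) ` {\<pi> n j<..\<pi> n (Suc j)})"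
    proof (rule bdd_aboveI2)
      fix t assume "t \<in> {\<pi> n j<..\<pi> n (Suc j)}"
      then show "norm (\<omega> t - \<omega> (\<pi> n j)) \<le> L * T powr \<mu>"
        using range[of j n] range[of "Suc j" n] j by (intro increment_bound) auto
    qed
    then have "norm (\<omega> r - \<omega> (\<pi> n j)) \<le> (SUP t\<in>{\<pi> n j<..\<pi> n (Suc j)}. norm (\<omega> t - \<omega> (\<pi> n j)))"
      using r by (intro cSUP_upper)
    also have "\<dots> \<le> e n" unfolding e_def using j by (intro Max_ge) auto
    finally show ?thesis .
  qed
  have e0: "0 \<le> e n" for n
    using order.trans[OF norm_ge_zero e_osc[of 0 n "\<pi> n (Suc 0)"]] m0[of n] \<pi>'(3)[of n] by auto
  have e_osc': "norm (\<omega> r - \<omega> (\<pi> n j)) \<le> e n" if "j < m n" "r \<in> {\<pi> n j..\<pi> n (Suc j)}" for n j r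
    using e_osc[OF that(1), of r] e0[of n] that by (cases "r = \<pi> n j") auto
  have e_lim: "e \<longlonglongrightarrow> 0" unfolding e_def[abs_def] by (rule osc)

  define \<Delta> where "\<Delta> n i = \<omega> (\<pi> n (Suc i)) - \<omega> (\<pi> n i)" for n i
  obtain B where B: "\<And>n. (\<Sum>i<m n. (norm (\<Delta> n i))\<^sup>2) \<le> B"
    using sum_norm_squared_bounded[OF \<pi> \<omega>] T unfolding \<Delta>_def by auto
  have \<Delta>_le: "norm (\<Delta> n i) \<le> e n" if "i < m n" for n i
    unfolding \<Delta>_def using that \<pi>'(3)[of n] by (intro e_osc) auto
  have prod_le: "\<bar>\<Delta> n i $ a * \<Delta> n i $ b\<bar> \<le> (norm (\<Delta> n i))\<^sup>2" for n i a b
    unfolding abs_mult power2_eq_square by (intro mult_mono component_le_norm_cart) auto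
  have "convergent (\<lambda>n. \<Sum>i<m n. vert_comp T F [b, a] (\<pi> n i) \<omega> * (\<Delta> n i $ a * \<Delta> n i $ b))" for a b
  proof (rule weighted_sums_convergent[OF \<pi> T])
    have "continuous_on {0..T} (\<lambda>t. hessian T F t \<omega> (axis b 1) $ a)"
      by (intro continuous_intros hessian_continuous)
    then show "continuous_on {0..T} (\<lambda>t. vert_comp T F [b, a] t \<omega>)"
      by (simp add: hessian_def inner_axis)
    show "convergent (\<lambda>n. \<Sum>i | i < m n \<and> \<pi> n (Suc i) \<le> t. \<Delta> n i $ a * \<Delta> n i $ b)" if "t \<in> {0..T}" for t
      unfolding \<Delta>_def by (rule quadratic_covariation_convergent[OF \<pi> \<omega> that])
    show "\<bar>\<Delta> n i $ a * \<Delta> n i $ b\<bar> \<le> (e n)\<^sup>2" if "i < m n" for n i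
      using order.trans[OF prod_le power_mono[OF \<Delta>_le[OF that] norm_ge_zero]] .
    show "(\<lambda>n. (e n)\<^sup>2) \<longlonglongrightarrow> 0" using tendsto_power[OF e_lim, of 2] by simp
    show "(\<Sum>i<m n. \<bar>\<Delta> n i $ a * \<Delta> n i $ b\<bar>) \<le> B" for n
      by (rule order.trans[OF sum_mono[OF prod_le] B])
  qed
  then have "convergent (\<lambda>n. \<Sum>a\<in>UNIV. \<Sum>b\<in>UNIV. \<Sum>i<m n. vert_comp T F [b, a] (\<pi> n i) \<omega> * (\<Delta> n i $ a * \<Delta> n i $ b))"
    by (intro convergent_sum)
  also have "(\<lambda>n. \<Sum>a\<in>UNIV. \<Sum>b\<in>UNIV. \<Sum>i<m n. vert_comp T F [b, a] (\<pi> n i) \<omega> * (\<Delta> n i $ a * \<Delta> n i $ b))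
      = (\<lambda>n. \<Sum>i<m n. hessian T F (\<pi> n i) \<omega> (\<Delta> n i) \<bullet> \<Delta> n i)"
  proof
    fix n
    have "(\<Sum>a\<in>UNIV. \<Sum>b\<in>UNIV. \<Sum>i<m n. vert_comp T F [b, a] (\<pi> n i) \<omega> * (\<Delta> n i $ a * \<Delta> n i $ b))
        = (\<Sum>a\<in>UNIV. \<Sum>i<m n. \<Sum>b\<in>UNIV. vert_comp T F [b, a] (\<pi> n i) \<omega> * (\<Delta> n i $ a * \<Delta> n i $ b))"
      by (intro sum.cong refl sum.swap)
    also have "\<dots> = (\<Sum>i<m n. \<Sum>a\<in>UNIV. \<Sum>b\<in>UNIV. vert_comp T F [b, a] (\<pi> n i) \<omega> * (\<Delta> n i $ a * \<Delta> n i $ b))"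
      by (rule sum.swap)
    also have "\<dots> = (\<Sum>i<m n. hessian T F (\<pi> n i) \<omega> (\<Delta> n i) \<bullet> \<Delta> n i)"
      unfolding hessian_inner by (simp only: mult.commute[of "\<Delta> n _ $ _" "\<Delta> n _ $ _"])
    finally show "(\<Sum>a\<in>UNIV. \<Sum>b\<in>UNIV. \<Sum>i<m n. vert_comp T F [b, a] (\<pi> n i) \<omega> * (\<Delta> n i $ a * \<Delta> n i $ b))
      = (\<Sum>i<m n. hessian T F (\<pi> n i) \<omega> (\<Delta> n i) \<bullet> \<Delta> n i)" .
  qed
  finally obtain q where q: "(\<lambda>n. \<Sum>i<m n. hessian T F (\<pi> n i) \<omega> (\<Delta> n i) \<bullet> \<Delta> n i) \<longlonglongrightarrow> q"
    by (auto simp: convergent_def)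

  define l where "l = F T \<omega> - F 0 \<omega> - integral {0..T} (\<lambda>u. horiz_deriv T F u \<omega>) - q / 2"
  note lims = riemann_sums_converge[OF \<pi> e_osc' e0 e_lim B[unfolded \<Delta>_def] q[unfolded \<Delta>_def], folded l_def]
  define P where "P n = (\<Sum>i<m n. vert_grad T F (\<pi> n i) (step_path (\<pi> n) i) \<bullet> (\<omega> (\<pi> n (Suc i)) - \<omega> (\<pi> n i)))" for n
  have "\<bar>pathwise_sum T m \<pi> F \<omega> n - P n\<bar> \<le> L * (e n)\<^sup>2" for n
  proof -
    have "\<bar>pathwise_sum T m \<pi> F \<omega> n - P n\<bar> \<le> L * (norm (\<omega> (\<pi> n 1) - \<omega> (\<pi> n 0)))\<^sup>2"
      unfolding pathwise_sum_def P_def by (rule pathwise_integrand_correction[OF \<pi>'])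
    also have "\<dots> \<le> L * (e n)\<^sup>2"
      using \<Delta>_le[OF m0] L_ge_1 by (intro mult_left_mono power_mono) (auto simp: \<Delta>_def)
    finally show ?thesis .
  qed
  moreover have "(\<lambda>n. L * (e n)\<^sup>2) \<longlonglongrightarrow> L * 0\<^sup>2" by (intro tendsto_intros e_lim)
  ultimately have "(\<lambda>n. pathwise_sum T m \<pi> F \<omega> n - P n) \<longlonglongrightarrow> 0"
    by (intro Lim_null_comparison[where g = "\<lambda>n. L * (e n)\<^sup>2" and f = "\<lambda>n. pathwise_sum T m \<pi> F \<omega> n - P n"]) auto
  from tendsto_add[OF this lims(2)[folded P_def]] have "pathwise_sum T m \<pi> F \<omega> \<longlonglongrightarrow> l" by simp
  then show ?thesis using lims(1) by blast
qed

theorem theorem3p2: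
  fixes T \<nu> :: real
    and m :: "nat \<Rightarrow> nat" and \<pi> :: "nat \<Rightarrow> nat \<Rightarrow> real"
    and \<omega> :: "real \<Rightarrow> real ^ 'd::finite"
    and F :: "('d, real) functional"
  assumes "T > 0"
    and "partition_seq T m \<pi>"
    and "\<omega> \<in> finite_qv T m \<pi>"
    and "(sqrt 13 - 1) / 6 < \<nu>" and "\<nu> < 1"
    and "\<omega> \<in> holder_paths T \<nu>"
    and "(\<lambda>n. MAX j\<in>{..<m n}. SUP t\<in>{\<pi> n j<..\<pi> n (Suc j)}. norm (\<omega> t - \<omega> (\<pi> n j)))
           \<longlonglongrightarrow> 0"
    and "F \<in> regular_functionals T"
  shows "convergent (pathwise_sum T m \<pi> F \<omega>) \<and>
    (\<lambda>n. \<Sum>i<m n. vert_grad T F (\<pi> n i) \<omega> \<bullet> (\<omega> (\<pi> n (Suc i)) - \<omega> (\<pi> n i)))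
      \<longlonglongrightarrow> pathwise_integral T m \<pi> F \<omega> \<and>
    (\<forall>G\<in>regular_functionals T.
       (\<forall>t\<in>{0..T}. vert_grad T G t \<omega> = vert_grad T F t \<omega>) \<longrightarrow>
       pathwise_integral T m \<pi> G \<omega> = pathwise_integral T m \<pi> F \<omega>) \<and>
    ((\<forall>t\<in>{0..T}. vert_grad T F t \<omega> = 0) \<longrightarrow> pathwise_integral T m \<pi> F \<omega> = 0)"
proof -
  define R where "R G n = (\<Sum>i<m n. vert_grad T G (\<pi> n i) \<omega> \<bullet> (\<omega> (\<pi> n (Suc i)) - \<omega> (\<pi> n i)))"
    for G :: "('d, real) functional" and n
  have main: "convergent (pathwise_sum T m \<pi> G \<omega>)" "R G \<longlonglongrightarrow> pathwise_integral T m \<pi> G \<omega>"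
    if G: "G \<in> regular_functionals T" for G
  proof -
    obtain l where l: "pathwise_sum T m \<pi> G \<omega> \<longlonglongrightarrow> l" "R G \<longlonglongrightarrow> l"
      using regular_sums_limit[OF assms(1-4,6,7) G] unfolding R_def by blast
    then show "convergent (pathwise_sum T m \<pi> G \<omega>)" "R G \<longlonglongrightarrow> pathwise_integral T m \<pi> G \<omega>"
      by (auto simp: convergent_def pathwise_integral_def limI)
  qed
  have range: "\<pi> n i \<in> {0..T}" if "i < m n" for n i
    using partition_mono[of "m n" "\<pi> n" 0 i] partition_mono[of "m n" "\<pi> n" i "m n"] assms(2) that
    by (auto simp: partition_seq_def)
  have "pathwise_integral T m \<pi> G \<omega> = pathwise_integral T m \<pi> F \<omega>"
    if G: "G \<in> regular_functionals T" and eq: "\<forall>t\<in>{0..T}. vert_grad T G t \<omega> = vert_grad T F t \<omega>" for G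
  proof -
    have "R G = R F" unfolding R_def using eq range by (intro ext sum.cong) auto
    then show ?thesis using main(2)[OF G] main(2)[OF assms(8)] LIMSEQ_unique by metis
  qed
  moreover have "pathwise_integral T m \<pi> F \<omega> = 0" if "\<forall>t\<in>{0..T}. vert_grad T F t \<omega> = 0"
  proof -
    have "R F = (\<lambda>n. 0)" unfolding R_def using that range by (intro ext sum.neutral) auto
    then show ?thesis using main(2)[OF assms(8)] LIMSEQ_unique[OF tendsto_const] by metis
  qed
  ultimately show ?thesis using main[OF assms(8)] unfolding R_def by blast
qed

end
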